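(* The map $\mathbb{G}_a^n\times\mathcal{A}_n\to\mathcal{A}_n$ given by $$a\cdot(\Sigma,\preceq,p_\infty,\omega_\bullet,p_1,\dots,p_n)=(\Sigma,\preceq,p_\infty,\omega_\bullet,p_1+a_1,\dots,p_n+a_n),\qquad a=(a_1,\dots,a_n),$$ defines an action in the category of algebraic varieties, which induces an action of $G=\mathbb{G}_a^n/\Delta$ (where $\Delta$ is the diagonal subgroup) on $\mathcal{A}_n$ with respect to which the inclusion $\mathbb{A}^n/\mathbb{G}_a\hookrightarrow\mathcal{A}_n$ is equivariant.
   Context: Everything is over $\mathbb{C}$; $[k]=\{0<1<\dots<k\}$. Multiscaled lines. A multiscaled line is a tuple $(\Sigma,p_\infty,\preceq,\omega_\bullet)$ where: (1) $\Sigma$ is a connected (complete) nodal complex curve of arithmetic genus $0$ with a smooth marked point $p_\infty$; its dual graph is a tree with vertex set $V(\Sigma)$, $\Sigma_v$ is the component of $v$, and the root $v_0$ is the vertex whose component contains $p_\infty$. Write $v\subseteq u$ if $v$ lies on the simple path from $u$ to $v_0$; $u\wedge v$ is the $\subseteq$-maximal vertex common to the simple paths from $u$ and from $v$ to $v_0$; terminal vertices are the $\subseteq$-maximal ones. (2) $\preceq$ is a total preorder on $V(\Sigma)$ such that (a) each $v\neq v_0$ has a unique adjacent $w$ with $w\prec v$ (the corresponding node is the descending node of $v$), and (b) any two terminal vertices are equivalent, where $v\sim w$ means $v\preceq w$ and $w\preceq v$. (3) For each $v$, $\omega_v$ is a meromorphic differential on $\Sigma_v$ with a pole of order $2$ at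 the descending node of $v$ (at $p_\infty$ if $v=v_0$) and no other zeros or poles. An $n$-marked multiscaled line has in addition smooth points $p_1,\dots,p_n$ (which may coincide with each other but not with $p_\infty$) lying on terminal components. It is stable if every terminal component contains at least one $p_i$ and every nonterminal component contains at least $3$ nodes, or at least $2$ nodes and $p_\infty$. A complex projective isomorphism is an isomorphism of curves $f:\Sigma\to\Sigma'$ preserving preorders and all marked points, with $f^*(\omega'_v)=c_v\omega_v$ for constants $c_v\in\mathbb{C}^*$ such that $c_v=c_w$ if $v\sim w$ and $c_v=1$ if $v$ is terminal. $\mathcal{A}_n$ is the set of complex projective isomorphism classes of stable $n$-marked multiscaled lines. Dual level trees. $\Gamma(\Sigma)$ is the dual tree of $\Sigma$ with root $v_0$, preorder $\preceq$ and marking $h:\{1,\dots,n\}\to V(\Sigma)$, $h(i)=v$ if $p_i\in\Sigma_v$. A dual level tree is any marked preordered rooted tree arising this way. Its level function is the order-preserving map $\lambda: V\to V/{\sim}\cong[\ell]$; $\ell$ is its length. A contraction $\Gamma\twoheadrightarrow\Gamma'$ is a surjection $f$ on vertices, compatible with the markings, such that $v\preceq w\Rightarrow f(v)\preceq' f(w)$, adjacent vertices have equal or adjacent images, and fibers span connected subgraphs. Variety structure. $\Pi_{ij}:\mathcal{A}_n\to\mathbb{P}^1$: $\Pi_{ij}(\Sigma)=\int_{p_i}^{p_j}\omega_v$ (any path in the smooth locus of $\Sigma_v$) if $p_i,p_j$ lie on the same terminal component $\Sigma_v$, and $\Pi_{ij}(\Sigma)=\infty$ otherwise. $I_{ij}(\Sigma)=\int_{n_i}^{n_j}\omega_v$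 where $v=h(i)\wedge h(j)$ in $\Gamma(\Sigma)$, and $n_i,n_j$ are $p_i,p_j$ if $h(i)=h(j)$, and otherwise the nodes of $\Sigma_v$ through which $\Sigma_v$ is connected to $\Sigma_{h(i)},\Sigma_{h(j)}$. For a dual level tree $\Gamma$ of length $\ell$ with marking $h$, $U_\Gamma\subset\mathcal{A}_n$ is the set of $\Sigma$ such that there is a contraction $\Gamma\twoheadrightarrow\Gamma(\Sigma)$ and $\Pi_{ij}(\Sigma)\neq0$ whenever $h(i)\neq h(j)$ in $\Gamma$. Choose, for each $0\le m\le\ell-1$, a pair $(i_m,j_m)$ such that $v_m:=h(i_m)\wedge h(j_m)$ is on level $m$ of $\Gamma$; let $v_\ell$ be any terminal vertex. For $\Sigma\in U_\Gamma$ with (unique) contraction $f:\Gamma\twoheadrightarrow\Gamma(\Sigma)$ put $s_\ell=1$, $s_m=I_{i_mj_m}(\Sigma)$ for $m<\ell$; for $1\le m\le\ell$, $t_m=s_m/s_{m-1}$ if $f(v_m)\sim f(v_{m-1})$ and $t_m=0$ otherwise; $z_{ij}=I_{ij}(\Sigma)/s_m$ if $h(i)\wedge h(j)$ is on level $m$ of $\Gamma$. With $A$ (resp. $B$) the set of pairs $i<j$ with $h(i)\ne h(j)$ (resp. $h(i)=h(j)$) in $\Gamma$, this gives a map $\psi_\Gamma=(z_{ij},t_m):U_\Gamma\to(\mathbb{C}^* )^A\times\mathbb{C}^B\times\mathbb{C}^\ell$. $\mathcal{A}_n$ carries the unique structure of algebraic variety such that all $U_\Gamma$ are Zariski open and all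 $\psi_\Gamma$ are closed immersions; it is smooth and proper of dimension $n-1$. The map $[z_1,\dots,z_n]\mapsto(\mathbb{P}^1,\infty,dz,z_1,\dots,z_n)$ identifies $\mathbb{A}^n/\mathbb{G}_a$ (quotient by simultaneous translation) with the open dense subset of $\mathcal{A}_n$ of classes with irreducible curve. The action. $p_i+a_i$ denotes the translate of $p_i$ by $a_i$ in its terminal component $\Sigma_{h(i)}$: choose an isomorphism of $\Sigma_{h(i)}$ minus its descending node (minus $p_\infty$ if $\Sigma$ is irreducible) with $\mathbb{A}^1=\operatorname{Spec}\mathbb{C}[z]$ such that $dz$ pulls back to $\omega_{h(i)}$, and translate by $a_i$ in the coordinate $z$. $G$ acts on $\mathbb{A}^n/\mathbb{G}_a$ by translation. *)

theory Defs
  imports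
    "HOL-Analysis.Analysis"
    "HOL-Complex_Analysis.Complex_Analysis"
    "HOL-Algebra.Group_Action"
begin

section \<open>Varieties as spaces with functions\<close>

text \<open>
  A complex variety is handled through its closed points: a Zariski topology together with, for
  every open set, the regular functions on it.  Such a function is a total function of which only
  the values on the open set matter.  Varieties form a full subcategory of these spaces with
  functions.
\<close>

record 'a fspace =
  ztop :: "'a topology"
  regfun :: "'a set \<Rightarrow> ('a \<Rightarrow> complex) set"

definition is_morphism :: "'a fspace \<Rightarrow> 'b fspace \<Rightarrow> ('a \<Rightarrow> 'b) \<Rightarrow> bool" where
  "is_morphism X Y f \<longleftrightarrow>
     continuous_map (ztop X) (ztop Y) f \<and>
     (\<forall>V g. openin (ztop Y) V \<and> g \<in> regfun Y V \<longrightarrow>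
        g \<circ> f \<in> regfun X {x \<in> topspace (ztop X). f x \<in> V})"

inductive_set polys :: "('a \<Rightarrow> complex) set \<Rightarrow> ('a \<Rightarrow> complex) set" for C where
  const: "(\<lambda>_. k) \<in> polys C"
| gen: "c \<in> C \<Longrightarrow> c \<in> polys C"
| add: "f \<in> polys C \<Longrightarrow> g \<in> polys C \<Longrightarrow> (\<lambda>x. f x + g x) \<in> polys C"
| mult: "f \<in> polys C \<Longrightarrow> g \<in> polys C \<Longrightarrow> (\<lambda>x. f x * g x) \<in> polys C"

text \<open>
  A chart consists of a set and coordinate functions on it.  The space glued from charts has the
  coarsest topology in which all nonvanishing loci of polynomials in the coordinates of a chart
  are open; its regular functions are locally quotients of polynomials in the coordinates of some
  chart.  By \<open>glue_unique\<close> below this is the only candidate for a structure in which the charts are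
  open and immersed by their coordinates.
\<close>

definition glue :: "('a set \<times> ('a \<Rightarrow> complex) set) set \<Rightarrow> 'a fspace" where
  "glue Ch = (let T = topology_generated_by {{x \<in> U. P x \<noteq> 0} | U C P. (U, C) \<in> Ch \<and> P \<in> polys C} in
    \<lparr> ztop = T,
      regfun = (\<lambda>W. {g. \<forall>x\<in>W. \<exists>(U, C)\<in>Ch. \<exists>P\<in>polys C. \<exists>Q\<in>polys C. \<exists>N.
        openin T N \<and> x \<in> N \<and> N \<subseteq> W \<inter> U \<and> (\<forall>y\<in>N. Q y \<noteq> 0 \<and> g y = P y / Q y)}) \<rparr>)"

text \<open>
  The product of varieties: basic open sets are the nonvanishing loci of sums of
  \<open>f x * g y\<close> on products of open sets, and regular functions are locally quotients of such sums.
\<close>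

definition prod_fspace :: "'a fspace \<Rightarrow> 'b fspace \<Rightarrow> ('a \<times> 'b) fspace" where
  "prod_fspace X Y = glue
     {(U \<times> V, {f \<circ> fst | f. f \<in> regfun X U} \<union> {g \<circ> snd | g. g \<in> regfun Y V}) | U V.
        openin (ztop X) U \<and> openin (ztop Y) V}"

definition quot_fspace :: "'a fspace \<Rightarrow> ('a \<Rightarrow> 'b) \<Rightarrow> 'b fspace" where
  "quot_fspace X q =
    \<lparr> ztop = topology_generated_by
        {W. W \<subseteq> q ` topspace (ztop X) \<and> openin (ztop X) {x \<in> topspace (ztop X). q x \<in> W}},
      regfun = (\<lambda>W. {g. g \<circ> q \<in> regfun X {x \<in> topspace (ztop X). q x \<in> W}}) \<rparr>"

definition open_subspace :: "'a fspace \<Rightarrow> 'a set \<Rightarrow> 'a fspace" where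
  "open_subspace X U = X\<lparr>ztop := subtopology (ztop X) U\<rparr>"

definition closed_immersion :: "'a fspace \<Rightarrow> 'b fspace \<Rightarrow> ('a \<Rightarrow> 'b) \<Rightarrow> bool" where
  "closed_immersion X Y f \<longleftrightarrow>
     is_morphism X Y f \<and> inj_on f (topspace (ztop X)) \<and> closed_map (ztop X) (ztop Y) f \<and>
     (\<forall>W g. openin (ztop X) W \<and> g \<in> regfun X W \<longrightarrow>
        (\<forall>x\<in>W. \<exists>V h. openin (ztop Y) V \<and> f x \<in> V \<and> h \<in> regfun Y V \<and>
           (\<forall>y\<in>W. f y \<in> V \<longrightarrow> g y = h (f y))))"

definition is_sheaf :: "'a fspace \<Rightarrow> bool" where
  "is_sheaf X \<longleftrightarrow>
     (\<forall>W N g. openin (ztop X) W \<and> openin (ztop X) N \<and> N \<subseteq> W \<and> g \<in> regfun X W \<longrightarrow> g \<in> regfun X N) \<and>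
     (\<forall>W g. openin (ztop X) W \<and>
        (\<forall>x\<in>W. \<exists>N h. openin (ztop X) N \<and> x \<in> N \<and> N \<subseteq> W \<and> h \<in> regfun X N \<and>
           (\<forall>y\<in>N. g y = h y)) \<longrightarrow> g \<in> regfun X W)"

lemma polys_comp: "p \<in> polys C \<Longrightarrow> p \<circ> f \<in> polys ((\<lambda>c. c \<circ> f) ` C)"
proof (induction rule: polys.induct)
  case (add p q)
  then show ?case using polys.add[of "p \<circ> f" _ "q \<circ> f"] by (simp add: o_def)
next
  case (mult p q)
  then show ?case using polys.mult[of "p \<circ> f" _ "q \<circ> f"] by (simp add: o_def)
next
  case (const k)
  then show ?case using polys.const[of k] by (simp add: o_def)
next
  case (gen c)
  then show ?case by (intro polys.gen imageI)
qed

lemma polys_compD: "P \<in> polys ((\<lambda>c. c \<circ> f) ` C) \<Longrightarrow> \<exists>p\<in>polys C. P = p \<circ> f"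
proof (induction rule: polys.induct)
  case (const k)
  show ?case by (rule bexI[of _ "\<lambda>_. k"]) (auto intro: polys.const)
next
  case (gen c)
  then show ?case by (auto intro: polys.gen)
next
  case (add P Q)
  then obtain p q where "p \<in> polys C" "q \<in> polys C" "P = p \<circ> f" "Q = q \<circ> f" by blast
  then show ?case by (intro bexI[of _ "\<lambda>x. p x + q x"]) (auto intro: polys.add)
next
  case (mult P Q)
  then obtain p q where "p \<in> polys C" "q \<in> polys C" "P = p \<circ> f" "Q = q \<circ> f" by blast
  then show ?case by (intro bexI[of _ "\<lambda>x. p x * q x"]) (auto intro: polys.mult)
qed

lemma ztop_glue:
  "ztop (glue Ch) = topology_generated_by {{x \<in> U. P x \<noteq> 0} | U C P. (U, C) \<in> Ch \<and> P \<in> polys C}"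
  by (simp add: glue_def Let_def)

lemma regfun_glue:
  "g \<in> regfun (glue Ch) W \<longleftrightarrow> (\<forall>x\<in>W. \<exists>(U, C)\<in>Ch. \<exists>P\<in>polys C. \<exists>Q\<in>polys C. \<exists>N.
     openin (ztop (glue Ch)) N \<and> x \<in> N \<and> N \<subseteq> W \<inter> U \<and> (\<forall>y\<in>N. Q y \<noteq> 0 \<and> g y = P y / Q y))"
  by (simp add: glue_def Let_def)

lemma topspace_glue: "topspace (ztop (glue Ch)) = (\<Union>(U, C)\<in>Ch. U)"
proof -
  let ?B = "{{x \<in> U. P x \<noteq> 0} | U C P. (U, C) \<in> Ch \<and> P \<in> polys C}"
  have "U \<in> ?B" if "(U, C) \<in> Ch" for U C
    using that polys.const[of 1 C] by (intro CollectI exI[of _ U] exI[of _ C] exI[of _ "\<lambda>_. 1"]) simp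
  then have "(\<Union>(U, C)\<in>Ch. U) \<subseteq> \<Union>?B"
    by (intro UN_least) (metis (no_types, lifting) Union_upper case_prod_beta prod.collapse)
  moreover have "\<Union>?B \<subseteq> (\<Union>(U, C)\<in>Ch. U)" by (intro Union_least) auto
  ultimately show ?thesis unfolding ztop_glue topology_generated_by_topspace by (rule equalityI[rotated])
qed

lemma openin_glue_basic:
  "(U, C) \<in> Ch \<Longrightarrow> P \<in> polys C \<Longrightarrow> openin (ztop (glue Ch)) {x \<in> U. P x \<noteq> 0}"
  unfolding ztop_glue by (rule topology_generated_by_Basis) blast

lemma openin_glue_chart:
  assumes "(U, C) \<in> Ch" shows "openin (ztop (glue Ch)) U"
  using openin_glue_basic[OF assms polys.const[of 1]] by simp

lemma glue_unique:
  fixes X :: "'a fspace" and \<psi> :: "'k \<Rightarrow> 'a \<Rightarrow> 'b"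
  assumes sheaf: "is_sheaf X"
    and cover: "topspace (ztop X) = (\<Union>k\<in>K. U k)"
    and opn: "\<And>k. k \<in> K \<Longrightarrow> openin (ztop X) (U k)"
    and imm: "\<And>k. k \<in> K \<Longrightarrow> closed_immersion (open_subspace X (U k)) (glue {(S k, C k)}) (\<psi> k)"
  defines "Y \<equiv> glue {(U k, (\<lambda>c. c \<circ> \<psi> k) ` C k) | k. k \<in> K}"
  shows "ztop X = ztop Y" and "openin (ztop X) W \<Longrightarrow> regfun X W = regfun Y W"
proof -
  have restr: "g \<in> regfun X N"
    if "openin (ztop X) V" "openin (ztop X) N" "N \<subseteq> V" "g \<in> regfun X V" for V N g
    using conjunct1[OF sheaf[unfolded is_sheaf_def]] that by blast
  note gl = conjunct2[OF sheaf[unfolded is_sheaf_def], THEN spec, THEN spec, THEN mp]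
  define T where "T k = glue {(S k, C k)}" for k
  have sub: "topspace (ztop (open_subspace X (U k))) = U k" if "k \<in> K" for k
    using opn[OF that] openin_subset by (fastforce simp: open_subspace_def)
  have opsub: "openin (ztop (open_subspace X (U k))) N \<longleftrightarrow> openin (ztop X) N \<and> N \<subseteq> U k"
    if "k \<in> K" for k N
    using openin_open_subtopology[OF opn[OF that]] by (simp add: open_subspace_def)
  have regsub: "regfun (open_subspace X V) = regfun X" for V by (simp add: open_subspace_def)
  have mor: "is_morphism (open_subspace X (U k)) (T k) (\<psi> k)" if "k \<in> K" for k
    using imm[OF that] by (simp add: closed_immersion_def T_def)
  have topT: "topspace (ztop (T k)) = S k" for k by (simp add: T_def topspace_glue)
  have inS: "\<psi> k x \<in> S k" if "k \<in> K" "x \<in> U k" for k x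
    using mor[OF that(1)] that sub[OF that(1)] topT
    by (auto simp: is_morphism_def continuous_map_def Pi_iff)
  have preX: "openin (ztop X) {x \<in> U k. \<psi> k x \<in> V}" if "k \<in> K" "openin (ztop (T k)) V" for k V
    using mor[OF that(1)] that opsub[OF that(1)] sub[OF that(1)]
    unfolding is_morphism_def continuous_map_def by auto
  have chY: "(U k, (\<lambda>c. c \<circ> \<psi> k) ` C k) \<in> {(U k, (\<lambda>c. c \<circ> \<psi> k) ` C k) | k. k \<in> K}" if "k \<in> K" for k
    using that by blast
  have opnY: "openin (ztop Y) (U k)" if "k \<in> K" for k
    unfolding Y_def by (rule openin_glue_chart[OF chY[OF that]])
  have preY: "openin (ztop Y) {x \<in> U k. \<psi> k x \<in> V}" if k: "k \<in> K" and V: "openin (ztop (T k)) V" for k V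
  proof -
    have "generate_topology_on {{x \<in> S k. P x \<noteq> 0} |P. P \<in> polys (C k)} V"
      using V openin_topology_generated_by
      unfolding T_def ztop_glue by fastforce
    then show ?thesis
    proof (induction rule: generate_topology_on.induct)
      case Empty then show ?case by simp
    next
      case (Int a b)
      have "{x \<in> U k. \<psi> k x \<in> a \<inter> b} = {x \<in> U k. \<psi> k x \<in> a} \<inter> {x \<in> U k. \<psi> k x \<in> b}" by blast
      then show ?case using Int by auto
    next
      case (UN B)
      have "{x \<in> U k. \<psi> k x \<in> \<Union>B} = (\<Union>b\<in>B. {x \<in> U k. \<psi> k x \<in> b})" by blast
      then show ?case using UN by auto
    next
      case (Basis s)
      then obtain P where P: "P \<in> polys (C k)" and s: "s = {x \<in> S k. P x \<noteq> 0}" by blast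
      have "{x \<in> U k. \<psi> k x \<in> s} = {x \<in> U k. (P \<circ> \<psi> k) x \<noteq> 0}" using s inS[OF k] by auto
      then show ?case
        using openin_glue_basic[OF chY[OF k] polys_comp[OF P]] by (simp add: Y_def)
    qed
  qed
  show top: "ztop X = ztop Y"
  proof (rule topology_eq[THEN iffD2], intro allI iffI)
    fix W assume W: "openin (ztop X) W"
    show "openin (ztop Y) W"
    proof (subst openin_subopen, intro ballI)
      fix x assume x: "x \<in> W"
      then obtain k where k: "k \<in> K" and xk: "x \<in> U k"
        using openin_subset[OF W] cover by blast
      have cm: "closed_map (ztop (open_subspace X (U k))) (ztop (T k)) (\<psi> k)"
        and inj: "inj_on (\<psi> k) (U k)"
        using imm[OF k] sub[OF k] by (auto simp: closed_immersion_def T_def)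
      have "openin (ztop (open_subspace X (U k))) (W \<inter> U k)"
        using W opn[OF k] opsub[OF k] by auto
      then have "closedin (ztop (open_subspace X (U k))) (U k - W)"
        using sub[OF k] by (simp add: closedin_def Diff_Diff_Int Int_commute)
      then have "closedin (ztop (T k)) (\<psi> k ` (U k - W))" using cm by (simp add: closed_map_def)
      then have V: "openin (ztop (T k)) (S k - \<psi> k ` (U k - W))" by (simp add: closedin_def topT)
      have "{y \<in> U k. \<psi> k y \<in> S k - \<psi> k ` (U k - W)} = W \<inter> U k"
        using inj inS[OF k] by (auto simp: inj_on_def)
      then show "\<exists>N. openin (ztop Y) N \<and> x \<in> N \<and> N \<subseteq> W"
        using preY[OF k V] x xk by (intro exI[of _ "W \<inter> U k"]) auto
    qed
  next
    fix W assume "openin (ztop Y) W"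
    then have "generate_topology_on {{x \<in> V. P x \<noteq> 0} | V D P.
        (V, D) \<in> {(U k, (\<lambda>c. c \<circ> \<psi> k) ` C k) | k. k \<in> K} \<and> P \<in> polys D} W"
      unfolding Y_def ztop_glue by (rule openin_topology_generated_by)
    then show "openin (ztop X) W"
    proof (induction rule: generate_topology_on.induct)
      case (Basis s)
      then obtain k P where k: "k \<in> K" and P: "P \<in> polys ((\<lambda>c. c \<circ> \<psi> k) ` C k)"
        and s: "s = {x \<in> U k. P x \<noteq> 0}" by auto
      obtain p where p: "p \<in> polys (C k)" "P = p \<circ> \<psi> k" using polys_compD[OF P] by blast
      have "s = {x \<in> U k. \<psi> k x \<in> {y \<in> S k. p y \<noteq> 0}}" using s p inS[OF k] by auto
      moreover have "openin (ztop (T k)) {y \<in> S k. p y \<noteq> 0}"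
        unfolding T_def by (rule openin_glue_basic[OF _ p(1)]) simp
      ultimately show ?case using preX[OF k] by metis
    qed auto
  qed
  assume W: "openin (ztop X) W"
  show "regfun X W = regfun Y W"
  proof (intro equalityI subsetI)
    fix g assume g: "g \<in> regfun X W"
    show "g \<in> regfun Y W"
      unfolding Y_def regfun_glue
    proof (intro ballI, fold Y_def)
      fix x assume x: "x \<in> W"
      then obtain k where k: "k \<in> K" and xk: "x \<in> U k"
        using openin_subset[OF W] cover by blast
      have W': "openin (ztop X) (W \<inter> U k)" using W opn[OF k] by auto
      then have "g \<in> regfun X (W \<inter> U k)"
        using restr[OF W _ _ g] by blast
      then obtain V h where V: "openin (ztop (T k)) V" "\<psi> k x \<in> V" and h: "h \<in> regfun (T k) V"
        and gh: "\<And>y. y \<in> W \<inter> U k \<Longrightarrow> \<psi> k y \<in> V \<Longrightarrow> g y = h (\<psi> k y)"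
      proof -
        have o: "openin (ztop (open_subspace X (U k))) (W \<inter> U k)" using W' opsub[OF k] by auto
        have "\<And>N g x. openin (ztop (open_subspace X (U k))) N \<Longrightarrow> g \<in> regfun X N \<Longrightarrow> x \<in> N \<Longrightarrow>
            \<exists>V h. openin (ztop (T k)) V \<and> \<psi> k x \<in> V \<and> h \<in> regfun (T k) V \<and>
              (\<forall>y\<in>N. \<psi> k y \<in> V \<longrightarrow> g y = h (\<psi> k y))"
          using imm[OF k] unfolding closed_immersion_def regsub T_def by simp
        from this[OF o \<open>g \<in> regfun X (W \<inter> U k)\<close> IntI[OF x xk]] that show ?thesis by blast
      qed
      obtain P Q N where PQ: "P \<in> polys (C k)" "Q \<in> polys (C k)" and N: "openin (ztop (T k)) N"
        "\<psi> k x \<in> N" "N \<subseteq> V \<inter> S k" and hPQ: "\<And>y. y \<in> N \<Longrightarrow> Q y \<noteq> 0 \<and> h y = P y / Q y"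
        using bspec[OF h[unfolded T_def regfun_glue] V(2)] by (auto simp: T_def)
      define M where "M = W \<inter> {y \<in> U k. \<psi> k y \<in> N}"
      have "openin (ztop Y) M" unfolding M_def using W preX[OF k N(1)] top by auto
      moreover have "\<forall>y\<in>M. (Q \<circ> \<psi> k) y \<noteq> 0 \<and> g y = (P \<circ> \<psi> k) y / (Q \<circ> \<psi> k) y"
        using gh hPQ N(3) by (auto simp: M_def)
      moreover have "x \<in> M" "M \<subseteq> W \<inter> U k" using x xk N(2) by (auto simp: M_def)
      ultimately show "\<exists>(U, C)\<in>{(U k, (\<lambda>c. c \<circ> \<psi> k) ` C k) |k. k \<in> K}. \<exists>P\<in>polys C. \<exists>Q\<in>polys C.
          \<exists>N. openin (ztop Y) N \<and> x \<in> N \<and> N \<subseteq> W \<inter> U \<and> (\<forall>y\<in>N. Q y \<noteq> 0 \<and> g y = P y / Q y)"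
        using polys_comp[OF PQ(1), of "\<psi> k"] polys_comp[OF PQ(2), of "\<psi> k"]
        by (intro bexI[OF _ chY[OF k]] case_prodI bexI[of _ "P \<circ> \<psi> k"] bexI[of _ "Q \<circ> \<psi> k"]
            exI[of _ M] conjI)
    qed
  next
    fix g assume g: "g \<in> regfun Y W"
    have "\<exists>N h. openin (ztop X) N \<and> x \<in> N \<and> N \<subseteq> W \<and> h \<in> regfun X N \<and> (\<forall>y\<in>N. g y = h y)"
      if x: "x \<in> W" for x
    proof -
      have "\<exists>(V, D)\<in>{(U k, (\<lambda>c. c \<circ> \<psi> k) ` C k) |k. k \<in> K}. \<exists>P\<in>polys D. \<exists>Q\<in>polys D.
          \<exists>N. openin (ztop Y) N \<and> x \<in> N \<and> N \<subseteq> W \<inter> V \<and> (\<forall>y\<in>N. Q y \<noteq> 0 \<and> g y = P y / Q y)"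
        using g x unfolding Y_def regfun_glue by blast
      then obtain k P Q N where k: "k \<in> K" and P: "P \<in> polys ((\<lambda>c. c \<circ> \<psi> k) ` C k)"
        and Q: "Q \<in> polys ((\<lambda>c. c \<circ> \<psi> k) ` C k)" and N: "openin (ztop X) N" "x \<in> N" "N \<subseteq> W \<inter> U k"
        and gPQ: "\<And>y. y \<in> N \<Longrightarrow> Q y \<noteq> 0 \<and> g y = P y / Q y" unfolding top by auto
      obtain p q where p: "p \<in> polys (C k)" "P = p \<circ> \<psi> k" and q: "q \<in> polys (C k)" "Q = q \<circ> \<psi> k"
        using polys_compD[OF P] polys_compD[OF Q] by blast
      define V where "V = {y \<in> S k. q y \<noteq> 0}"
      have V: "openin (ztop (T k)) V"
        unfolding T_def V_def by (rule openin_glue_basic[OF _ q(1)]) simp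
      have "(\<lambda>y. p y / q y) \<in> regfun (T k) V"
        unfolding T_def regfun_glue using V p(1) q(1) by (auto simp: T_def V_def)
      then have h: "(\<lambda>y. p y / q y) \<circ> \<psi> k \<in> regfun X {y \<in> U k. \<psi> k y \<in> V}"
        using mor[OF k] V sub[OF k] unfolding is_morphism_def regsub by metis
      have "N \<subseteq> {y \<in> U k. \<psi> k y \<in> V}"
        using N gPQ q(2) inS[OF k] by (auto simp: V_def)
      then have "(\<lambda>y. p y / q y) \<circ> \<psi> k \<in> regfun X N"
        using restr[OF preX[OF k V] N(1) _ h] by blast
      then show ?thesis using N gPQ p q by (intro exI[of _ N] exI[of _ "(\<lambda>y. p y / q y) \<circ> \<psi> k"]) auto
    qed
    with W show "g \<in> regfun X W" by (intro gl conjI ballI)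
  qed
qed


section \<open>The projective line\<close>

text \<open>\<open>Aff z\<close> is the point \<open>[z : 1]\<close> and \<open>Inf1\<close> the point \<open>[1 : 0]\<close>.\<close>

datatype cp1 = Aff (aff: complex) | Inf1

fun moebius :: "complex \<Rightarrow> complex \<Rightarrow> complex \<Rightarrow> complex \<Rightarrow> cp1 \<Rightarrow> cp1" where
  "moebius a b c d (Aff z) = (if c * z + d = 0 then Inf1 else Aff ((a * z + b) / (c * z + d)))"
| "moebius a b c d Inf1 = (if c = 0 then Inf1 else Aff (a / c))"

text \<open>The isomorphisms of curves from the projective line to itself.\<close>

definition is_moebius :: "(cp1 \<Rightarrow> cp1) \<Rightarrow> bool" where
  "is_moebius \<phi> \<longleftrightarrow> (\<exists>a b c d. a * d - b * c \<noteq> 0 \<and> \<phi> = moebius a b c d)"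

text \<open>
  A differential \<open>f dz\<close> on the projective line is represented by its coefficient \<open>f\<close> in the affine
  coordinate, normalised to take its limit at removable singularities and \<open>0\<close> at poles.
  The coefficient at a point \<open>p\<close> is taken with respect to the local coordinate \<open>z - a\<close> if
  \<open>p = Aff a\<close> and \<open>w = 1 / z\<close> if \<open>p = Inf1\<close>, where \<open>dz = - dw / w\<^sup>2\<close>.
\<close>

definition local_coeff :: "(complex \<Rightarrow> complex) \<Rightarrow> cp1 \<Rightarrow> complex \<Rightarrow> complex" where
  "local_coeff f p = (case p of Aff a \<Rightarrow> (\<lambda>w. f (a + w)) | Inf1 \<Rightarrow> (\<lambda>w. - f (1 / w) / w ^ 2))"

definition meromorphic_form :: "(complex \<Rightarrow> complex) \<Rightarrow> bool" where
  "meromorphic_form f \<longleftrightarrow> remove_sings f = f \<and> (\<forall>p. local_coeff f p meromorphic_on {0})"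

text \<open>
  The value of \<open>zorder\<close> is meaningful only for a function that is not identically \<open>0\<close>.
\<close>

definition only_double_pole :: "cp1 \<Rightarrow> (complex \<Rightarrow> complex) \<Rightarrow> bool" where
  "only_double_pole d f \<longleftrightarrow> meromorphic_form f \<and>
     (\<forall>p. (\<forall>\<^sub>F w in at 0. local_coeff f p w \<noteq> 0) \<and>
          zorder (local_coeff f p) 0 = (if p = d then -2 else 0))"

definition pullback_form :: "(cp1 \<Rightarrow> cp1) \<Rightarrow> (complex \<Rightarrow> complex) \<Rightarrow> complex \<Rightarrow> complex" where
  "pullback_form \<phi> f =
     remove_sings (\<lambda>z. f (aff (\<phi> (Aff z))) * deriv (\<lambda>u. aff (\<phi> (Aff u))) z)"

text \<open>
  The integral of \<open>f dz\<close>, whose only pole is \<open>d\<close>, along any path from \<open>p\<close> to \<open>q\<close> in the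
  complement of \<open>d\<close>.  The paths may pass through \<open>Inf1\<close>; they are the images of the paths in the
  complex plane under a parametrisation \<open>\<psi>\<close> of the complement of \<open>d\<close>.
\<close>

definition form_integral :: "(complex \<Rightarrow> complex) \<Rightarrow> cp1 \<Rightarrow> cp1 \<Rightarrow> cp1 \<Rightarrow> complex" where
  "form_integral f d p q =
     (THE I. \<exists>\<psi> \<gamma>. is_moebius \<psi> \<and> \<psi> Inf1 = d \<and> valid_path \<gamma> \<and>
        \<psi> (Aff (pathstart \<gamma>)) = p \<and> \<psi> (Aff (pathfinish \<gamma>)) = q \<and>
        (pullback_form \<psi> f has_contour_integral I) \<gamma>)"

text \<open>
  Translation by \<open>a\<close>, using an isomorphism \<open>\<phi>\<close> of the complement of the pole \<open>d\<close> with the affine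
  line that pulls \<open>dz\<close> back to \<open>f dz\<close>.
\<close>

definition affine_coord :: "(complex \<Rightarrow> complex) \<Rightarrow> cp1 \<Rightarrow> (cp1 \<Rightarrow> cp1) \<Rightarrow> bool" where
  "affine_coord f d \<phi> \<longleftrightarrow> is_moebius \<phi> \<and> \<phi> d = Inf1 \<and> pullback_form \<phi> (\<lambda>_. 1) = f"

definition translate_point :: "(complex \<Rightarrow> complex) \<Rightarrow> cp1 \<Rightarrow> complex \<Rightarrow> cp1 \<Rightarrow> cp1" where
  "translate_point f d a p =
     (let \<phi> = (SOME \<phi>. affine_coord f d \<phi>) in inv_into UNIV \<phi> (Aff (aff (\<phi> p) + a)))"


section \<open>Marked preordered rooted trees\<close>

text \<open>Vertices are natural numbers; \<open>adj\<close> is the symmetric adjacency relation, and \<open>'n\<close> is the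
  set of indices of the marked points.\<close>

record 'n ltree =
  verts :: "nat set"
  adj :: "(nat \<times> nat) set"
  vroot :: nat
  pre :: "(nat \<times> nat) set"
  mark :: "'n \<Rightarrow> nat"

definition simple_walk :: "('n, 'x) ltree_scheme \<Rightarrow> nat \<Rightarrow> nat list \<Rightarrow> nat \<Rightarrow> bool" where
  "simple_walk \<Gamma> u xs v \<longleftrightarrow>
     xs \<noteq> [] \<and> hd xs = u \<and> last xs = v \<and> distinct xs \<and> set xs \<subseteq> verts \<Gamma> \<and>
     successively (\<lambda>x y. (x, y) \<in> adj \<Gamma>) xs"

definition is_tree :: "('n, 'x) ltree_scheme \<Rightarrow> bool" where
  "is_tree \<Gamma> \<longleftrightarrow>
     finite (verts \<Gamma>) \<and> verts \<Gamma> \<noteq> {} \<and> adj \<Gamma> \<subseteq> verts \<Gamma> \<times> verts \<Gamma> \<and>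
     sym (adj \<Gamma>) \<and> irrefl (adj \<Gamma>) \<and>
     (\<forall>u\<in>verts \<Gamma>. \<forall>v\<in>verts \<Gamma>. \<exists>!xs. simple_walk \<Gamma> u xs v)"

definition nbrs :: "('n, 'x) ltree_scheme \<Rightarrow> nat \<Rightarrow> nat set" where
  "nbrs \<Gamma> v = {w. (v, w) \<in> adj \<Gamma>}"

definition ancestor :: "('n, 'x) ltree_scheme \<Rightarrow> nat \<Rightarrow> nat \<Rightarrow> bool" where
  "ancestor \<Gamma> v u \<longleftrightarrow> (\<exists>xs. simple_walk \<Gamma> u xs (vroot \<Gamma>) \<and> v \<in> set xs)"

definition is_terminal :: "('n, 'x) ltree_scheme \<Rightarrow> nat \<Rightarrow> bool" where
  "is_terminal \<Gamma> v \<longleftrightarrow> v \<in> verts \<Gamma> \<and> (\<forall>u\<in>verts \<Gamma>. ancestor \<Gamma> v u \<longrightarrow> u = v)"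

definition meet :: "('n, 'x) ltree_scheme \<Rightarrow> nat \<Rightarrow> nat \<Rightarrow> nat" where
  "meet \<Gamma> u v = (THE w. ancestor \<Gamma> w u \<and> ancestor \<Gamma> w v \<and>
     (\<forall>w'. ancestor \<Gamma> w' u \<and> ancestor \<Gamma> w' v \<and> ancestor \<Gamma> w w' \<longrightarrow> w' = w))"

definition strictly_below :: "('n, 'x) ltree_scheme \<Rightarrow> nat \<Rightarrow> nat \<Rightarrow> bool" where
  "strictly_below \<Gamma> w v \<longleftrightarrow> (w, v) \<in> pre \<Gamma> \<and> (v, w) \<notin> pre \<Gamma>"

definition same_level :: "('n, 'x) ltree_scheme \<Rightarrow> (nat \<times> nat) set" where
  "same_level \<Gamma> = pre \<Gamma> \<inter> (pre \<Gamma>)\<inverse>"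

text \<open>The position of the class of \<open>v\<close> in \<open>V/\<sim>\<close>, counted from \<open>0\<close>.\<close>

definition level :: "('n, 'x) ltree_scheme \<Rightarrow> nat \<Rightarrow> nat" where
  "level \<Gamma> v = card ({w \<in> verts \<Gamma>. strictly_below \<Gamma> w v} // same_level \<Gamma>)"

definition tree_length :: "('n, 'x) ltree_scheme \<Rightarrow> nat" where
  "tree_length \<Gamma> = card (verts \<Gamma> // same_level \<Gamma>) - 1"

definition contraction ::
    "('n, 'x) ltree_scheme \<Rightarrow> ('n, 'y) ltree_scheme \<Rightarrow> (nat \<Rightarrow> nat) \<Rightarrow> bool" where
  "contraction \<Gamma> \<Gamma>' f \<longleftrightarrow>
     f ` verts \<Gamma> = verts \<Gamma>' \<and>
     (\<forall>i. f (mark \<Gamma> i) = mark \<Gamma>' i) \<and>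
     (\<forall>(v, w)\<in>pre \<Gamma>. (f v, f w) \<in> pre \<Gamma>') \<and>
     (\<forall>(v, w)\<in>adj \<Gamma>. f v = f w \<or> (f v, f w) \<in> adj \<Gamma>') \<and>
     (\<forall>x\<in>verts \<Gamma>'. let F = {v \<in> verts \<Gamma>. f v = x} in
        \<forall>u\<in>F. \<forall>v\<in>F. (u, v) \<in> (adj \<Gamma> \<inter> F \<times> F)\<^sup>*)"


section \<open>Marked multiscaled lines\<close>

text \<open>
  A connected nodal curve of arithmetic genus \<open>0\<close> is a tree of projective lines.  It is given by
  its dual tree and, for each pair of adjacent vertices \<open>v\<close> and \<open>w\<close>, the point \<open>node v w\<close> of the
  component of \<open>v\<close> that is glued to the point \<open>node w v\<close> of the component of \<open>w\<close>; components
  are copies of the projective line.  The marked point \<open>i\<close> is the point \<open>pt i\<close> of the component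
  of \<open>mark i\<close>, and \<open>pinf\<close> lies on the component of the root.  Values of \<open>node\<close> and \<open>form\<close>
  outside these ranges are irrelevant.
\<close>

record 'n mline = "'n ltree" +
  node :: "nat \<Rightarrow> nat \<Rightarrow> cp1"
  pinf :: cp1
  form :: "nat \<Rightarrow> complex \<Rightarrow> complex"
  pt :: "'n \<Rightarrow> cp1"

definition dual_tree :: "'n mline \<Rightarrow> 'n ltree" where
  "dual_tree L = ltree.truncate L"

text \<open>The descending node, or the point at infinity on the root component.\<close>

definition desc :: "'n mline \<Rightarrow> nat \<Rightarrow> cp1" where
  "desc L v = (if v = vroot L then pinf L
     else node L v (THE w. w \<in> nbrs L v \<and> strictly_below L w v))"

definition multiscaled_line :: "'n mline \<Rightarrow> bool" where
  "multiscaled_line L \<longleftrightarrow>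
     is_tree L \<and> vroot L \<in> verts L \<and>
     (\<forall>v\<in>verts L. inj_on (node L v) (nbrs L v)) \<and>
     pinf L \<notin> node L (vroot L) ` nbrs L (vroot L) \<and>
     preorder_on (verts L) (pre L) \<and> pre L \<subseteq> verts L \<times> verts L \<and> total_on (verts L) (pre L) \<and>
     (\<forall>v\<in>verts L. v \<noteq> vroot L \<longrightarrow> (\<exists>!w. w \<in> nbrs L v \<and> strictly_below L w v)) \<and>
     (\<forall>u v. is_terminal L u \<and> is_terminal L v \<longrightarrow> (u, v) \<in> same_level L) \<and>
     (\<forall>v\<in>verts L. only_double_pole (desc L v) (form L v))"

definition marked_multiscaled_line :: "'n mline \<Rightarrow> bool" where
  "marked_multiscaled_line L \<longleftrightarrow> multiscaled_line L \<and>
     (\<forall>i. is_terminal L (mark L i) \<and>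
          pt L i \<notin> node L (mark L i) ` nbrs L (mark L i) \<and>
          \<not> (mark L i = vroot L \<and> pt L i = pinf L))"

definition stable :: "'n mline \<Rightarrow> bool" where
  "stable L \<longleftrightarrow>
     (\<forall>v\<in>verts L. if is_terminal L v then v \<in> range (mark L)
        else card (nbrs L v) \<ge> 3 \<or> (card (nbrs L v) \<ge> 2 \<and> v = vroot L))"

definition stable_lines :: "'n mline set" where
  "stable_lines = {L. marked_multiscaled_line L \<and> stable L}"

text \<open>
  An isomorphism of nodal curves amounts to a bijection \<open>\<sigma>\<close> of the components together with
  isomorphisms \<open>\<phi> v\<close> of corresponding components that match the nodes.
\<close>

definition proj_iso :: "'n mline \<Rightarrow> 'n mline \<Rightarrow> bool" where
  "proj_iso L L' \<longleftrightarrow> (\<exists>\<sigma> \<phi> c.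
     bij_betw \<sigma> (verts L) (verts L') \<and>
     (\<forall>v\<in>verts L. is_moebius (\<phi> v)) \<and>
     (\<forall>u\<in>verts L. \<forall>v\<in>verts L. (u, v) \<in> adj L \<longleftrightarrow> (\<sigma> u, \<sigma> v) \<in> adj L') \<and>
     (\<forall>(u, v)\<in>adj L. \<phi> u (node L u v) = node L' (\<sigma> u) (\<sigma> v)) \<and>
     \<sigma> (vroot L) = vroot L' \<and> \<phi> (vroot L) (pinf L) = pinf L' \<and>
     (\<forall>u\<in>verts L. \<forall>v\<in>verts L. (u, v) \<in> pre L \<longleftrightarrow> (\<sigma> u, \<sigma> v) \<in> pre L') \<and>
     (\<forall>i. \<sigma> (mark L i) = mark L' i \<and> \<phi> (mark L i) (pt L i) = pt L' i) \<and>
     (\<forall>v\<in>verts L. c v \<noteq> 0 \<and> pullback_form (\<phi> v) (form L' (\<sigma> v)) = (\<lambda>z. c v * form L v z)) \<and>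
     (\<forall>(u, v)\<in>same_level L. c u = c v) \<and>
     (\<forall>v. is_terminal L v \<longrightarrow> c v = 1))"

definition iso_rel :: "('n mline \<times> 'n mline) set" where
  "iso_rel = {(L, L'). L \<in> stable_lines \<and> L' \<in> stable_lines \<and> proj_iso L L'}"

definition An_points :: "'n mline set set" where
  "An_points = stable_lines // iso_rel"


section \<open>The variety structure\<close>

definition PPi :: "'n mline \<Rightarrow> 'n \<Rightarrow> 'n \<Rightarrow> cp1" where
  "PPi L i j = (if mark L i = mark L j
     then Aff (form_integral (form L (mark L i)) (desc L (mark L i)) (pt L i) (pt L j)) else Inf1)"

text \<open>The vertex following \<open>v\<close> on the simple path from \<open>v\<close> to \<open>u\<close>.\<close>

definition next_towards :: "'n mline \<Rightarrow> nat \<Rightarrow> nat \<Rightarrow> nat" where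
  "next_towards L v u = (THE w. \<exists>xs. simple_walk L v (v # w # xs) u)"

definition II :: "'n mline \<Rightarrow> 'n \<Rightarrow> 'n \<Rightarrow> complex" where
  "II L i j = (let v = meet L (mark L i) (mark L j);
       n = (\<lambda>k. if mark L i = mark L j then pt L k else node L v (next_towards L v (mark L k)))
     in form_integral (form L v) (desc L v) (n i) (n j))"

definition dual_level_tree :: "'n ltree \<Rightarrow> bool" where
  "dual_level_tree \<Gamma> \<longleftrightarrow> (\<exists>L\<in>stable_lines. \<Gamma> = dual_tree L)"

definition chart_dom :: "'n ltree \<Rightarrow> 'n mline set set" where
  "chart_dom \<Gamma> = {iso_rel `` {L} | L. L \<in> stable_lines \<and> (\<exists>f. contraction \<Gamma> (dual_tree L) f) \<and>
     (\<forall>i j. mark \<Gamma> i \<noteq> mark \<Gamma> j \<longrightarrow> PPi L i j \<noteq> Aff 0)}"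

text \<open>The choices of the pairs \<open>(i\<^sub>m, j\<^sub>m)\<close> for \<open>m < \<ell>\<close> and of the terminal vertex \<open>v\<^sub>\<ell>\<close>.\<close>

definition chart_choice :: "'n ltree \<Rightarrow> (nat \<Rightarrow> 'n \<times> 'n) \<Rightarrow> nat \<Rightarrow> bool" where
  "chart_choice \<Gamma> ij vt \<longleftrightarrow> is_terminal \<Gamma> vt \<and>
     (\<forall>m < tree_length \<Gamma>. level \<Gamma> (meet \<Gamma> (mark \<Gamma> (fst (ij m))) (mark \<Gamma> (snd (ij m)))) = m)"

text \<open>
  The coordinates \<open>z\<close> and \<open>t\<close> are invariant under isomorphism of \<open>L\<close>; the scales \<open>s\<close> are not.  The
  contraction \<open>f\<close> is unique on the vertices of \<open>\<Gamma>\<close>.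
\<close>

definition line_chart :: "'n::{finite,linorder} ltree \<Rightarrow> (nat \<Rightarrow> 'n \<times> 'n) \<Rightarrow> nat \<Rightarrow> 'n mline \<Rightarrow>
    ('n \<times> 'n \<Rightarrow> complex) \<times> (nat \<Rightarrow> complex)" where
  "line_chart \<Gamma> ij vt L =
     (let l = tree_length \<Gamma>;
          f = (SOME f. contraction \<Gamma> (dual_tree L) f);
          v = (\<lambda>m. if m = l then vt else meet \<Gamma> (mark \<Gamma> (fst (ij m))) (mark \<Gamma> (snd (ij m))));
          s = (\<lambda>m. if m = l then 1 else II L (fst (ij m)) (snd (ij m)));
          t = (\<lambda>m. if (f (v m), f (v (m - 1))) \<in> same_level L then s m / s (m - 1) else 0);
          z = (\<lambda>(i, j). II L i j / s (level \<Gamma> (meet \<Gamma> (mark \<Gamma> i) (mark \<Gamma> j))))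
      in (restrict z {(i, j). i < j}, restrict t {1..l}))"

definition chart :: "'n::{finite,linorder} ltree \<Rightarrow> (nat \<Rightarrow> 'n \<times> 'n) \<Rightarrow> nat \<Rightarrow> 'n mline set \<Rightarrow>
    ('n \<times> 'n \<Rightarrow> complex) \<times> (nat \<Rightarrow> complex)" where
  "chart \<Gamma> ij vt x = line_chart \<Gamma> ij vt (SOME L. L \<in> x)"

text \<open>The affine variety with factors \<open>\<complex>\<^sup>*\<close> for the pairs \<open>i < j\<close> with distinct marks in \<open>\<Gamma>\<close>,
  \<open>\<complex>\<close> for the other pairs \<open>i < j\<close>, and \<open>\<complex>\<close> for \<open>1 \<le> m \<le> \<ell>\<close>.\<close>

definition target_coords :: "'n::{finite,linorder} ltree \<Rightarrow>
    (('n \<times> 'n \<Rightarrow> complex) \<times> (nat \<Rightarrow> complex) \<Rightarrow> complex) set" where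
  "target_coords \<Gamma> = {(\<lambda>y. fst y (i, j)) | i j. i < j} \<union> {(\<lambda>y. snd y m) | m. m \<in> {1..tree_length \<Gamma>}}"

definition target_points :: "'n::{finite,linorder} ltree \<Rightarrow>
    (('n \<times> 'n \<Rightarrow> complex) \<times> (nat \<Rightarrow> complex)) set" where
  "target_points \<Gamma> = {(z, t). z \<in> extensional {(i, j). i < j} \<and> t \<in> extensional {1..tree_length \<Gamma>} \<and>
     (\<forall>i j. i < j \<and> mark \<Gamma> i \<noteq> mark \<Gamma> j \<longrightarrow> z (i, j) \<noteq> 0)}"

definition chart_target :: "'n::{finite,linorder} ltree \<Rightarrow>
    (('n \<times> 'n \<Rightarrow> complex) \<times> (nat \<Rightarrow> complex)) fspace" where
  "chart_target \<Gamma> = glue {(target_points \<Gamma>, target_coords \<Gamma>)}"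

text \<open>
  The space of stable marked multiscaled lines up to complex projective isomorphism.
  By \<open>An_unique\<close> below, any structure for which all chart domains are open and all charts are
  closed immersions agrees with it on all open sets.
\<close>

definition An :: "'n::{finite,linorder} mline set fspace" where
  "An = glue {(chart_dom \<Gamma>, (\<lambda>c. c \<circ> chart \<Gamma> ij vt) ` target_coords \<Gamma>) | \<Gamma> ij vt.
     dual_level_tree \<Gamma> \<and> chart_choice \<Gamma> ij vt}"


lemma An_unique:
  fixes X :: "'n::{finite,linorder} mline set fspace"
  assumes "is_sheaf X"
    and "topspace (ztop X) = (\<Union>{chart_dom \<Gamma> | \<Gamma> ij vt. dual_level_tree \<Gamma> \<and> chart_choice \<Gamma> ij vt})"
    and "\<And>\<Gamma> ij vt. dual_level_tree \<Gamma> \<Longrightarrow> chart_choice \<Gamma> ij vt \<Longrightarrow>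
      openin (ztop X) (chart_dom \<Gamma>) \<and>
      closed_immersion (open_subspace X (chart_dom \<Gamma>)) (chart_target \<Gamma>) (chart \<Gamma> ij vt)"
  shows "ztop X = ztop An" and "openin (ztop X) W \<Longrightarrow> regfun X W = regfun An W"
proof -
  define K where "K = {(\<Gamma> :: 'n ltree, ij, vt). dual_level_tree \<Gamma> \<and> chart_choice \<Gamma> ij vt}"
  define \<psi> :: "'n ltree \<times> (nat \<Rightarrow> 'n \<times> 'n) \<times> nat \<Rightarrow> _" where "\<psi> = (\<lambda>(\<Gamma>, ij, vt). chart \<Gamma> ij vt)"
  have eq: "An = glue {(chart_dom (fst k), (\<lambda>c. c \<circ> \<psi> k) ` target_coords (fst k)) | k. k \<in> K}"
    unfolding An_def K_def \<psi>_def by (rule arg_cong[of _ _ glue]) auto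
  note * = glue_unique[of X "\<lambda>k. chart_dom (fst k)" K "\<lambda>k. target_points (fst k)"
      "\<lambda>k. target_coords (fst k)" \<psi>, folded eq]
  have t: "topspace (ztop X) = (\<Union>k\<in>K. chart_dom (fst k))"
    unfolding assms(2) K_def by (rule arg_cong[of _ _ Union]) force
  have c: "openin (ztop X) (chart_dom (fst k)) \<and>
      closed_immersion (open_subspace X (chart_dom (fst k)))
        (glue {(target_points (fst k), target_coords (fst k))}) (\<psi> k)" if kK: "k \<in> K" for k
  proof -
    obtain \<Gamma> ij vt where k: "k = (\<Gamma>, ij, vt)" "dual_level_tree \<Gamma>" "chart_choice \<Gamma> ij vt"
      using kK by (auto simp: K_def)
    show ?thesis
      using assms(3)[OF k(2,3)] by (simp only: k(1) \<psi>_def chart_target_def fst_conv prod.case)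
  qed
  note ** = t c[THEN conjunct1] c[THEN conjunct2]
  show "ztop X = ztop An" using *(1)[OF assms(1) **] .
  show "openin (ztop X) W \<Longrightarrow> regfun X W = regfun An W" using *(2)[OF assms(1) **] .
qed


section \<open>The groups and the action\<close>

definition affine_space :: "(complex ^ 'n::finite) fspace" where
  "affine_space = glue {(UNIV, range (\<lambda>i a. vec_nth a i))}"

definition Ga_pow :: "(complex ^ 'n::finite) monoid" where
  "Ga_pow = \<lparr>carrier = UNIV, mult = (+), one = 0\<rparr>"

definition Diag :: "(complex ^ 'n::finite) set" where
  "Diag = range (\<lambda>c. \<chi> i. c)"

definition translate_line :: "complex ^ 'n::finite \<Rightarrow> 'n mline \<Rightarrow> 'n mline" where
  "translate_line a L = L\<lparr>pt := (\<lambda>i.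
     translate_point (form L (mark L i)) (desc L (mark L i)) (vec_nth a i) (pt L i))\<rparr>"

definition act :: "complex ^ 'n::finite \<Rightarrow> 'n mline set \<Rightarrow> 'n mline set" where
  "act a x = (\<Union>L\<in>x. iso_rel `` {translate_line a L})"

text \<open>The orbit of \<open>z\<close> under simultaneous translation, and the class of the line
  \<open>(\<P>\<^sup>1, \<infinity>, dz, z\<^sub>1, \<dots>, z\<^sub>n)\<close> attached to it.\<close>

definition transl_orbit :: "complex ^ 'n::finite \<Rightarrow> (complex ^ 'n) set" where
  "transl_orbit z = range (\<lambda>c. z + (\<chi> i. c))"

definition irreducible_line :: "complex ^ 'n::finite \<Rightarrow> 'n mline" where
  "irreducible_line z = \<lparr>verts = {0}, adj = {}, vroot = 0, pre = {(0, 0)}, mark = (\<lambda>_. 0),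
     node = (\<lambda>_ _. Inf1), pinf = Inf1, form = (\<lambda>_ _. 1), pt = (\<lambda>i. Aff (vec_nth z i))\<rparr>"

definition incl :: "(complex ^ 'n::finite) set \<Rightarrow> 'n mline set" where
  "incl x = (\<Union>z\<in>x. iso_rel `` {irreducible_line z})"

end

theory Submission
  imports Defs
begin

text \<open>
  Write \<open>s\<^sub>k\<close>, \<open>t\<^sub>k\<close>, \<open>z\<^sub>i\<^sub>j\<close> for the scales and coordinates of a chart.  Translating the marked points by
  \<open>a\<close> adds \<open>a\<^sub>j - a\<^sub>i\<close> to the integral \<open>I\<^sub>i\<^sub>j\<close> if \<open>p\<^sub>i\<close> and \<open>p\<^sub>j\<close> lie on the same component and leaves it
  unchanged otherwise.  If \<open>h i \<and> h j\<close> is on level \<open>k\<close>, the product \<open>t\<^sub>k\<^sub>+\<^sub>1 \<cdots> t\<^sub>\<ell>\<close> equals \<open>1 / s\<^sub>k\<close> in the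
  first case and \<open>0\<close> in the second, so the new integral is \<open>s\<^sub>k w\<^sub>i\<^sub>j\<close> with the polynomial
  \<open>w\<^sub>i\<^sub>j = z\<^sub>i\<^sub>j + (a\<^sub>j - a\<^sub>i) t\<^sub>k\<^sub>+\<^sub>1 \<cdots> t\<^sub>\<ell>\<close>.  Around the class of a line \<open>L\<close> use the chart of the dual tree of
  \<open>L\<close>.  If a translate of \<open>L\<close> lies in the domain of some other chart, nearby translates of nearby lines
  do so as long as certain \<open>w\<^sub>i\<^sub>j\<close> do not vanish, and their coordinates in the other chart are quotients
  of the \<open>w\<^sub>i\<^sub>j\<close>, possibly times one \<open>t\<^sub>k\<close>.  Only differences \<open>a\<^sub>j - a\<^sub>i\<close> occur, which handles
  the quotient by the diagonal at the same time.
\<close>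

section \<open>Spaces glued from charts\<close>

text \<open>A differential whose only zero or pole is a double pole is the pullback of
  \<open>dz\<close> along a Moebius map sending the pole to infinity, by Liouville's theorem. This
  map is unique up to translation, so integrals are differences of coordinates and moving a point is
  addition. The product of the \<open>t\<close>s has two possible values because it telescopes: as
  the top scale is \<open>1\<close>, it is the inverse of a scale if all levels from there to the
  top are merged in the line, which is when the two points share a component. Otherwise some factor
  is \<open>0\<close>. The formulas for a change of chart have to be the same for all nearby lines.
  Translation keeps the dual tree, so the tree of the other chart contracts onto the tree of
  \<open>L\<close> itself; this one contraction, followed by the contraction to the tree of a nearby
  line, serves everywhere. Being monotone and onto, it passes from each level to the next by a step
  of at most one, which is why a single \<open>t\<close> suffices. That contractions preserve meets
  relies on connected fibres. Independence of representatives holds because the constants of an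
  isomorphism depend only on the level and are \<open>1\<close> on terminal components.\<close>

lemma polys_uminus: "f \<in> polys C \<Longrightarrow> (\<lambda>x. - f x) \<in> polys C"
  using polys.mult[OF polys.const[of "-1"]] by fastforce

lemma polys_diff: "f \<in> polys C \<Longrightarrow> g \<in> polys C \<Longrightarrow> (\<lambda>x. f x - g x) \<in> polys C"
  using polys.add[OF _ polys_uminus] by fastforce

lemma polys_prod:
  assumes "\<And>i. i \<in> I \<Longrightarrow> f i \<in> polys C"
  shows "(\<lambda>x. \<Prod>i\<in>I. f i x) \<in> polys C"
  using assms by (induction I rule: infinite_finite_induct) (auto intro: polys.const polys.mult)

text \<open>Quotients whose denominators have no zero on \<open>N\<close> are closed under sums and
  products, so a condition on the coordinates of the target passes to all polynomials in
  them.\<close>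

lemma polys_quotient_comp:
  assumes gen: "\<forall>c\<in>C'. \<exists>P\<in>polys C. \<exists>Q\<in>polys C. \<forall>y\<in>N. Q y \<noteq> 0 \<and> c (f y) = P y / Q y"
    and "p \<in> polys C'"
  shows "\<exists>P\<in>polys C. \<exists>Q\<in>polys C. \<forall>y\<in>N. Q y \<noteq> 0 \<and> p (f y) = P y / Q y"
  using assms(2)
proof (induction rule: polys.induct)
  case (const k)
  show ?case
    by (rule bexI[of _ "\<lambda>_. k"], rule bexI[of _ "\<lambda>_. 1"]) (auto intro: polys.const)
next
  case (gen c)
  then show ?case using assms(1) by blast
next
  case (add p q)
  then obtain P Q P' Q' where "P \<in> polys C" "Q \<in> polys C" "P' \<in> polys C" "Q' \<in> polys C"
    "\<forall>y\<in>N. Q y \<noteq> 0 \<and> p (f y) = P y / Q y" "\<forall>y\<in>N. Q' y \<noteq> 0 \<and> q (f y) = P' y / Q' y" by blast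
  then show ?case
    by (intro bexI[of _ "\<lambda>y. P y * Q' y + P' y * Q y"] bexI[of _ "\<lambda>y. Q y * Q' y"])
      (auto intro: polys.intros simp: add_frac_eq)
next
  case (mult p q)
  then obtain P Q P' Q' where "P \<in> polys C" "Q \<in> polys C" "P' \<in> polys C" "Q' \<in> polys C"
    "\<forall>y\<in>N. Q y \<noteq> 0 \<and> p (f y) = P y / Q y" "\<forall>y\<in>N. Q' y \<noteq> 0 \<and> q (f y) = P' y / Q' y" by blast
  then show ?case
    by (intro bexI[of _ "\<lambda>y. P y * P' y"] bexI[of _ "\<lambda>y. Q y * Q' y"]) (auto intro: polys.mult)
qed

text \<open>Here \<open>N\<close> may depend on the point and on the target chart. Continuity and
  regularity both reduce to the coordinates of the target by
  \<open>polys_quotient_comp\<close>.\<close>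

lemma is_morphism_glueI:
  assumes maps: "\<And>x. x \<in> topspace (ztop (glue Ch)) \<Longrightarrow> f x \<in> topspace (ztop (glue Ch'))"
    and loc: "\<And>x U' C'. x \<in> topspace (ztop (glue Ch)) \<Longrightarrow> (U', C') \<in> Ch' \<Longrightarrow> f x \<in> U' \<Longrightarrow>
      \<exists>U C N. (U, C) \<in> Ch \<and> openin (ztop (glue Ch)) N \<and> x \<in> N \<and> N \<subseteq> U \<and> f ` N \<subseteq> U' \<and>
        (\<forall>c\<in>C'. \<exists>P\<in>polys C. \<exists>Q\<in>polys C. \<forall>y\<in>N. Q y \<noteq> 0 \<and> c (f y) = P y / Q y)"
  shows "is_morphism (glue Ch) (glue Ch') f"
proof -
  let ?X = "ztop (glue Ch)" and ?Y = "ztop (glue Ch')"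
  have basic: "openin ?X {x \<in> topspace ?X. f x \<in> {y \<in> U'. p y \<noteq> 0}}"
    if ch: "(U', C') \<in> Ch'" and p: "p \<in> polys C'" for U' C' p
  proof (subst openin_subopen, intro ballI)
    fix x assume x: "x \<in> {x \<in> topspace ?X. f x \<in> {y \<in> U'. p y \<noteq> 0}}"
    then have "x \<in> topspace ?X" "f x \<in> U'" by simp_all
    from loc[OF this(1) ch this(2)] obtain U C N where N: "(U, C) \<in> Ch" "openin ?X N" "x \<in> N"
        "N \<subseteq> U" "f ` N \<subseteq> U'"
      and q: "\<forall>c\<in>C'. \<exists>P\<in>polys C. \<exists>Q\<in>polys C. \<forall>y\<in>N. Q y \<noteq> 0 \<and> c (f y) = P y / Q y"
      by (elim exE conjE)
    obtain P Q where PQ: "P \<in> polys C" "\<forall>y\<in>N. Q y \<noteq> 0 \<and> p (f y) = P y / Q y"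
      using polys_quotient_comp[of C' C N f, OF q p] by (elim bexE)
    \<comment> \<open>On \<open>N\<close> the pulled back polynomial is \<open>P / Q\<close> with
      \<open>Q\<close> nonvanishing, so its nonvanishing locus is that of \<open>P\<close>.\<close>
    have "openin ?X (N \<inter> {y \<in> U. P y \<noteq> 0})"
      using N(2) openin_glue_basic[OF N(1) PQ(1)] by blast
    moreover have "x \<in> N \<inter> {y \<in> U. P y \<noteq> 0}" using x PQ(2) N by auto
    moreover have "N \<inter> {y \<in> U. P y \<noteq> 0} \<subseteq> {x \<in> topspace ?X. f x \<in> {y \<in> U'. p y \<noteq> 0}}"
      using PQ(2) N openin_subset[OF N(2)] by auto
    ultimately show "\<exists>T. openin ?X T \<and> x \<in> T \<and> T \<subseteq> {x \<in> topspace ?X. f x \<in> {y \<in> U'. p y \<noteq> 0}}"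
      by blast
  qed
  have cont: "continuous_map ?X ?Y f"
    unfolding ztop_glue[of Ch']
  proof (rule continuous_on_generated_topo)
    fix V assume "V \<in> {{x \<in> U. P x \<noteq> 0} | U C P. (U, C) \<in> Ch' \<and> P \<in> polys C}"
    then obtain U' C' p where V: "V = {y \<in> U'. p y \<noteq> 0}" "(U', C') \<in> Ch'" "p \<in> polys C'" by blast
    have "f -` V \<inter> topspace ?X = {x \<in> topspace ?X. f x \<in> {y \<in> U'. p y \<noteq> 0}}" using V(1) by auto
    then show "openin ?X (f -` V \<inter> topspace ?X)" using basic[OF V(2,3)] by (simp only:)
  next
    show "f ` topspace ?X \<subseteq> \<Union>{{x \<in> U. P x \<noteq> 0} | U C P. (U, C) \<in> Ch' \<and> P \<in> polys C}"
      using maps unfolding ztop_glue[of Ch'] topology_generated_by_topspace by (rule image_subsetI)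
  qed
  have "g \<circ> f \<in> regfun (glue Ch) {x \<in> topspace ?X. f x \<in> V}"
    if V: "openin ?Y V" and g: "g \<in> regfun (glue Ch') V" for V g
    unfolding regfun_glue
  proof
    fix x assume x: "x \<in> {x \<in> topspace ?X. f x \<in> V}"
    then obtain U' C' p q M where ch: "(U', C') \<in> Ch'" and p: "p \<in> polys C'" and q: "q \<in> polys C'"
      and M: "openin ?Y M" "f x \<in> M" "M \<subseteq> V \<inter> U'" and pq: "\<forall>y\<in>M. q y \<noteq> 0 \<and> g y = p y / q y"
      using g unfolding regfun_glue by blast
    have "x \<in> topspace ?X" "f x \<in> U'" using x M by auto
    from loc[OF this(1) ch this(2)] obtain U C N where N: "(U, C) \<in> Ch" "openin ?X N" "x \<in> N"
        "N \<subseteq> U" "f ` N \<subseteq> U'"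
      and gen: "\<forall>c\<in>C'. \<exists>P\<in>polys C. \<exists>Q\<in>polys C. \<forall>y\<in>N. Q y \<noteq> 0 \<and> c (f y) = P y / Q y"
      by (elim exE conjE)
    obtain P Q where PQ: "P \<in> polys C" "Q \<in> polys C" "\<forall>y\<in>N. Q y \<noteq> 0 \<and> p (f y) = P y / Q y"
      using polys_quotient_comp[of C' C N f, OF gen p] by (elim bexE)
    obtain P' Q' where PQ': "P' \<in> polys C" "Q' \<in> polys C" "\<forall>y\<in>N. Q' y \<noteq> 0 \<and> q (f y) = P' y / Q' y"
      using polys_quotient_comp[of C' C N f, OF gen q] by (elim bexE)
    define N' where "N' = N \<inter> {x \<in> topspace ?X. f x \<in> M}"
    have "openin ?X N'"
      unfolding N'_def using N(2) openin_continuous_map_preimage[OF cont M(1)] by blast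
    moreover have "x \<in> N'" "N' \<subseteq> {x \<in> topspace ?X. f x \<in> V} \<inter> U" using x N M unfolding N'_def by auto
    \<comment> \<open>\<open>P'\<close> has no zero on \<open>N'\<close> because \<open>q\<close>
      has none on \<open>M\<close>, so the quotient of the fractions \<open>P / Q\<close> and
      \<open>P' / Q'\<close> is again an admissible fraction.\<close>
    moreover have "Q y * P' y \<noteq> 0 \<and> (g \<circ> f) y = (P y * Q' y) / (Q y * P' y)" if "y \<in> N'" for y
      using that PQ(3) PQ'(3) pq unfolding N'_def by auto
    ultimately show "\<exists>(U, C)\<in>Ch. \<exists>P\<in>polys C. \<exists>Q\<in>polys C. \<exists>N. openin ?X N \<and> x \<in> N \<and>
        N \<subseteq> {x \<in> topspace ?X. f x \<in> V} \<inter> U \<and> (\<forall>y\<in>N. Q y \<noteq> 0 \<and> (g \<circ> f) y = P y / Q y)"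
      using N(1) polys.mult[OF PQ(1) PQ'(2)] polys.mult[OF PQ(2) PQ'(1)]
      by (intro bexI[of _ "(U, C)"] case_prodI bexI[of _ "\<lambda>y. P y * Q' y"]
          bexI[of _ "\<lambda>y. Q y * P' y"] exI[of _ N'] conjI ballI) auto
  qed
  with cont show ?thesis unfolding is_morphism_def by blast
qed

lemma regfun_glue_coordinate:
  assumes "(U, C) \<in> Ch" "c \<in> C"
  shows "c \<in> regfun (glue Ch) U"
  unfolding regfun_glue using assms openin_glue_chart[OF assms(1)]
  by (intro ballI bexI[of _ "(U, C)"] case_prodI bexI[of _ c] bexI[of _ "\<lambda>_. 1"] exI[of _ U])
    (auto intro: polys.intros)

lemma topspace_prod_fspace:
  "topspace (ztop (prod_fspace X Y)) = topspace (ztop X) \<times> topspace (ztop Y)"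
proof -
  have "openin (ztop X) (topspace (ztop X))" "openin (ztop Y) (topspace (ztop Y))" by simp_all
  then show ?thesis unfolding prod_fspace_def topspace_glue by (auto dest: openin_subset)
qed

section \<open>Differentials with a single double pole\<close>

text \<open>The derivative of \<open>(a * z + b) / (c * z + d)\<close>. Division by zero yields
  \<open>0\<close> at a pole, which is the value that the normal form of a differential has
  there.\<close>

definition moebius_form :: "complex \<Rightarrow> complex \<Rightarrow> complex \<Rightarrow> complex \<Rightarrow> complex \<Rightarrow> complex" where
  "moebius_form a b c d z = (a * d - b * c) / (c * z + d) ^ 2"

section \<open>Composition and inversion of Moebius transformations\<close>

lemma moebius_moebius:
  assumes "a * d - b * c \<noteq> 0" "a' * d' - b' * c' \<noteq> 0"
  shows "moebius a b c d (moebius a' b' c' d' p) =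
    moebius (a * a' + b * c') (a * b' + b * d') (c * a' + d * c') (c * b' + d * d') p"
proof (cases p)
  case (Aff z)
  let ?n = "a' * z + b'" and ?m = "c' * z + d'"
  have e: "(a * a' + b * c') * z + (a * b' + b * d') = a * ?n + b * ?m"
    "(c * a' + d * c') * z + (c * b' + d * d') = c * ?n + d * ?m" by (simp_all add: algebra_simps)
  show ?thesis
  proof (cases "?m = 0")
    case True
    have "?n \<noteq> 0"
    proof
      assume "?n = 0"
      then have "c' * ?n - a' * ?m = 0" "d' * ?n - b' * ?m = 0" using True by simp_all
      then have "b' * c' - a' * d' = 0" "z * (a' * d' - b' * c') = 0" by (simp_all add: algebra_simps)
      then show False using assms(2) by simp
    qed
    then show ?thesis using Aff True e assms by (auto simp: divide_simps)
  next
    case False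
    have "c * (?n / ?m) + d = (c * ?n + d * ?m) / ?m" "a * (?n / ?m) + b = (a * ?n + b * ?m) / ?m"
      using False by (simp_all add: field_simps)
    then show ?thesis using Aff False e by (simp del: times_divide_eq_right)
  qed
next
  case Inf1
  show ?thesis
  proof (cases "c' = 0")
    case True
    then show ?thesis using Inf1 assms by auto
  next
    case False
    have "c * (a' / c') + d = (c * a' + d * c') / c'" "a * (a' / c') + b = (a * a' + b * c') / c'"
      using False by (simp_all add: field_simps)
    then show ?thesis using Inf1 False by (simp del: times_divide_eq_right)
  qed
qed

lemma moebius_scalar: "k \<noteq> 0 \<Longrightarrow> moebius k 0 0 k = id"
proof
  fix p assume "k \<noteq> 0" then show "moebius k 0 0 k p = id p" by (cases p) auto
qed

lemma moebius_comp:
  assumes "a * d - b * c \<noteq> 0" "a' * d' - b' * c' \<noteq> 0"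
  shows "moebius a b c d \<circ> moebius a' b' c' d' =
    moebius (a * a' + b * c') (a * b' + b * d') (c * a' + d * c') (c * b' + d * d')"
  using moebius_moebius[OF assms] by auto

lemma moebius_det_mult:
  fixes a :: complex
  shows "(a * a' + b * c') * (c * b' + d * d') - (a * b' + b * d') * (c * a' + d * c') =
    (a * d - b * c) * (a' * d' - b' * c')"
  by (simp add: algebra_simps)

lemma is_moebius_comp: "is_moebius \<phi> \<Longrightarrow> is_moebius \<psi> \<Longrightarrow> is_moebius (\<phi> \<circ> \<psi>)"
  unfolding is_moebius_def using moebius_comp moebius_det_mult by (metis mult_eq_0_iff)

text \<open>The adjugate matrix gives the inverse: its product with the matrix is the determinant
  times the identity, and this acts trivially by \<open>moebius_scalar\<close>.\<close>

lemma is_moebius_inverse: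
  assumes "is_moebius \<phi>"
  obtains \<psi> where "is_moebius \<psi>" "\<phi> \<circ> \<psi> = id" "\<psi> \<circ> \<phi> = id"
proof -
  obtain a b c d where 1: "a * d - b * c \<noteq> 0" "\<phi> = moebius a b c d"
    using assms unfolding is_moebius_def by blast
  have 2: "d * a - (-b) * (-c) \<noteq> 0" using 1 by (simp add: algebra_simps)
  have "moebius a b c d \<circ> moebius d (-b) (-c) a = id" "moebius d (-b) (-c) a \<circ> moebius a b c d = id"
    unfolding moebius_comp[OF 1(1) 2] moebius_comp[OF 2 1(1)]
    using moebius_scalar[OF 1(1)] by (simp_all add: algebra_simps)
  with that 1 2 show ?thesis unfolding is_moebius_def by blast
qed

lemma is_moebius_bij: "is_moebius \<phi> \<Longrightarrow> bij \<phi>"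
  by (metis is_moebius_inverse o_bij)

lemma is_moebius_id: "is_moebius id"
  unfolding is_moebius_def using moebius_scalar[of 1] by (metis diff_zero mult_zero_left mult_1 zero_neq_one)

lemma is_moebius_affine: "k \<noteq> 0 \<Longrightarrow> is_moebius (moebius k b 0 1)"
  unfolding is_moebius_def by (rule exI[of _ k], rule exI[of _ b], rule exI[of _ 0], rule exI[of _ 1]) simp

lemma is_moebius_fix_Inf:
  assumes "is_moebius \<phi>" "\<phi> Inf1 = Inf1"
  obtains k b where "k \<noteq> 0" "\<phi> = moebius k b 0 1"
proof -
  obtain a b c d where 1: "a * d - b * c \<noteq> 0" "\<phi> = moebius a b c d"
    using assms unfolding is_moebius_def by blast
  then have "c = 0" using assms by (auto split: if_splits)
  then have "\<phi> p = moebius (a / d) (b / d) 0 1 p" for p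
    using 1 by (cases p) (auto simp: field_simps)
  with that[of "a / d" "b / d"] 1 \<open>c = 0\<close> show ?thesis by auto
qed

section \<open>Pullback of differentials along Moebius transformations\<close>

lemma affine_denominator_nz:
  assumes "a * d - b * c \<noteq> (0::complex)"
  shows "\<forall>\<^sub>F w in at z. c * w + d \<noteq> 0"
proof (cases "c = 0")
  case True
  then show ?thesis using assms by auto
next
  case False
  have "\<forall>\<^sub>F w in at z. w \<noteq> - d / c"
    using eventually_neq_at_within[of "- d / c" z UNIV] by simp
  then show ?thesis
  proof eventually_elim
    case (elim w)
    then show "c * w + d \<noteq> 0" using False by (simp add: field_simps add_eq_0_iff)
  qed
qed

lemma remove_sings_moebius_form:
  assumes "a * d - b * c \<noteq> 0"
  shows "remove_sings (moebius_form a b c d) = moebius_form a b c d"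
proof
  fix z
  show "remove_sings (moebius_form a b c d) z = moebius_form a b c d z"
  proof (cases "c * z + d = 0")
    case False
    then have "moebius_form a b c d analytic_on {z}"
      unfolding moebius_form_def by (intro analytic_intros) auto
    then show ?thesis by simp
  next
    case True
    have "filterlim (\<lambda>w. (c * w + d) ^ 2) (at 0) (at z)"
    proof (rule filterlim_atI)
      have "((\<lambda>w. (c * w + d) ^ 2) \<longlongrightarrow> (c * z + d) ^ 2) (at z)" by (intro tendsto_intros)
      then show "((\<lambda>w. (c * w + d) ^ 2) \<longlongrightarrow> 0) (at z)" using True by simp
      show "\<forall>\<^sub>F w in at z. (c * w + d)\<^sup>2 \<noteq> 0"
        using affine_denominator_nz[OF assms] by eventually_elim simp
    qed
    then have "is_pole (moebius_form a b c d) z"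
      unfolding is_pole_def moebius_form_def using assms
      by (intro filterlim_divide_at_infinity[OF tendsto_const]) auto
    then show ?thesis using True by (simp add: moebius_form_def)
  qed
qed

text \<open>The chain rule. Both sides are in normal form, so they need only be compared in a
  punctured neighbourhood of \<open>z\<close>, where the inner map avoids infinity.\<close>

lemma pullback_moebius_form:
  assumes "a * d - b * c \<noteq> 0" "a' * d' - b' * c' \<noteq> 0"
  shows "pullback_form (moebius a' b' c' d') (moebius_form a b c d) =
    moebius_form (a * a' + b * c') (a * b' + b * d') (c * a' + d * c') (c * b' + d * d')"
    (is "?l = ?r")
proof
  fix z
  let ?\<phi> = "\<lambda>u. aff (moebius a' b' c' d' (Aff u))"
  have "\<forall>\<^sub>F w in at z. moebius_form a b c d (?\<phi> w) * deriv ?\<phi> w = ?r w"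
    using affine_denominator_nz[OF assms(2)]
  proof eventually_elim
    case (elim w)
    have "open {u. c' * u + d' \<noteq> 0}" by (intro open_Collect_neq continuous_intros)
    then have ev: "\<forall>\<^sub>F u in nhds w. c' * u + d' \<noteq> 0"
      using elim eventually_nhds_in_open by fastforce
    have ev: "\<forall>\<^sub>F u in nhds w. ?\<phi> u = (a' * u + b') / (c' * u + d')"
      using ev by eventually_elim simp
    have "((\<lambda>u. (a' * u + b') / (c' * u + d')) has_field_derivative
        (a' * d' - b' * c') / (c' * w + d') ^ 2) (at w)"
      using elim by (auto intro!: derivative_eq_intros simp: power2_eq_square algebra_simps)
    then have D: "deriv ?\<phi> w = (a' * d' - b' * c') / (c' * w + d') ^ 2"
      using deriv_cong_ev[OF ev refl] by (simp add: DERIV_imp_deriv)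
    have "c * ((a' * w + b') / (c' * w + d')) + d =
        ((c * a' + d * c') * w + (c * b' + d * d')) / (c' * w + d')"
      using elim by (simp add: field_simps)
    then show ?case using elim unfolding D moebius_form_def
      by (simp del: times_divide_eq_right add: moebius_det_mult power_divide) simp
  qed
  then have "?l z = remove_sings ?r z"
    unfolding pullback_form_def by (intro remove_sings_cong refl)
  also have "\<dots> = ?r z"
    by (subst remove_sings_moebius_form) (use assms in \<open>simp_all add: moebius_det_mult\<close>)
  finally show "?l z = ?r z" .
qed

lemma moebius_form_1: "moebius_form 1 0 0 1 = (\<lambda>_. 1)" by (auto simp: moebius_form_def)

lemma pullback_moebius_dz:
  assumes "a * d - b * c \<noteq> 0"
  shows "pullback_form (moebius a b c d) (\<lambda>_. 1) = moebius_form a b c d"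
  using pullback_moebius_form[of 1 1 0 0 a d b c] assms by (simp add: moebius_form_1)

text \<open>Functoriality, stated for pullbacks of \<open>dz\<close> because every differential with
  an affine coordinate is one; \<open>pullback_scale\<close> and \<open>pullback_comp\<close> are
  derived from it.\<close>

lemma pullback_pullback_dz:
  assumes "is_moebius \<phi>" "is_moebius \<psi>"
  shows "pullback_form \<psi> (pullback_form \<phi> (\<lambda>_. 1)) = pullback_form (\<phi> \<circ> \<psi>) (\<lambda>_. 1)"
  using assms unfolding is_moebius_def
  by (auto simp: pullback_moebius_dz pullback_moebius_form moebius_comp moebius_det_mult)

text \<open>Rescaling a differential amounts to composing its coordinate with an affine map. In this
  way the constants of a projective isomorphism are absorbed into coordinates.\<close>

lemma pullback_affine_comp_dz:
  assumes "is_moebius \<phi>" "k \<noteq> 0"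
  shows "pullback_form (moebius k b 0 1 \<circ> \<phi>) (\<lambda>_. 1) = (\<lambda>z. k * pullback_form \<phi> (\<lambda>_. 1) z)"
proof -
  have "moebius_form k b 0 1 = (\<lambda>_. k)" by (auto simp: moebius_form_def)
  then have 1: "pullback_form (moebius k b 0 1) (\<lambda>_. 1) = (\<lambda>_. k)"
    using pullback_moebius_dz[of k 1 b 0] assms by simp
  obtain a b' c d where ad: "a * d - b' * c \<noteq> 0" and \<phi>: "\<phi> = moebius a b' c d"
    using assms unfolding is_moebius_def by blast
  show ?thesis
    unfolding \<phi> pullback_moebius_dz[OF ad] using ad assms
    by (subst moebius_comp) (auto simp: pullback_moebius_dz moebius_form_def algebra_simps)
qed

section \<open>Affine coordinates of a differential\<close>

lemma affine_coord_unique: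
  assumes "affine_coord f e \<phi>" "affine_coord f e \<psi>"
  obtains b where "\<psi> = moebius 1 b 0 1 \<circ> \<phi>"
proof -
  note d = assms[unfolded affine_coord_def]
  obtain \<theta> where \<theta>: "is_moebius \<theta>" "\<phi> \<circ> \<theta> = id" "\<theta> \<circ> \<phi> = id"
    using d is_moebius_inverse by metis
  \<comment> \<open>The change of coordinate fixes infinity, hence is affine with some slope
    \<open>k\<close>. Both coordinates pull \<open>dz\<close> back to \<open>f\<close>, which is not
    identically zero, so \<open>k = 1\<close>.\<close>
  have "is_moebius (\<psi> \<circ> \<theta>)" "(\<psi> \<circ> \<theta>) Inf1 = Inf1"
    using d \<theta> is_moebius_comp by (auto simp: o_def fun_eq_iff id_def) metis
  then obtain k b where kb: "k \<noteq> 0" "\<psi> \<circ> \<theta> = moebius k b 0 1" by (rule is_moebius_fix_Inf)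
  have \<psi>: "\<psi> = moebius k b 0 1 \<circ> \<phi>"
    using \<theta>(3) by (simp add: kb(2)[symmetric] comp_assoc)
  have "f = (\<lambda>z. k * f z)" using d pullback_affine_comp_dz[of \<phi> k b] kb \<psi> by metis
  moreover have "\<exists>z. f z \<noteq> 0"
  proof -
    obtain a b c d' where ad: "a * d' - b * c \<noteq> 0" "\<phi> = moebius a b c d'"
      using d unfolding is_moebius_def by blast
    then have "f = moebius_form a b c d'" using d pullback_moebius_dz by metis
    moreover have "\<exists>z. c * z + d' \<noteq> 0" using eventually_happens'[OF _ affine_denominator_nz[OF ad(1), of 0]] by auto
    ultimately show ?thesis using ad by (auto simp: moebius_form_def)
  qed
  ultimately have "k = 1" by (metis mult_cancel_right1)
  then show ?thesis using \<psi> that by simp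
qed


lemma pullback_scale:
  assumes "affine_coord f d \<psi>" "is_moebius \<phi>" "k \<noteq> 0"
  shows "pullback_form \<phi> (\<lambda>z. k * f z) = (\<lambda>z. k * pullback_form \<phi> f z)"
proof -
  have \<psi>: "is_moebius \<psi>" "f = pullback_form \<psi> (\<lambda>_. 1)" using assms(1) by (auto simp: affine_coord_def)
  note k = is_moebius_affine[OF assms(3), of 0]
  have "pullback_form \<phi> (\<lambda>z. k * f z) = pullback_form ((moebius k 0 0 1 \<circ> \<psi>) \<circ> \<phi>) (\<lambda>_. 1)"
    unfolding \<psi>(2) pullback_affine_comp_dz[OF \<psi>(1) assms(3), of 0, symmetric]
    by (rule pullback_pullback_dz[OF is_moebius_comp[OF k \<psi>(1)] assms(2)])
  also have "\<dots> = (\<lambda>z. k * pullback_form (\<psi> \<circ> \<phi>) (\<lambda>_. 1) z)"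
    unfolding comp_assoc by (rule pullback_affine_comp_dz[OF is_moebius_comp[OF \<psi>(1) assms(2)] assms(3)])
  finally show ?thesis
    unfolding \<psi>(2) pullback_pullback_dz[OF \<psi>(1) assms(2)] .
qed

lemma pullback_comp:
  assumes "affine_coord f d \<theta>" "is_moebius \<phi>" "is_moebius \<psi>"
  shows "pullback_form (\<phi> \<circ> \<psi>) f = pullback_form \<psi> (pullback_form \<phi> f)"
  using assms pullback_pullback_dz is_moebius_comp unfolding affine_coord_def by (metis comp_assoc)

text \<open>Dividing \<open>\<psi>' \<circ> \<phi>\<close> by \<open>k\<close> gives an affine
  coordinate of \<open>f\<close>, and this is unique up to translation.\<close>

lemma affine_coord_pullback:
  assumes f: "affine_coord f d \<psi>" and f': "affine_coord f' (\<phi> d) \<psi>'"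
    and \<phi>: "is_moebius \<phi>" and pb: "pullback_form \<phi> f' = (\<lambda>z. k * f z)" and k: "k \<noteq> 0"
  obtains b where "\<psi>' \<circ> \<phi> = moebius k b 0 1 \<circ> \<psi>"
proof -
  have \<psi>': "is_moebius \<psi>'" "\<psi>' (\<phi> d) = Inf1" "f' = pullback_form \<psi>' (\<lambda>_. 1)"
    using f' by (auto simp: affine_coord_def)
  have m: "is_moebius (\<psi>' \<circ> \<phi>)" using \<psi>' \<phi> is_moebius_comp by blast
  have "pullback_form (\<psi>' \<circ> \<phi>) (\<lambda>_. 1) = (\<lambda>z. k * f z)"
    using pb pullback_pullback_dz[OF \<psi>'(1) \<phi>] \<psi>'(3) by simp
  then have "affine_coord f d (moebius (1 / k) 0 0 1 \<circ> (\<psi>' \<circ> \<phi>))"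
    unfolding affine_coord_def using k m \<psi>' is_moebius_comp[OF is_moebius_affine m, of "1 / k" 0]
    by (simp add: pullback_affine_comp_dz)
  then obtain b where "moebius (1 / k) 0 0 1 \<circ> (\<psi>' \<circ> \<phi>) = moebius 1 b 0 1 \<circ> \<psi>"
    by (rule affine_coord_unique[OF f])
  then have "moebius k 0 0 1 \<circ> (moebius (1 / k) 0 0 1 \<circ> (\<psi>' \<circ> \<phi>)) =
    moebius k 0 0 1 \<circ> (moebius 1 b 0 1 \<circ> \<psi>)" by simp
  then have "\<psi>' \<circ> \<phi> = moebius k (k * b) 0 1 \<circ> \<psi>"
    unfolding comp_assoc[symmetric] using k by (simp add: moebius_comp moebius_scalar)
  then show ?thesis by (rule that)
qed

section \<open>Integrals and translations in an affine coordinate\<close>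

lemma affine_coord_finite:
  assumes "affine_coord f d \<phi>"
  shows "\<phi> p = Inf1 \<longleftrightarrow> p = d"
  using assms is_moebius_bij unfolding affine_coord_def by (metis bij_is_inj injD)

lemma affine_coord_Aff:
  assumes "affine_coord f d \<phi>" "p \<noteq> d"
  shows "\<phi> p = Aff (aff (\<phi> p))"
  using affine_coord_finite[OF assms(1), of p] assms(2) by (cases "\<phi> p") auto

lemma affine_coord_inj:
  assumes "affine_coord f d \<phi>" "p \<noteq> d" "q \<noteq> d" "aff (\<phi> p) = aff (\<phi> q)"
  shows "p = q"
proof -
  have "\<phi> p = \<phi> q" using assms affine_coord_Aff by metis
  then show ?thesis using assms(1) is_moebius_bij unfolding affine_coord_def by (metis bij_is_inj injD)
qed

text \<open>For any parametrisation \<open>\<psi>\<close> of the complement of the pole,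
  \<open>\<phi> \<circ> \<psi>\<close> is affine with some slope \<open>k\<close> and the form
  becomes the constant \<open>k\<close>. The integral is thus the difference of the values of
  \<open>\<phi>\<close>, whatever \<open>\<psi>\<close> and \<open>\<gamma>\<close> are.\<close>

lemma form_integral_affine_coord:
  assumes \<phi>: "affine_coord f d \<phi>" and p: "p \<noteq> d" and q: "q \<noteq> d"
  shows "form_integral f d p q = aff (\<phi> q) - aff (\<phi> p)"
  unfolding form_integral_def
proof (rule the_equality)
  have int: "((\<lambda>_. k) has_contour_integral (k * pathfinish \<gamma> - k * pathstart \<gamma>)) \<gamma>"
    if "valid_path \<gamma>" for k \<gamma>
    using contour_integral_primitive[of UNIV "\<lambda>z. k * z" "\<lambda>_. k" \<gamma>] that
    by (auto intro!: derivative_eq_intros)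
  have m: "is_moebius \<phi>" "\<phi> d = Inf1" "f = pullback_form \<phi> (\<lambda>_. 1)"
    using \<phi> by (auto simp: affine_coord_def)
  {
    fix I assume "\<exists>\<psi> \<gamma>. is_moebius \<psi> \<and> \<psi> Inf1 = d \<and> valid_path \<gamma> \<and>
      \<psi> (Aff (pathstart \<gamma>)) = p \<and> \<psi> (Aff (pathfinish \<gamma>)) = q \<and>
      (pullback_form \<psi> f has_contour_integral I) \<gamma>"
    then obtain \<psi> \<gamma> where \<psi>: "is_moebius \<psi>" "\<psi> Inf1 = d" and \<gamma>: "valid_path \<gamma>"
      "\<psi> (Aff (pathstart \<gamma>)) = p" "\<psi> (Aff (pathfinish \<gamma>)) = q"
      and I: "(pullback_form \<psi> f has_contour_integral I) \<gamma>" by blast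
    have "is_moebius (\<phi> \<circ> \<psi>)" "(\<phi> \<circ> \<psi>) Inf1 = Inf1" using m \<psi> is_moebius_comp by auto
    then obtain k b where kb: "k \<noteq> 0" "\<phi> \<circ> \<psi> = moebius k b 0 1" by (rule is_moebius_fix_Inf)
    have "pullback_form \<psi> f = moebius_form k b 0 1"
      using pullback_pullback_dz[OF m(1) \<psi>(1)] m(3) kb pullback_moebius_dz[of k 1 b 0] by simp
    then have "pullback_form \<psi> f = (\<lambda>_. k)" by (auto simp: moebius_form_def)
    then have "I = k * pathfinish \<gamma> - k * pathstart \<gamma>"
      using has_contour_integral_unique[OF I] int[OF \<gamma>(1)] by simp
    moreover have "\<phi> p = Aff (k * pathstart \<gamma> + b)" "\<phi> q = Aff (k * pathfinish \<gamma> + b)"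
      using kb(2) \<gamma> by (simp_all add: fun_eq_iff flip: \<gamma>(2,3))
    ultimately show "I = aff (\<phi> q) - aff (\<phi> p)" by simp
  }
  \<comment> \<open>For existence, parametrise by the inverse of \<open>\<phi>\<close> and take the
    straight segment between the coordinates of \<open>p\<close> and \<open>q\<close>.\<close>
  obtain \<psi> where \<psi>: "is_moebius \<psi>" "\<phi> \<circ> \<psi> = id" "\<psi> \<circ> \<phi> = id" using m(1) is_moebius_inverse by metis
  let ?\<gamma> = "linepath (aff (\<phi> p)) (aff (\<phi> q))"
  have "pullback_form \<psi> f = (\<lambda>_. 1)"
    using pullback_pullback_dz[OF m(1) \<psi>(1)] m(3) \<psi>(2) pullback_moebius_dz[of 1 1 0 0]
    by (simp add: moebius_form_1 moebius_scalar)
  then have "(pullback_form \<psi> f has_contour_integral aff (\<phi> q) - aff (\<phi> p)) ?\<gamma>"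
    using int[of ?\<gamma> 1] by simp
  moreover have "\<psi> (Aff (aff (\<phi> p))) = p" "\<psi> (Aff (aff (\<phi> q))) = q" "\<psi> Inf1 = d"
    using affine_coord_Aff[OF \<phi>] p q \<psi>(3) m(2) by (metis comp_apply id_apply)+
  ultimately show "\<exists>\<psi> \<gamma>. is_moebius \<psi> \<and> \<psi> Inf1 = d \<and> valid_path \<gamma> \<and>
      \<psi> (Aff (pathstart \<gamma>)) = p \<and> \<psi> (Aff (pathfinish \<gamma>)) = q \<and>
      (pullback_form \<psi> f has_contour_integral aff (\<phi> q) - aff (\<phi> p)) \<gamma>"
    using \<psi>(1) by (intro exI[of _ \<psi>] exI[of _ ?\<gamma>]) auto
qed

text \<open>The coordinate selected by \<open>translate_point\<close> differs from
  \<open>\<phi>\<close> by a translation, which commutes with adding \<open>a\<close>.\<close>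

lemma translate_point_affine_coord:
  assumes \<phi>: "affine_coord f d \<phi>" and p: "p \<noteq> d"
  shows "\<phi> (translate_point f d a p) = Aff (aff (\<phi> p) + a)" "translate_point f d a p \<noteq> d"
proof -
  define \<psi> where "\<psi> = (SOME \<phi>. affine_coord f d \<phi>)"
  have \<psi>: "affine_coord f d \<psi>" unfolding \<psi>_def by (rule someI[of "affine_coord f d", OF \<phi>])
  obtain b where b: "\<phi> = moebius 1 b 0 1 \<circ> \<psi>" by (rule affine_coord_unique[OF \<psi> \<phi>])
  have "bij \<psi>" using \<psi> is_moebius_bij by (simp add: affine_coord_def)
  then have "\<psi> (translate_point f d a p) = Aff (aff (\<psi> p) + a)"
    unfolding translate_point_def Let_def \<psi>_def[symmetric] by (simp add: bij_is_surj surj_f_inv_f)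
  moreover obtain z where "\<psi> p = Aff z" using affine_coord_Aff[OF \<psi> p] by blast
  then have "aff (\<phi> p) = aff (\<psi> p) + b" using b by simp
  ultimately show *: "\<phi> (translate_point f d a p) = Aff (aff (\<phi> p) + a)" using b by simp
  then show "translate_point f d a p \<noteq> d" using affine_coord_finite[OF \<phi>, of "translate_point f d a p"] by simp
qed

lemma translate_point_eqI:
  assumes "affine_coord f d \<phi>" "p \<noteq> d" "q \<noteq> d" "aff (\<phi> q) = aff (\<phi> p) + a"
  shows "translate_point f d a p = q"
  by (rule affine_coord_inj[OF assms(1) _ assms(3)])
    (simp_all add: translate_point_affine_coord[OF assms(1,2)] assms(4))

section \<open>Classification by Liouville's theorem\<close>

lemma meromorphic_zorder_limit:
  assumes "f meromorphic_on {z}" "\<forall>\<^sub>F w in at z. f w \<noteq> 0"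
  obtains c where "c \<noteq> 0" "((\<lambda>w. f w * (w - z) powi (- zorder f z)) \<longlongrightarrow> c) (at z)"
proof -
  have "isolated_singularity_at f z" "not_essential f z"
    using assms(1) by (auto simp: meromorphic_on_altdef)
  moreover have "\<exists>\<^sub>F w in at z. f w \<noteq> 0" using assms(2) by (simp add: eventually_frequently)
  ultimately have "zor_poly f z z \<noteq> 0 \<and> (\<exists>r>0. zor_poly f z holomorphic_on cball z r \<and>
      (\<forall>w\<in>cball z r - {z}. f w = zor_poly f z w * (w - z) powi zorder f z \<and> zor_poly f z w \<noteq> 0))"
    by (rule zorder_exist)
  then obtain g r where g: "g z \<noteq> 0" "r > 0" "g holomorphic_on cball z r"
    "\<forall>w\<in>cball z r - {z}. f w = g w * (w - z) powi zorder f z" by blast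
  have "isCont g z"
    using g(2,3) by (intro continuous_on_interior[OF holomorphic_on_imp_continuous_on[OF g(3)]]) auto
  then have lim: "g \<midarrow>z\<rightarrow> g z" by (simp add: isCont_def)
  have "\<forall>\<^sub>F w in at z. w \<in> ball z r - {z}" using g(2) by (intro eventually_at_in_open) auto
  then have "\<forall>\<^sub>F w in at z. g w = f w * (w - z) powi (- zorder f z)"
  proof eventually_elim
    case (elim w)
    then have "(w - z) powi zorder f z * (w - z) powi (- zorder f z) = 1"
      by (simp add: power_int_minus)
    then show ?case using g(4) elim by (simp add: mult.assoc)
  qed
  then show ?thesis by (rule that[OF g(1) Lim_transform_eventually[OF lim]])
qed

text \<open>After multiplication by \<open>(z - a) ^ 2\<close> if the pole is a finite point
  \<open>a\<close>, the coefficient extends to an entire function with a finite limit at infinity,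
  so it is a constant \<open>- c\<close>. Hence \<open>f\<close> is the derivative of
  \<open>- c * z\<close> or of \<open>c / (z - a)\<close>.\<close>

lemma only_double_pole_imp_affine_coord:
  assumes "only_double_pole d f"
  obtains \<phi> where "affine_coord f d \<phi>"
proof -
  have rs: "remove_sings f = f" and mero: "\<And>p. local_coeff f p meromorphic_on {0}"
    and ne: "\<And>p. \<forall>\<^sub>F w in at 0. local_coeff f p w \<noteq> 0"
    and zo: "\<And>p. zorder (local_coeff f p) 0 = (if p = d then -2 else 0)"
    using assms by (auto simp: only_double_pole_def meromorphic_form_def)
  have lim: "\<exists>c. c \<noteq> 0 \<and> ((\<lambda>w. local_coeff f p w * w powi (if p = d then 2 else 0)) \<longlongrightarrow> c) (at 0)" for p
  proof -
    obtain c where "c \<noteq> 0"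
      "((\<lambda>w. local_coeff f p w * (w - 0) powi (- zorder (local_coeff f p) 0)) \<longlongrightarrow> c) (at 0)"
      by (rule meromorphic_zorder_limit[OF mero ne])
    then show ?thesis unfolding zo by (cases "p = d") auto
  qed
  have limz: "\<exists>c. c \<noteq> 0 \<and> ((\<lambda>w. f w * (w - z) powi (if Aff z = d then 2 else 0)) \<longlongrightarrow> c) (at z)" for z
  proof -
    obtain c where "c \<noteq> 0" "((\<lambda>w. f (z + w) * w powi (if Aff z = d then 2 else 0)) \<longlongrightarrow> c) (at 0)"
      using lim[of "Aff z"] unfolding local_coeff_def by auto
    moreover from this(2) have "((\<lambda>w. f w * (w - z) powi (if Aff z = d then 2 else 0)) \<longlongrightarrow> c) (at z)"
      by (intro LIM_offset_zero_cancel[of _ z]) simp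
    ultimately show ?thesis by blast
  qed
  have "f meromorphic_on {z}" for z
    using mero[of "Aff z"] by (simp add: meromorphic_on_def local_coeff_def)
  then have f_mero: "f meromorphic_on UNIV" by (subst meromorphic_on_meromorphic_at) simp
  then have iso: "isolated_singularity_at f z" for z by (auto simp: meromorphic_on_altdef)
  have ana: "f analytic_on {z}" if z: "Aff z \<noteq> d" for z
  proof -
    have "\<exists>c. c \<noteq> 0 \<and> f \<midarrow>z\<rightarrow> c" using limz[of z] z by simp
    then obtain c where "f \<midarrow>z\<rightarrow> c" by blast
    from remove_sings_analytic_at[OF iso this] show ?thesis unfolding rs .
  qed
  \<comment> \<open>\<open>q\<close> cancels a finite pole. A double pole at infinity means that
    \<open>f\<close> itself has a finite nonzero limit there.\<close>
  define q where "q = (\<lambda>z. case d of Aff a \<Rightarrow> (z - a) ^ 2 | Inf1 \<Rightarrow> 1)"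
  define F where "F = (\<lambda>z. f z * q z)"
  have q_ana: "q analytic_on A" for A
    unfolding q_def by (cases d) (simp_all add: analytic_on_power analytic_on_diff)
  have qnz: "q z \<noteq> 0" if "Aff z \<noteq> d" for z using that unfolding q_def by (cases d) auto
  have F_lim: "\<exists>c. F \<midarrow>z\<rightarrow> c" for z
  proof (cases "Aff z = d")
    case True
    then have "q = (\<lambda>w. (w - z) ^ 2)" by (auto simp: q_def)
    then show ?thesis using limz[of z] True by (auto simp: F_def)
  next
    case False
    then have "F analytic_on {z}" unfolding F_def by (intro analytic_on_mult ana q_ana)
    then show ?thesis using analytic_at_imp_isCont isContD by blast
  qed
  have "F meromorphic_on UNIV"
    unfolding F_def by (intro meromorphic_on_mult f_mero analytic_on_imp_meromorphic_on q_ana)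
  then have "isolated_singularity_at F z" for z by (simp add: meromorphic_on_altdef)
  then have "remove_sings F analytic_on {z}" for z
    using F_lim[of z] remove_sings_analytic_at[of F z] by blast
  then have "remove_sings F analytic_on UNIV" by (subst analytic_on_analytic_at) blast
  then have hol: "remove_sings F holomorphic_on UNIV" by (rule analytic_imp_holomorphic)
  have FF: "remove_sings F z = F z" if z: "Aff z \<noteq> d" for z
    unfolding F_def by (intro remove_sings_at_analytic analytic_on_mult ana[OF z] q_ana)
  obtain c where c: "c \<noteq> 0" "((\<lambda>w. - f (1 / w) / w ^ 2 * w powi (if Inf1 = d then 2 else 0)) \<longlongrightarrow> c) (at 0)"
    using lim[of Inf1] unfolding local_coeff_def by auto
  have nz: "\<forall>\<^sub>F w in at 0. w \<noteq> (0::complex)" by (simp add: eventually_at_filter)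
  have "((\<lambda>w. F (1 / w)) \<longlongrightarrow> - c) (at 0)"
  proof (cases d)
    case Inf1
    have "\<forall>\<^sub>F w in at 0. - (- f (1 / w) / w ^ 2 * w powi 2) = F (1 / w)"
      using nz by eventually_elim (simp add: F_def q_def Inf1)
    moreover have "((\<lambda>w. - (- f (1 / w) / w ^ 2 * w powi 2)) \<longlongrightarrow> - c) (at 0)"
      using c(2) Inf1 by (intro tendsto_minus) simp
    ultimately show ?thesis by (rule Lim_transform_eventually[rotated])
  next
    case (Aff a)
    \<comment> \<open>The first factor is the local coefficient at infinity, which tends to
      \<open>c\<close>; the second comes from \<open>1 / w - a = (1 - a * w) / w\<close> and tends
      to \<open>-1\<close>. The sign is that of \<open>dz = - dw / w ^ 2\<close>.\<close>
    have "\<forall>\<^sub>F w in at 0. (- f (1 / w) / w ^ 2) * (- ((1 - a * w) ^ 2)) = F (1 / w)"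
      using nz
    proof eventually_elim
      case (elim w)
      then have "1 / w - a = (1 - a * w) / w" by (simp add: field_simps)
      then show ?case by (simp add: F_def q_def Aff power_divide)
    qed
    moreover have "((\<lambda>w. (- f (1 / w) / w ^ 2) * (- ((1 - a * w) ^ 2))) \<longlongrightarrow> c * (- ((1 - a * 0) ^ 2))) (at 0)"
      using c(2) Aff by (intro tendsto_mult tendsto_intros) simp
    ultimately have "((\<lambda>w. F (1 / w)) \<longlongrightarrow> c * (- ((1 - a * 0) ^ 2))) (at 0)"
      by (rule Lim_transform_eventually[rotated])
    then show ?thesis by simp
  qed
  then have "(F \<longlongrightarrow> - c) at_infinity"
    by (simp add: lim_at_infinity_0 o_def inverse_eq_divide)
  moreover have "\<forall>\<^sub>F z in at_infinity. F z = remove_sings F z"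
  proof (cases d)
    case (Aff a)
    have "\<forall>\<^sub>F z in at_infinity. z \<noteq> a" by (rule eventually_not_equal_at_infinity)
    then show ?thesis by eventually_elim (simp add: FF Aff)
  qed (simp add: FF)
  ultimately have "(remove_sings F \<longlongrightarrow> - c) at_infinity" by (rule Lim_transform_eventually)
  then have "remove_sings F z = - c" for z by (rule Liouville_weak[OF hol])
  then have fq: "f z = - c / q z" if "Aff z \<noteq> d" for z
    using FF[OF that] qnz[OF that] by (simp add: F_def field_simps)
  show ?thesis
  proof (cases d)
    case Inf1
    then have "f = moebius_form (- c) 0 0 1" using fq by (auto simp: q_def moebius_form_def)
    then have "affine_coord f d (moebius (- c) 0 0 1)"
      using c(1) is_moebius_affine[of "- c" 0] Inf1 by (simp add: affine_coord_def pullback_moebius_dz)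
    then show ?thesis by (rule that)
  next
    case (Aff a)
    \<comment> \<open>This is the derivative of \<open>c / (z - a)\<close>. Equality at the pole
      itself holds because both sides are in normal form.\<close>
    have "f z = moebius_form 0 c 1 (- a) z" for z
    proof -
      have "\<forall>\<^sub>F w in at z. w \<noteq> a" by (rule eventually_neq_at_within)
      then have "\<forall>\<^sub>F w in at z. f w = moebius_form 0 c 1 (- a) w"
        by eventually_elim (use fq Aff in \<open>simp add: q_def moebius_form_def\<close>)
      then have "remove_sings f z = remove_sings (moebius_form 0 c 1 (- a)) z"
        by (intro remove_sings_cong refl)
      then show ?thesis using rs c(1) by (simp add: remove_sings_moebius_form)
    qed
    then have "f = moebius_form 0 c 1 (- a)" ..
    moreover have "is_moebius (moebius 0 c 1 (- a))"
      unfolding is_moebius_def using c(1)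
      by (intro exI[of _ 0] exI[of _ c] exI[of _ 1] exI[of _ "- a"]) simp
    ultimately have "affine_coord f d (moebius 0 c 1 (- a))"
      using c(1) Aff by (simp add: affine_coord_def pullback_moebius_dz)
    then show ?thesis by (rule that)
  qed
qed

lemma only_double_pole_dz: "only_double_pole Inf1 (\<lambda>_. 1)"
proof -
  have "zorder (\<lambda>w::complex. - 1 / w\<^sup>2) 0 = -2"
    by (rule zorder_eqI[of UNIV _ "\<lambda>_. -1"]) (auto simp: power_int_minus field_simps)
  moreover have "(\<lambda>w::complex. - 1 / w\<^sup>2) meromorphic_on {0}" by (intro meromorphic_intros)
  moreover have "\<forall>\<^sub>F w in at (0::complex). w \<noteq> 0" by (simp add: eventually_at_filter)
  ultimately show ?thesis
    unfolding only_double_pole_def meromorphic_form_def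
    by (auto simp: local_coeff_def fun_eq_iff split: cp1.split)
qed

section \<open>Level trees and contractions\<close>

definition parent :: "('n, 'x) ltree_scheme \<Rightarrow> nat \<Rightarrow> nat" where
  "parent \<Gamma> v = (THE w. w \<in> nbrs \<Gamma> v \<and> strictly_below \<Gamma> w v)"

text \<open>Edges oriented from child to parent. The reflexive transitive closure relates each
  vertex to its ancestors, see \<open>ancestor_iff\<close>.\<close>

definition up :: "('n, 'x) ltree_scheme \<Rightarrow> (nat \<times> nat) set" where
  "up \<Gamma> = {(v, parent \<Gamma> v) | v. v \<in> verts \<Gamma> \<and> v \<noteq> vroot \<Gamma>}"

definition children :: "('n, 'x) ltree_scheme \<Rightarrow> nat \<Rightarrow> nat set" where
  "children \<Gamma> v = {c. (c, v) \<in> up \<Gamma>}"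

text \<open>A measure that is strictly monotone for \<open>strictly_below\<close>, for inductions
  towards the root and for picking extremal vertices.\<close>

definition rank :: "('n, 'x) ltree_scheme \<Rightarrow> nat \<Rightarrow> nat" where
  "rank \<Gamma> v = card {w \<in> verts \<Gamma>. strictly_below \<Gamma> w v}"

text \<open>The conditions on a stable marked line that concern only its dual tree. The record
  scheme makes the same facts available for a line and for its truncation.\<close>

locale level_tree =
  fixes \<Gamma> :: "('n, 'x) ltree_scheme"
  assumes tree: "is_tree \<Gamma>"
    and root_vert: "vroot \<Gamma> \<in> verts \<Gamma>"
    and preord: "preorder_on (verts \<Gamma>) (pre \<Gamma>)"
    and pre_verts: "pre \<Gamma> \<subseteq> verts \<Gamma> \<times> verts \<Gamma>"
    and pre_total: "total_on (verts \<Gamma>) (pre \<Gamma>)"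
    and lower_nbr: "\<forall>v\<in>verts \<Gamma>. v \<noteq> vroot \<Gamma> \<longrightarrow> (\<exists>!w. w \<in> nbrs \<Gamma> v \<and> strictly_below \<Gamma> w v)"
    and terminals: "\<forall>u v. is_terminal \<Gamma> u \<and> is_terminal \<Gamma> v \<longrightarrow> (u, v) \<in> same_level \<Gamma>"
    and mark_terminal: "is_terminal \<Gamma> (mark \<Gamma> i)"
    and stab: "\<forall>v\<in>verts \<Gamma>. if is_terminal \<Gamma> v then v \<in> range (mark \<Gamma>)
        else card (nbrs \<Gamma> v) \<ge> 3 \<or> (card (nbrs \<Gamma> v) \<ge> 2 \<and> v = vroot \<Gamma>)"
begin

abbreviation le (infix "\<le>\<^sub>l" 50) where "u \<le>\<^sub>l v \<equiv> (u, v) \<in> pre \<Gamma>"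
abbreviation lt (infix "<\<^sub>l" 50) where "u <\<^sub>l v \<equiv> strictly_below \<Gamma> u v"

lemma finite_verts: "finite (verts \<Gamma>)"
  using tree by (simp add: is_tree_def)

lemma le_refl: "v \<in> verts \<Gamma> \<Longrightarrow> v \<le>\<^sub>l v"
  using preord by (simp add: preorder_on_def refl_on_def)

lemma le_trans: "u \<le>\<^sub>l v \<Longrightarrow> v \<le>\<^sub>l w \<Longrightarrow> u \<le>\<^sub>l w"
  using preord unfolding preorder_on_def trans_def by blast

lemma le_total: "u \<in> verts \<Gamma> \<Longrightarrow> v \<in> verts \<Gamma> \<Longrightarrow> u \<le>\<^sub>l v \<or> v \<le>\<^sub>l u"
  using pre_total le_refl by (cases "u = v") (auto simp: total_on_def)

lemma le_verts: "u \<le>\<^sub>l v \<Longrightarrow> u \<in> verts \<Gamma> \<and> v \<in> verts \<Gamma>"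
  using pre_verts by blast

lemma lt_le: "u <\<^sub>l v \<Longrightarrow> u \<le>\<^sub>l v"
  by (simp add: strictly_below_def)

lemma not_le_lt: "u \<in> verts \<Gamma> \<Longrightarrow> v \<in> verts \<Gamma> \<Longrightarrow> \<not> v \<le>\<^sub>l u \<longleftrightarrow> u <\<^sub>l v"
  using le_total by (auto simp: strictly_below_def)

lemma lt_le_trans: "u <\<^sub>l v \<Longrightarrow> v \<le>\<^sub>l w \<Longrightarrow> u <\<^sub>l w"
  unfolding strictly_below_def using le_trans by blast

lemma rank_strict_mono: "u <\<^sub>l v \<Longrightarrow> rank \<Gamma> u < rank \<Gamma> v"
  unfolding rank_def
proof (rule psubset_card_mono)
  assume uv: "u <\<^sub>l v"
  then have "u \<in> verts \<Gamma>" using lt_le le_verts by blast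
  moreover have "\<not> u <\<^sub>l u" by (simp add: strictly_below_def)
  ultimately show "{w \<in> verts \<Gamma>. w <\<^sub>l u} \<subset> {w \<in> verts \<Gamma>. w <\<^sub>l v}"
    using uv lt_le lt_le_trans by blast
qed (simp add: finite_verts)

section \<open>Parents and ancestors\<close>

lemma parent:
  assumes "v \<in> verts \<Gamma>" "v \<noteq> vroot \<Gamma>"
  shows "(v, parent \<Gamma> v) \<in> adj \<Gamma>" "parent \<Gamma> v <\<^sub>l v" "parent \<Gamma> v \<in> verts \<Gamma>"
proof -
  have "parent \<Gamma> v \<in> nbrs \<Gamma> v \<and> parent \<Gamma> v <\<^sub>l v"
    unfolding parent_def by (rule theI') (use lower_nbr assms in blast)
  then show "(v, parent \<Gamma> v) \<in> adj \<Gamma>" "parent \<Gamma> v <\<^sub>l v" "parent \<Gamma> v \<in> verts \<Gamma>"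
    using lt_le le_verts by (auto simp: nbrs_def)
qed

lemma parentI:
  assumes "v \<in> verts \<Gamma>" "v \<noteq> vroot \<Gamma>" "(v, w) \<in> adj \<Gamma>" "w <\<^sub>l v"
  shows "w = parent \<Gamma> v"
  unfolding parent_def using lower_nbr assms by (intro the1_equality[symmetric]) (auto simp: nbrs_def)

lemma upI: "v \<in> verts \<Gamma> \<Longrightarrow> v \<noteq> vroot \<Gamma> \<Longrightarrow> (v, parent \<Gamma> v) \<in> up \<Gamma>"
  by (auto simp: up_def)

lemma upD:
  assumes "(v, w) \<in> up \<Gamma>"
  shows "v \<in> verts \<Gamma>" "w \<in> verts \<Gamma>" "v \<noteq> vroot \<Gamma>" "w = parent \<Gamma> v" "w <\<^sub>l v" "(v, w) \<in> adj \<Gamma>"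
  using assms parent by (auto simp: up_def)

lemma up_strict: "(v, w) \<in> (up \<Gamma>)\<^sup>* \<Longrightarrow> v = w \<or> w <\<^sub>l v"
proof (induction rule: rtrancl_induct)
  case (step y z)
  then show ?case using upD(5)[OF step(2)] lt_le lt_le_trans by blast
qed simp

lemma up_le: "v \<in> verts \<Gamma> \<Longrightarrow> (v, w) \<in> (up \<Gamma>)\<^sup>* \<Longrightarrow> w \<le>\<^sub>l v"
  using up_strict le_refl lt_le by blast

lemma up_verts: "v \<in> verts \<Gamma> \<Longrightarrow> (v, w) \<in> (up \<Gamma>)\<^sup>* \<Longrightarrow> w \<in> verts \<Gamma>"
  using up_le le_verts by blast

lemma up_antisym: "(v, w) \<in> (up \<Gamma>)\<^sup>* \<Longrightarrow> (w, v) \<in> (up \<Gamma>)\<^sup>* \<Longrightarrow> v = w"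
  using up_strict unfolding strictly_below_def by blast

lemma up_chain: "(u, v) \<in> (up \<Gamma>)\<^sup>* \<Longrightarrow> (u, w) \<in> (up \<Gamma>)\<^sup>* \<Longrightarrow> (v, w) \<in> (up \<Gamma>)\<^sup>* \<or> (w, v) \<in> (up \<Gamma>)\<^sup>*"
  by (rule single_valued_confluent) (auto simp: single_valued_def dest: upD(4))

lemma up_cases:
  assumes "(v, w) \<in> (up \<Gamma>)\<^sup>*" "v \<noteq> w"
  shows "v \<in> verts \<Gamma>" "v \<noteq> vroot \<Gamma>" "(parent \<Gamma> v, w) \<in> (up \<Gamma>)\<^sup>*"
proof -
  obtain x where x: "(v, x) \<in> up \<Gamma>" "(x, w) \<in> (up \<Gamma>)\<^sup>*" using assms by (meson converse_rtranclE)
  then show "v \<in> verts \<Gamma>" "v \<noteq> vroot \<Gamma>" "(parent \<Gamma> v, w) \<in> (up \<Gamma>)\<^sup>*"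
    using upD[OF x(1)] by auto
qed

lemma up_root: "v \<in> verts \<Gamma> \<Longrightarrow> (v, vroot \<Gamma>) \<in> (up \<Gamma>)\<^sup>*"
proof (induction "rank \<Gamma> v" arbitrary: v rule: less_induct)
  case less
  show ?case
  proof (cases "v = vroot \<Gamma>")
    case False
    then show ?thesis
      using less parent[of v] rank_strict_mono upI[of v] by (meson converse_rtrancl_into_rtrancl)
  qed simp
qed

lemma root_le: "v \<in> verts \<Gamma> \<Longrightarrow> vroot \<Gamma> \<le>\<^sub>l v"
  using up_root up_le by blast

lemma walk_Cons:
  assumes "simple_walk \<Gamma> u xs v" "(w, u) \<in> adj \<Gamma>" "w \<notin> set xs"
  shows "simple_walk \<Gamma> w (w # xs) v"
  using assms tree unfolding simple_walk_def is_tree_def by (auto simp: successively_Cons)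

text \<open>By uniqueness of simple walks this is the walk to the ancestor, which turns statements
  about paths into statements about \<open>up\<close>.\<close>

lemma up_walk:
  assumes "v \<in> verts \<Gamma>" "(v, w) \<in> (up \<Gamma>)\<^sup>*"
  shows "\<exists>xs. simple_walk \<Gamma> v xs w \<and> set xs = {x. (v, x) \<in> (up \<Gamma>)\<^sup>* \<and> (x, w) \<in> (up \<Gamma>)\<^sup>*}"
  using assms(2,1)
proof (induction rule: converse_rtrancl_induct)
  case base
  have "simple_walk \<Gamma> w [w] w" using base by (simp add: simple_walk_def)
  then show ?case using up_antisym by (intro exI[of _ "[w]"]) auto
next
  case (step v p)
  then obtain xs where xs: "simple_walk \<Gamma> p xs w"
    "set xs = {x. (p, x) \<in> (up \<Gamma>)\<^sup>* \<and> (x, w) \<in> (up \<Gamma>)\<^sup>*}" using upD(2)[OF step(1)] by blast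
  note v = upD[OF step(1)]
  have "v \<notin> set xs"
    using xs(2) up_le[OF v(2), of v] v(5) by (auto simp: strictly_below_def)
  then have "simple_walk \<Gamma> v (v # xs) w" using walk_Cons[OF xs(1)] v by blast
  moreover have "set (v # xs) = {x. (v, x) \<in> (up \<Gamma>)\<^sup>* \<and> (x, w) \<in> (up \<Gamma>)\<^sup>*}"
    using xs(2) step(1,2) up_cases(3)[of v] v(4) by (auto intro: converse_rtrancl_into_rtrancl)
  ultimately show ?case by blast
qed

lemma walk_unique:
  "simple_walk \<Gamma> u xs v \<Longrightarrow> simple_walk \<Gamma> u ys v \<Longrightarrow> xs = ys"
proof -
  assume w: "simple_walk \<Gamma> u xs v" "simple_walk \<Gamma> u ys v"
  then have "u \<in> verts \<Gamma>" "v \<in> verts \<Gamma>"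
    unfolding simple_walk_def using hd_in_set last_in_set by (metis subsetD)+
  then show ?thesis using w tree unfolding is_tree_def by blast
qed

lemma ancestor_iff: "ancestor \<Gamma> v u \<longleftrightarrow> u \<in> verts \<Gamma> \<and> (u, v) \<in> (up \<Gamma>)\<^sup>*"
proof
  assume "ancestor \<Gamma> v u"
  then obtain xs where xs: "simple_walk \<Gamma> u xs (vroot \<Gamma>)" "v \<in> set xs" by (auto simp: ancestor_def)
  then have u: "u \<in> verts \<Gamma>" unfolding simple_walk_def using hd_in_set by blast
  obtain ys where "simple_walk \<Gamma> u ys (vroot \<Gamma>)"
    "set ys = {x. (u, x) \<in> (up \<Gamma>)\<^sup>* \<and> (x, vroot \<Gamma>) \<in> (up \<Gamma>)\<^sup>*}"
    using up_walk[OF u up_root[OF u]] by blast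
  then show "u \<in> verts \<Gamma> \<and> (u, v) \<in> (up \<Gamma>)\<^sup>*" using xs u walk_unique by blast
next
  assume uv: "u \<in> verts \<Gamma> \<and> (u, v) \<in> (up \<Gamma>)\<^sup>*"
  then have u: "u \<in> verts \<Gamma>" ..
  obtain ys where "simple_walk \<Gamma> u ys (vroot \<Gamma>)"
    "set ys = {x. (u, x) \<in> (up \<Gamma>)\<^sup>* \<and> (x, vroot \<Gamma>) \<in> (up \<Gamma>)\<^sup>*}"
    using up_walk[OF u up_root[OF u]] by blast
  then show "ancestor \<Gamma> v u" unfolding ancestor_def using uv up_root up_verts by blast
qed

lemma adj_sym: "(u, v) \<in> adj \<Gamma> \<Longrightarrow> (v, u) \<in> adj \<Gamma>"
  using tree by (auto simp: is_tree_def sym_def)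

lemma adj_verts: "(u, v) \<in> adj \<Gamma> \<Longrightarrow> u \<in> verts \<Gamma> \<and> v \<in> verts \<Gamma> \<and> u \<noteq> v"
  using tree by (auto simp: is_tree_def irrefl_def)

lemma adj_lt_up: "(v, w) \<in> adj \<Gamma> \<Longrightarrow> w <\<^sub>l v \<Longrightarrow> (v, w) \<in> up \<Gamma>"
  using parentI[of v w] upI[of v] adj_verts[of v w] root_le[of w] by (auto simp: strictly_below_def)

text \<open>Adjacent vertices on the same level would give two simple walks to the root.\<close>

lemma adj_up:
  assumes "(v, w) \<in> adj \<Gamma>"
  shows "(v, w) \<in> up \<Gamma> \<or> (w, v) \<in> up \<Gamma>"
proof (rule ccontr)
  assume "\<not> ?thesis"
  then have n: "\<not> w <\<^sub>l v" "\<not> v <\<^sub>l w" using adj_lt_up assms adj_sym by blast+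
  note vw = adj_verts[OF assms]
  obtain xs where xs: "simple_walk \<Gamma> v xs (vroot \<Gamma>)"
      "set xs = {x. (v, x) \<in> (up \<Gamma>)\<^sup>* \<and> (x, vroot \<Gamma>) \<in> (up \<Gamma>)\<^sup>*}"
    using up_walk up_root vw by blast
  then have "w \<notin> set xs" using up_strict n vw by blast
  then have "simple_walk \<Gamma> w (w # xs) (vroot \<Gamma>)" using walk_Cons[OF xs(1) adj_sym[OF assms]] by blast
  then have "ancestor \<Gamma> v w" unfolding ancestor_def using xs(2) up_root vw by auto
  then show False using ancestor_iff up_strict n vw by blast
qed

lemma nbrs_eq: "nbrs \<Gamma> v = {p. (v, p) \<in> up \<Gamma>} \<union> children \<Gamma> v"
  using adj_up upD(6) adj_sym by (auto simp: nbrs_def children_def)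

section \<open>Terminal vertices and branching\<close>

lemma is_terminal_iff: "is_terminal \<Gamma> v \<longleftrightarrow> v \<in> verts \<Gamma> \<and> children \<Gamma> v = {}"
proof -
  have "u = v" if "children \<Gamma> v = {}" "(u, v) \<in> (up \<Gamma>)\<^sup>*" for u
    using that(2,1) by (auto elim: rtranclE simp: children_def)
  moreover have "c \<in> verts \<Gamma> \<and> c \<noteq> v \<and> (c, v) \<in> (up \<Gamma>)\<^sup>*" if "c \<in> children \<Gamma> v" for c
    using that upD[of c v] by (auto simp: children_def strictly_below_def)
  ultimately show ?thesis unfolding is_terminal_def ancestor_iff by blast
qed

text \<open>A descendant of largest rank has no child, because a child would have larger
  rank.\<close>

lemma terminal_descendant:
  assumes "v \<in> verts \<Gamma>"
  obtains u where "is_terminal \<Gamma> u" "(u, v) \<in> (up \<Gamma>)\<^sup>*"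
proof -
  let ?D = "{u \<in> verts \<Gamma>. (u, v) \<in> (up \<Gamma>)\<^sup>*}"
  have "finite ?D" "?D \<noteq> {}" using finite_verts assms by auto
  then obtain u where u: "u \<in> ?D" and "Max (rank \<Gamma> ` ?D) = rank \<Gamma> u" by (rule obtains_MAX)
  then have max: "rank \<Gamma> w \<le> rank \<Gamma> u" if "w \<in> ?D" for w
    using Max_ge[OF finite_imageI[OF \<open>finite ?D\<close>] imageI[OF that, of "rank \<Gamma>"]] by simp
  have "children \<Gamma> u = {}"
  proof (rule ccontr)
    assume "children \<Gamma> u \<noteq> {}"
    then obtain c where c: "(c, u) \<in> up \<Gamma>" by (auto simp: children_def)
    then have "c \<in> ?D" using u upD(1) by (auto intro: converse_rtrancl_into_rtrancl)
    then show False using max rank_strict_mono[OF upD(5)[OF c]] by fastforce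
  qed
  then show ?thesis using u that is_terminal_iff by blast
qed

lemma marked_descendant:
  assumes "v \<in> verts \<Gamma>"
  obtains i where "(mark \<Gamma> i, v) \<in> (up \<Gamma>)\<^sup>*"
proof -
  obtain u where u: "is_terminal \<Gamma> u" "(u, v) \<in> (up \<Gamma>)\<^sup>*" by (rule terminal_descendant[OF assms])
  then have "u \<in> verts \<Gamma>" by (simp add: is_terminal_def)
  then have "u \<in> range (mark \<Gamma>)" using stab u(1) by fastforce
  then show ?thesis using u(2) that by blast
qed

text \<open>Stability counts neighbours. At most one of them is the parent, and the root, for which
  the bound is weaker, has no parent.\<close>

lemma two_children:
  assumes "v \<in> verts \<Gamma>" "\<not> is_terminal \<Gamma> v"
  obtains c c' where "(c, v) \<in> up \<Gamma>" "(c', v) \<in> up \<Gamma>" "c \<noteq> c'"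
proof -
  have fin: "finite (children \<Gamma> v)"
    using finite_verts upD(1) unfolding children_def by (auto intro: finite_subset)
  have "card (nbrs \<Gamma> v) \<le> card {p. (v, p) \<in> up \<Gamma>} + card (children \<Gamma> v)"
    unfolding nbrs_eq by (rule card_Un_le)
  moreover have "{p. (v, p) \<in> up \<Gamma>} = (if v = vroot \<Gamma> then {} else {parent \<Gamma> v})"
    using assms(1) by (auto simp: up_def)
  moreover have "card (nbrs \<Gamma> v) \<ge> 3 \<or> (card (nbrs \<Gamma> v) \<ge> 2 \<and> v = vroot \<Gamma>)"
    using stab assms by auto
  ultimately have "card (children \<Gamma> v) \<ge> 2" by (auto split: if_splits)
  then obtain c c' where "c \<in> children \<Gamma> v" "c' \<in> children \<Gamma> v" "c \<noteq> c'"
    using card_le_Suc0_iff_eq[OF fin] by fastforce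
  then show ?thesis using that by (auto simp: children_def)
qed

section \<open>Meets\<close>

lemma mark_verts: "mark \<Gamma> i \<in> verts \<Gamma>"
  using mark_terminal by (simp add: is_terminal_def)

text \<open>Common ancestors form a chain, and all of them are ancestors of the one of largest
  rank.\<close>

lemma meet_exists:
  assumes "u \<in> verts \<Gamma>" "v \<in> verts \<Gamma>"
  shows "\<exists>w. (u, w) \<in> (up \<Gamma>)\<^sup>* \<and> (v, w) \<in> (up \<Gamma>)\<^sup>* \<and>
    (\<forall>x. (u, x) \<in> (up \<Gamma>)\<^sup>* \<and> (v, x) \<in> (up \<Gamma>)\<^sup>* \<longrightarrow> (w, x) \<in> (up \<Gamma>)\<^sup>*)"
proof -
  let ?C = "{w. (u, w) \<in> (up \<Gamma>)\<^sup>* \<and> (v, w) \<in> (up \<Gamma>)\<^sup>*}"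
  have "?C \<subseteq> verts \<Gamma>" using up_verts assms by blast
  then have "finite ?C" using finite_verts finite_subset by blast
  moreover have "?C \<noteq> {}" using up_root assms by blast
  ultimately obtain w where w: "w \<in> ?C" and "Max (rank \<Gamma> ` ?C) = rank \<Gamma> w" by (rule obtains_MAX)
  then have max: "rank \<Gamma> x \<le> rank \<Gamma> w" if "x \<in> ?C" for x
    using Max_ge[OF finite_imageI[OF \<open>finite ?C\<close>] imageI[OF that, of "rank \<Gamma>"]] by simp
  have "(w, x) \<in> (up \<Gamma>)\<^sup>*" if x: "x \<in> ?C" for x
  proof -
    have "(w, x) \<in> (up \<Gamma>)\<^sup>* \<or> (x, w) \<in> (up \<Gamma>)\<^sup>*" using up_chain w x by blast
    then show ?thesis using max[OF x] up_strict[of x w] rank_strict_mono[of w x] by auto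
  qed
  then show ?thesis using w by blast
qed

lemma meet_eqI:
  assumes "u \<in> verts \<Gamma>" "v \<in> verts \<Gamma>" "(u, w) \<in> (up \<Gamma>)\<^sup>*" "(v, w) \<in> (up \<Gamma>)\<^sup>*"
    and "\<And>x. (u, x) \<in> (up \<Gamma>)\<^sup>* \<Longrightarrow> (v, x) \<in> (up \<Gamma>)\<^sup>* \<Longrightarrow> (w, x) \<in> (up \<Gamma>)\<^sup>*"
  shows "meet \<Gamma> u v = w"
  unfolding meet_def ancestor_iff
proof (rule the_equality)
  show "(u \<in> verts \<Gamma> \<and> (u, w) \<in> (up \<Gamma>)\<^sup>*) \<and> (v \<in> verts \<Gamma> \<and> (v, w) \<in> (up \<Gamma>)\<^sup>*) \<and>
    (\<forall>w'. (u \<in> verts \<Gamma> \<and> (u, w') \<in> (up \<Gamma>)\<^sup>*) \<and> (v \<in> verts \<Gamma> \<and> (v, w') \<in> (up \<Gamma>)\<^sup>*) \<and>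
      w' \<in> verts \<Gamma> \<and> (w', w) \<in> (up \<Gamma>)\<^sup>* \<longrightarrow> w' = w)"
    using assms up_antisym by blast
next
  fix x assume "(u \<in> verts \<Gamma> \<and> (u, x) \<in> (up \<Gamma>)\<^sup>*) \<and> (v \<in> verts \<Gamma> \<and> (v, x) \<in> (up \<Gamma>)\<^sup>*) \<and>
    (\<forall>w'. (u \<in> verts \<Gamma> \<and> (u, w') \<in> (up \<Gamma>)\<^sup>*) \<and> (v \<in> verts \<Gamma> \<and> (v, w') \<in> (up \<Gamma>)\<^sup>*) \<and>
      w' \<in> verts \<Gamma> \<and> (w', x) \<in> (up \<Gamma>)\<^sup>* \<longrightarrow> w' = x)"
  then show "x = w" using assms up_verts[OF assms(1,3)] by blast
qed

lemma meet:
  assumes "u \<in> verts \<Gamma>" "v \<in> verts \<Gamma>"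
  shows "(u, meet \<Gamma> u v) \<in> (up \<Gamma>)\<^sup>*" "(v, meet \<Gamma> u v) \<in> (up \<Gamma>)\<^sup>*"
    "\<And>x. (u, x) \<in> (up \<Gamma>)\<^sup>* \<Longrightarrow> (v, x) \<in> (up \<Gamma>)\<^sup>* \<Longrightarrow> (meet \<Gamma> u v, x) \<in> (up \<Gamma>)\<^sup>*"
    "meet \<Gamma> u v \<in> verts \<Gamma>"
proof -
  obtain w where w: "(u, w) \<in> (up \<Gamma>)\<^sup>*" "(v, w) \<in> (up \<Gamma>)\<^sup>*"
    "\<And>x. (u, x) \<in> (up \<Gamma>)\<^sup>* \<Longrightarrow> (v, x) \<in> (up \<Gamma>)\<^sup>* \<Longrightarrow> (w, x) \<in> (up \<Gamma>)\<^sup>*"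
    using meet_exists[OF assms] by blast
  then have m: "meet \<Gamma> u v = w" by (intro meet_eqI assms)
  show "(u, meet \<Gamma> u v) \<in> (up \<Gamma>)\<^sup>*" "(v, meet \<Gamma> u v) \<in> (up \<Gamma>)\<^sup>*" "meet \<Gamma> u v \<in> verts \<Gamma>"
    using w up_verts assms unfolding m by blast+
  show "(meet \<Gamma> u v, x) \<in> (up \<Gamma>)\<^sup>*" if "(u, x) \<in> (up \<Gamma>)\<^sup>*" "(v, x) \<in> (up \<Gamma>)\<^sup>*" for x
    unfolding m by (rule w(3)[OF that])
qed

lemma meet_same: "u \<in> verts \<Gamma> \<Longrightarrow> meet \<Gamma> u u = u"
  by (rule meet_eqI) auto

lemma meet_commute: "u \<in> verts \<Gamma> \<Longrightarrow> v \<in> verts \<Gamma> \<Longrightarrow> meet \<Gamma> u v = meet \<Gamma> v u"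
  using meet[of v u] by (intro meet_eqI) auto

lemma terminal_up: "is_terminal \<Gamma> v \<Longrightarrow> (u, v) \<in> (up \<Gamma>)\<^sup>* \<Longrightarrow> u = v"
  by (auto elim: rtranclE simp: is_terminal_iff children_def)

lemma mark_eq_iff_meet_terminal:
  "is_terminal \<Gamma> (meet \<Gamma> (mark \<Gamma> i) (mark \<Gamma> j)) \<longleftrightarrow> mark \<Gamma> i = mark \<Gamma> j"
  using terminal_up meet(1,2)[OF mark_verts mark_verts] meet_same[OF mark_verts] mark_terminal by metis

lemma branch_below:
  assumes "(u, w) \<in> (up \<Gamma>)\<^sup>*" "u \<noteq> w"
  obtains c where "(u, c) \<in> (up \<Gamma>)\<^sup>*" "(c, w) \<in> up \<Gamma>"
  using assms by (auto elim: rtranclE)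

text \<open>Ancestors of \<open>c\<close> or \<open>c'\<close> other than these vertices are
  ancestors of \<open>w\<close>. A common ancestor that is not of this kind would lie in both
  branches, which would make the siblings \<open>c\<close> and \<open>c'\<close> comparable.\<close>

lemma meet_branches:
  assumes "u \<in> verts \<Gamma>" "v \<in> verts \<Gamma>" "(u, c) \<in> (up \<Gamma>)\<^sup>*" "(v, c') \<in> (up \<Gamma>)\<^sup>*"
    and c: "(c, w) \<in> up \<Gamma>" "(c', w) \<in> up \<Gamma>" "c \<noteq> c'"
  shows "meet \<Gamma> u v = w"
proof (rule meet_eqI[OF assms(1,2)])
  fix x assume x: "(u, x) \<in> (up \<Gamma>)\<^sup>*" "(v, x) \<in> (up \<Gamma>)\<^sup>*"
  have p: "parent \<Gamma> c = w" "parent \<Gamma> c' = w" using c upD(4) by blast+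
  show "(w, x) \<in> (up \<Gamma>)\<^sup>*"
  proof (cases "(c, x) \<in> (up \<Gamma>)\<^sup>* \<and> c \<noteq> x \<or> (c', x) \<in> (up \<Gamma>)\<^sup>* \<and> c' \<noteq> x")
    case True
    then show ?thesis using up_cases(3)[of c x] up_cases(3)[of c' x] p by auto
  next
    case False
    then have "(x, c) \<in> (up \<Gamma>)\<^sup>*" "(x, c') \<in> (up \<Gamma>)\<^sup>*"
      using up_chain[OF assms(3) x(1)] up_chain[OF assms(4) x(2)] by auto
    then have "(c, c') \<in> (up \<Gamma>)\<^sup>* \<or> (c', c) \<in> (up \<Gamma>)\<^sup>*" by (rule up_chain)
    then have "c <\<^sub>l c' \<or> c' <\<^sub>l c" using up_strict c(3) by blast
    moreover have "(c, w) \<in> (up \<Gamma>)\<^sup>* \<or> (c', w) \<in> (up \<Gamma>)\<^sup>*" using c by blast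
    ultimately have False
      using \<open>(c, c') \<in> (up \<Gamma>)\<^sup>* \<or> (c', c) \<in> (up \<Gamma>)\<^sup>*\<close> c p up_cases(3)[of c c'] up_cases(3)[of c' c]
        up_strict[of w c'] up_strict[of w c] upD(5)[OF c(1)] upD(5)[OF c(2)]
      unfolding strictly_below_def by metis
    then show ?thesis ..
  qed
qed (use assms in \<open>auto intro: rtrancl_into_rtrancl\<close>)

text \<open>Two children of \<open>v\<close> have marked descendants, whose meet is
  \<open>v\<close>. Marks and their meets thus exhaust the vertices, which makes contractions
  unique.\<close>

lemma nonterminal_meet:
  assumes "v \<in> verts \<Gamma>" "\<not> is_terminal \<Gamma> v"
  obtains i j where "meet \<Gamma> (mark \<Gamma> i) (mark \<Gamma> j) = v"
proof -
  obtain c c' where c: "(c, v) \<in> up \<Gamma>" "(c', v) \<in> up \<Gamma>" "c \<noteq> c'" by (rule two_children[OF assms])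
  obtain i j where "(mark \<Gamma> i, c) \<in> (up \<Gamma>)\<^sup>*" "(mark \<Gamma> j, c') \<in> (up \<Gamma>)\<^sup>*"
    using marked_descendant upD(1) c by metis
  then show ?thesis using meet_branches[OF mark_verts mark_verts _ _ c] that by blast
qed

text \<open>Reversing the path from \<open>u\<close> up to \<open>c\<close> and prepending
  \<open>w\<close> gives the simple walk from \<open>w\<close> to \<open>u\<close>, whose second
  vertex is \<open>c\<close>.\<close>

lemma the_next_vertex:
  assumes "u \<in> verts \<Gamma>" "(u, c) \<in> (up \<Gamma>)\<^sup>*" "(c, w) \<in> up \<Gamma>"
  shows "(THE x. \<exists>xs. simple_walk \<Gamma> w (w # x # xs) u) = c"
proof -
  obtain xs where xs: "simple_walk \<Gamma> u xs c" "set xs = {x. (u, x) \<in> (up \<Gamma>)\<^sup>* \<and> (x, c) \<in> (up \<Gamma>)\<^sup>*}"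
    using up_walk assms by blast
  have adjsym: "(\<lambda>x y. (y, x) \<in> adj \<Gamma>) = (\<lambda>x y. (x, y) \<in> adj \<Gamma>)"
    using adj_sym by blast
  have "w \<notin> set xs"
    using xs(2) up_strict[of w c] upD(5)[OF assms(3)] by (auto simp: strictly_below_def)
  moreover have "successively (\<lambda>x y. (y, x) \<in> adj \<Gamma>) xs"
    using xs(1) unfolding simple_walk_def adjsym by blast
  then have "simple_walk \<Gamma> c (rev xs) u"
    using xs(1) unfolding simple_walk_def by (auto simp: hd_rev last_rev)
  ultimately have "simple_walk \<Gamma> w (w # rev xs) u"
    using walk_Cons adj_sym[OF upD(6)[OF assms(3)]] by simp
  moreover obtain ys where "rev xs = c # ys"
    using xs(1) unfolding simple_walk_def by (metis hd_rev list.collapse rev_is_Nil_conv)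
  ultimately have w: "simple_walk \<Gamma> w (w # c # ys) u" by simp
  show ?thesis
    by (rule the_equality) (use w walk_unique[OF w] in blast)+
qed

section \<open>Levels\<close>

lemma same_level_iff: "(u, v) \<in> same_level \<Gamma> \<longleftrightarrow> u \<le>\<^sub>l v \<and> v \<le>\<^sub>l u"
  by (auto simp: same_level_def)

lemma class_eq_iff:
  assumes "u \<in> verts \<Gamma>" "v \<in> verts \<Gamma>"
  shows "same_level \<Gamma> `` {u} = same_level \<Gamma> `` {v} \<longleftrightarrow> (u, v) \<in> same_level \<Gamma>"
  using assms le_refl le_trans unfolding Image_singleton same_level_iff by blast

lemma level_eq: "level \<Gamma> v = card ((\<lambda>w. same_level \<Gamma> `` {w}) ` {w \<in> verts \<Gamma>. w <\<^sub>l v})"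
  unfolding level_def quotient_def by (rule arg_cong[of _ _ card]) auto

lemma level_strict_mono:
  assumes "u <\<^sub>l v" shows "level \<Gamma> u < level \<Gamma> v"
  unfolding level_eq
proof (rule psubset_card_mono)
  have u: "u \<in> verts \<Gamma>" using lt_le le_verts assms by blast
  have "same_level \<Gamma> `` {u} \<notin> (\<lambda>w. same_level \<Gamma> `` {w}) ` {w \<in> verts \<Gamma>. w <\<^sub>l u}"
    using class_eq_iff u by (auto simp: same_level_iff strictly_below_def)
  then show "(\<lambda>w. same_level \<Gamma> `` {w}) ` {w \<in> verts \<Gamma>. w <\<^sub>l u} \<subset>
      (\<lambda>w. same_level \<Gamma> `` {w}) ` {w \<in> verts \<Gamma>. w <\<^sub>l v}"
    using u assms lt_le lt_le_trans by blast
qed (simp add: finite_verts)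

lemma level_le_iff:
  assumes "u \<in> verts \<Gamma>" "v \<in> verts \<Gamma>"
  shows "level \<Gamma> u \<le> level \<Gamma> v \<longleftrightarrow> u \<le>\<^sub>l v"
proof
  assume "u \<le>\<^sub>l v"
  then have "{w \<in> verts \<Gamma>. w <\<^sub>l u} \<subseteq> {w \<in> verts \<Gamma>. w <\<^sub>l v}" using lt_le_trans by blast
  then show "level \<Gamma> u \<le> level \<Gamma> v"
    unfolding level_eq by (intro card_mono image_mono) (simp_all add: finite_verts)
next
  assume "level \<Gamma> u \<le> level \<Gamma> v"
  then show "u \<le>\<^sub>l v" using level_strict_mono[of v u] not_le_lt assms by fastforce
qed

lemma level_eq_iff:
  "u \<in> verts \<Gamma> \<Longrightarrow> v \<in> verts \<Gamma> \<Longrightarrow> level \<Gamma> u = level \<Gamma> v \<longleftrightarrow> (u, v) \<in> same_level \<Gamma>"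
  using level_le_iff[of u v] level_le_iff[of v u] by (auto simp: same_level_iff)

lemma le_terminal:
  assumes "is_terminal \<Gamma> t" "v \<in> verts \<Gamma>"
  shows "v \<le>\<^sub>l t"
proof -
  obtain u where u: "is_terminal \<Gamma> u" "(u, v) \<in> (up \<Gamma>)\<^sup>*" by (rule terminal_descendant[OF assms(2)])
  then have "v \<le>\<^sub>l u" using up_le by (simp add: is_terminal_def)
  moreover have "(u, t) \<in> same_level \<Gamma>" using terminals u assms by blast
  ultimately show ?thesis using le_trans same_level_iff by blast
qed

text \<open>The class of a terminal vertex is the greatest one, so every class but this one is
  counted.\<close>

lemma level_terminal:
  assumes "is_terminal \<Gamma> t"
  shows "level \<Gamma> t = tree_length \<Gamma>"
proof -
  let ?c = "\<lambda>w. same_level \<Gamma> `` {w}"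
  have t: "t \<in> verts \<Gamma>" using assms by (simp add: is_terminal_def)
  have "?c ` {w \<in> verts \<Gamma>. w <\<^sub>l t} = ?c ` verts \<Gamma> - {?c t}"
    using class_eq_iff[OF _ t] le_terminal[OF assms] t
    by (auto simp: same_level_iff strictly_below_def)
  moreover have "verts \<Gamma> // same_level \<Gamma> = ?c ` verts \<Gamma>" by (auto simp: quotient_def)
  ultimately show ?thesis
    unfolding level_eq tree_length_def using t finite_verts by (simp add: card_Diff_singleton)
qed

lemma is_terminal_iff_level:
  assumes "v \<in> verts \<Gamma>"
  shows "is_terminal \<Gamma> v \<longleftrightarrow> level \<Gamma> v = tree_length \<Gamma>"
proof
  assume l: "level \<Gamma> v = tree_length \<Gamma>"
  obtain u where u: "is_terminal \<Gamma> u" "(u, v) \<in> (up \<Gamma>)\<^sup>*" by (rule terminal_descendant[OF assms])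
  then have "\<not> v <\<^sub>l u" using level_strict_mono[of v u] l level_terminal[of u] by auto
  then show "is_terminal \<Gamma> v" using u up_strict by blast
qed (rule level_terminal)

lemma level_le_length: "v \<in> verts \<Gamma> \<Longrightarrow> level \<Gamma> v \<le> tree_length \<Gamma>"
  using level_terminal[OF mark_terminal] level_le_iff le_terminal[OF mark_terminal] mark_verts by metis

text \<open>Counting: \<open>level\<close> separates the classes, of which there are
  \<open>tree_length \<Gamma> + 1\<close>, and takes values in
  \<open>{..tree_length \<Gamma>}\<close>.\<close>

lemma level_surj:
  assumes "m \<le> tree_length \<Gamma>"
  obtains v where "v \<in> verts \<Gamma>" "level \<Gamma> v = m"
proof -
  let ?c = "\<lambda>w. same_level \<Gamma> `` {w}"
  define lv where "lv C = the_elem (level \<Gamma> ` C)" for C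
  have lv: "lv (?c v) = level \<Gamma> v" if v: "v \<in> verts \<Gamma>" for v
  proof -
    have "level \<Gamma> w = level \<Gamma> v" if "w \<in> ?c v" for w
      using that level_eq_iff[OF v, of w] le_verts[of v w] by (simp add: same_level_iff)
    moreover have "v \<in> ?c v" using le_refl v by (simp add: same_level_iff)
    ultimately have "level \<Gamma> ` ?c v = {level \<Gamma> v}" by blast
    then show ?thesis by (simp add: lv_def)
  qed
  have "level \<Gamma> ` verts \<Gamma> = lv ` ?c ` verts \<Gamma>" using lv by (auto simp: image_image)
  moreover have "inj_on lv (?c ` verts \<Gamma>)"
    using lv level_eq_iff class_eq_iff by (auto simp: inj_on_def)
  moreover have "verts \<Gamma> // same_level \<Gamma> = ?c ` verts \<Gamma>" by (auto simp: quotient_def)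
  ultimately have "card (level \<Gamma> ` verts \<Gamma>) = card (verts \<Gamma> // same_level \<Gamma>)"
    by (simp add: card_image)
  moreover have "card (verts \<Gamma> // same_level \<Gamma>) > 0"
    using root_vert finite_verts \<open>verts \<Gamma> // same_level \<Gamma> = ?c ` verts \<Gamma>\<close> by (auto simp: card_gt_0_iff)
  ultimately have "card (level \<Gamma> ` verts \<Gamma>) = card {..tree_length \<Gamma>}" by (simp add: tree_length_def)
  moreover have "level \<Gamma> ` verts \<Gamma> \<subseteq> {..tree_length \<Gamma>}" using level_le_length by auto
  ultimately have "level \<Gamma> ` verts \<Gamma> = {..tree_length \<Gamma>}" by (intro card_subset_eq) auto
  then show ?thesis using assms that by (metis atMost_iff imageE)
qed

lemma level_pairs:
  "\<exists>ij. \<forall>m < tree_length \<Gamma>. level \<Gamma> (meet \<Gamma> (mark \<Gamma> (fst (ij m))) (mark \<Gamma> (snd (ij m)))) = m"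
proof -
  have "\<exists>ij. level \<Gamma> (meet \<Gamma> (mark \<Gamma> (fst ij)) (mark \<Gamma> (snd ij))) = m" if m: "m < tree_length \<Gamma>" for m
  proof -
    obtain v where v: "v \<in> verts \<Gamma>" "level \<Gamma> v = m" using level_surj m by (metis less_imp_le)
    then have "\<not> is_terminal \<Gamma> v" using is_terminal_iff_level m by simp
    then obtain i j where "meet \<Gamma> (mark \<Gamma> i) (mark \<Gamma> j) = v" using nonterminal_meet v by blast
    then show ?thesis using v by (intro exI[of _ "(i, j)"]) simp
  qed
  then show ?thesis by metis
qed

end

section \<open>Contractions\<close>

locale tree_contraction = dom: level_tree \<Gamma> + cod: level_tree \<Gamma>'
  for \<Gamma> :: "('n, 'x) ltree_scheme" and \<Gamma>' :: "('n, 'y) ltree_scheme" +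
  fixes f
  assumes contr: "contraction \<Gamma> \<Gamma>' f"
begin

lemma image: "f ` verts \<Gamma> = verts \<Gamma>'"
  using contr by (simp add: contraction_def)

lemma vert: "v \<in> verts \<Gamma> \<Longrightarrow> f v \<in> verts \<Gamma>'"
  using image by blast

lemma mark_image: "f (mark \<Gamma> i) = mark \<Gamma>' i"
  using contr by (simp add: contraction_def)

lemma pre_image: "(v, w) \<in> pre \<Gamma> \<Longrightarrow> (f v, f w) \<in> pre \<Gamma>'"
  using contr unfolding contraction_def by blast

lemma adj_image: "(v, w) \<in> adj \<Gamma> \<Longrightarrow> f v = f w \<or> (f v, f w) \<in> adj \<Gamma>'"
  using contr unfolding contraction_def by blast

lemma fibre_connected:
  assumes "u \<in> verts \<Gamma>" "v \<in> verts \<Gamma>" "f u = f v"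
  defines "F \<equiv> {w \<in> verts \<Gamma>. f w = f v}"
  shows "(u, v) \<in> (adj \<Gamma> \<inter> F \<times> F)\<^sup>*"
proof -
  have "\<forall>x\<in>verts \<Gamma>'. let F = {v \<in> verts \<Gamma>. f v = x} in
      \<forall>u\<in>F. \<forall>v\<in>F. (u, v) \<in> (adj \<Gamma> \<inter> F \<times> F)\<^sup>*"
    using contr by (simp add: contraction_def)
  then show ?thesis using vert[OF assms(2)] assms(1-3) unfolding F_def Let_def by blast
qed

lemma same_level_image: "(v, w) \<in> same_level \<Gamma> \<Longrightarrow> (f v, f w) \<in> same_level \<Gamma>'"
  using pre_image by (simp add: dom.same_level_iff cod.same_level_iff)

lemma root_image: "f (vroot \<Gamma>) = vroot \<Gamma>'"
proof -
  obtain x where x: "x \<in> verts \<Gamma>" "f x = vroot \<Gamma>'" using image cod.root_vert by (metis imageE)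
  then have "(f (vroot \<Gamma>), vroot \<Gamma>') \<in> pre \<Gamma>'" using pre_image[OF dom.root_le[OF x(1)]] by simp
  then have "\<not> strictly_below \<Gamma>' (vroot \<Gamma>') (f (vroot \<Gamma>))" by (simp add: strictly_below_def)
  then show ?thesis
    using cod.up_strict[OF cod.up_root[OF vert[OF dom.root_vert]]] by blast
qed

lemma parent_image:
  assumes "(v, p) \<in> up \<Gamma>"
  shows "f p = f v \<or> (f v, f p) \<in> up \<Gamma>'"
proof (cases "f p = f v")
  case False
  then have "(f v, f p) \<in> adj \<Gamma>'" using adj_image dom.upD(6)[OF assms] by metis
  then have "(f v, f p) \<in> up \<Gamma>' \<or> (f p, f v) \<in> up \<Gamma>'" by (rule cod.adj_up)
  moreover have "(f p, f v) \<in> pre \<Gamma>'" using pre_image dom.lt_le dom.upD(5)[OF assms] by blast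
  ultimately show ?thesis using cod.upD(5)[of "f p" "f v"] by (auto simp: strictly_below_def)
qed simp

lemma up_image: "(v, w) \<in> (up \<Gamma>)\<^sup>* \<Longrightarrow> (f v, f w) \<in> (up \<Gamma>')\<^sup>*"
proof (induction rule: rtrancl_induct)
  case (step y z)
  then show ?case using parent_image[OF step(2)] by (auto intro: rtrancl_into_rtrancl)
qed simp

text \<open>Each step towards the root moves the image by at most one step, so the image of the path
  skips no vertex between \<open>f v\<close> and \<open>f w\<close>.\<close>

lemma up_lift:
  assumes "(v, w) \<in> (up \<Gamma>)\<^sup>*" "(f v, x) \<in> (up \<Gamma>')\<^sup>*" "(x, f w) \<in> (up \<Gamma>')\<^sup>*"
  shows "\<exists>y. (v, y) \<in> (up \<Gamma>)\<^sup>* \<and> (y, w) \<in> (up \<Gamma>)\<^sup>* \<and> f y = x"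
  using assms
proof (induction rule: converse_rtrancl_induct)
  case base
  then show ?case using cod.up_antisym by (intro exI[of _ w]) auto
next
  case (step v p)
  show ?case
  proof (cases "f v = x")
    case True
    then show ?thesis using step(1,2) by (intro exI[of _ v]) auto
  next
    case False
    have "(f p, x) \<in> (up \<Gamma>')\<^sup>*"
    proof (cases "f p = f v")
      case False
      then have "parent \<Gamma>' (f v) = f p" using parent_image[OF step(1)] cod.upD(4) by metis
      then show ?thesis using cod.up_cases(3)[OF step(4)] \<open>f v \<noteq> x\<close> by simp
    qed (use step(4) in simp)
    then obtain y where "(p, y) \<in> (up \<Gamma>)\<^sup>*" "(y, w) \<in> (up \<Gamma>)\<^sup>*" "f y = x"
      using step.IH step.prems(2) by blast
    then show ?thesis using step(1) by (intro exI[of _ y]) auto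
  qed
qed

text \<open>The branch at \<open>c\<close> is joined to the rest of the tree only by the edge to
  \<open>w\<close>, and \<open>w\<close> is outside the fibre. A walk within the fibre therefore
  stays in the branch.\<close>

lemma fibre_branch:
  assumes u: "u \<in> verts \<Gamma>" and v: "v \<in> verts \<Gamma>" and uv: "f u = f v"
    and c: "(u, c) \<in> (up \<Gamma>)\<^sup>*" "(c, w) \<in> up \<Gamma>" "f w \<noteq> f v"
  shows "(v, c) \<in> (up \<Gamma>)\<^sup>*"
  using fibre_connected[OF u v uv]
proof (induction rule: rtrancl_induct)
  case base
  show ?case by (rule c(1))
next
  case (step y z)
  then have yz: "(y, z) \<in> adj \<Gamma>" "f z = f v" by auto
  show ?case
  proof (cases "(y, z) \<in> up \<Gamma>")
    case True
    then have z: "z = parent \<Gamma> y" by (rule dom.upD(4))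
    have "y \<noteq> c"
    proof
      assume "y = c"
      then have "z = w" using z dom.upD(4)[OF c(2)] by simp
      then show False using yz(2) c(3) by simp
    qed
    then show ?thesis using dom.up_cases(3)[OF step(3)] z by simp
  next
    case False
    then have "(z, y) \<in> up \<Gamma>" using dom.adj_up[OF yz(1)] by blast
    then show ?thesis using step(3) by (rule converse_rtrancl_into_rtrancl)
  qed
qed

text \<open>Connectedness of the fibres is what makes contractions preserve meets.\<close>

lemma meet_image:
  assumes u: "u \<in> verts \<Gamma>" and v: "v \<in> verts \<Gamma>"
  shows "f (meet \<Gamma> u v) = meet \<Gamma>' (f u) (f v)"
proof (rule ccontr)
  let ?w = "meet \<Gamma> u v" and ?x = "meet \<Gamma>' (f u) (f v)"
  assume ne: "f ?w \<noteq> ?x"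
  note m = dom.meet[OF u v] and m' = cod.meet[OF vert[OF u] vert[OF v]]
  have xw: "(?x, f ?w) \<in> (up \<Gamma>')\<^sup>*" using m'(3) up_image m(1,2) by blast
  \<comment> \<open>Both paths to \<open>?w\<close> meet the fibre over \<open>?x\<close>, at
    \<open>u1\<close> and \<open>v1\<close>. The branch at \<open>?w\<close> that contains
    \<open>u1\<close> then contains \<open>v1\<close>, so \<open>c\<close> is a common ancestor of
    \<open>u\<close> and \<open>v\<close> that is a proper descendant of their meet.\<close>
  obtain u1 where u1: "(u, u1) \<in> (up \<Gamma>)\<^sup>*" "(u1, ?w) \<in> (up \<Gamma>)\<^sup>*" "f u1 = ?x"
    using up_lift[OF m(1) m'(1) xw] by blast
  obtain v1 where v1: "(v, v1) \<in> (up \<Gamma>)\<^sup>*" "(v1, ?w) \<in> (up \<Gamma>)\<^sup>*" "f v1 = ?x"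
    using up_lift[OF m(2) m'(2) xw] by blast
  have "u1 \<noteq> ?w" using ne u1(3) by auto
  then obtain c where c: "(u1, c) \<in> (up \<Gamma>)\<^sup>*" "(c, ?w) \<in> up \<Gamma>" using dom.branch_below[OF u1(2)] by blast
  have "(v1, c) \<in> (up \<Gamma>)\<^sup>*"
    using fibre_branch[OF dom.up_verts[OF u u1(1)] dom.up_verts[OF v v1(1)] _ c] u1(3) v1(3) ne by simp
  then have "(?w, c) \<in> (up \<Gamma>)\<^sup>*" using m(3) u1(1) v1(1) c(1) by (meson rtrancl_trans)
  then show False
    using dom.up_strict[of ?w c] dom.upD(5)[OF c(2)] by (auto simp: strictly_below_def)
qed

lemma meet_mark_image:
  "f (meet \<Gamma> (mark \<Gamma> i) (mark \<Gamma> j)) = meet \<Gamma>' (mark \<Gamma>' i) (mark \<Gamma>' j)"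
  using meet_image[OF dom.mark_verts dom.mark_verts] mark_image by simp

lemma terminal_image:
  assumes "is_terminal \<Gamma> v"
  shows "is_terminal \<Gamma>' (f v)"
proof -
  have "v \<in> verts \<Gamma>" using assms by (simp add: is_terminal_def)
  then obtain i where "v = mark \<Gamma> i" using dom.stab assms by fastforce
  then show ?thesis using mark_image cod.mark_terminal by metis
qed

text \<open>Let \<open>y\<close> be the child end. A path from a vertex over \<open>y\<close> to the
  root has to leave the fibre over \<open>y\<close>, and the edge on which it does so maps to the
  edge from \<open>y\<close> to its parent.\<close>

lemma edge_lift:
  assumes "(y, z) \<in> adj \<Gamma>'"
  shows "\<exists>u v. (u, v) \<in> adj \<Gamma> \<and> f u = y \<and> f v = z"
proof -
  have *: "\<exists>u v. (u, v) \<in> adj \<Gamma> \<and> f u = y \<and> f v = z" if yz: "(y, z) \<in> up \<Gamma>'" for y z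
  proof -
    obtain v where v: "v \<in> verts \<Gamma>" "f v = y" using image cod.upD(1)[OF yz] by (metis imageE)
    have "(v, vroot \<Gamma>) \<in> (up \<Gamma>)\<^sup>*" by (rule dom.up_root[OF v(1)])
    then have "f v = y \<longrightarrow> (\<exists>u p. (u, p) \<in> up \<Gamma> \<and> f u = y \<and> f p \<noteq> y)"
    proof (induction rule: converse_rtrancl_induct)
      case base
      then show ?case using root_image cod.upD(3)[OF yz] by simp
    next
      case (step u p)
      then show ?case by blast
    qed
    then obtain u p where up: "(u, p) \<in> up \<Gamma>" "f u = y" "f p \<noteq> y" using v by blast
    then have "(y, f p) \<in> up \<Gamma>'" using parent_image by metis
    then have "f p = z" using cod.upD(4) yz by metis
    then show ?thesis using up dom.upD(6) by blast
  qed
  show ?thesis using cod.adj_up[OF assms] *[of y z] *[of z y] dom.adj_sym by blast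
qed

text \<open>A level skipped between the images of \<open>u\<close> and \<open>v\<close> would be
  that of some \<open>f x\<close>. By monotonicity the level of \<open>x\<close> would lie strictly
  between two consecutive numbers.\<close>

lemma level_step:
  assumes u: "u \<in> verts \<Gamma>" and v: "v \<in> verts \<Gamma>" and l: "level \<Gamma> v = Suc (level \<Gamma> u)"
  shows "level \<Gamma>' (f v) = level \<Gamma>' (f u) \<or> level \<Gamma>' (f v) = Suc (level \<Gamma>' (f u))"
proof -
  have mono: "level \<Gamma>' (f x) \<le> level \<Gamma>' (f y)" if "x \<in> verts \<Gamma>" "y \<in> verts \<Gamma>" "level \<Gamma> x \<le> level \<Gamma> y" for x y
    using that pre_image dom.level_le_iff cod.level_le_iff vert by blast
  have "level \<Gamma>' (f v) \<le> Suc (level \<Gamma>' (f u))"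
  proof (rule ccontr)
    assume n: "\<not> ?thesis"
    then have "Suc (level \<Gamma>' (f u)) \<le> tree_length \<Gamma>'" using cod.level_le_length[OF vert[OF v]] by simp
    then obtain y where y: "y \<in> verts \<Gamma>'" "level \<Gamma>' y = Suc (level \<Gamma>' (f u))" by (rule cod.level_surj)
    obtain x where x: "x \<in> verts \<Gamma>" "f x = y" using image y(1) by (metis imageE)
    show False
      using mono[OF x(1) u] mono[OF v x(1)] x(2) y(2) n l by (cases "level \<Gamma> x \<le> level \<Gamma> u") auto
  qed
  moreover have "level \<Gamma>' (f u) \<le> level \<Gamma>' (f v)" using mono u v l by simp
  ultimately show ?thesis by linarith
qed

end

text \<open>The marks fix the values on terminal vertices. Since meets are preserved, they also fix
  the values on all other vertices.\<close>

lemma contraction_unique: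
  assumes "tree_contraction \<Gamma> \<Gamma>' f" "tree_contraction \<Gamma> \<Gamma>' g" "v \<in> verts \<Gamma>"
  shows "f v = g v"
proof -
  interpret f: tree_contraction \<Gamma> \<Gamma>' f by fact
  interpret g: tree_contraction \<Gamma> \<Gamma>' g by fact
  show ?thesis
  proof (cases "is_terminal \<Gamma> v")
    case True
    then have "v \<in> range (mark \<Gamma>)" using f.dom.stab assms(3) by fastforce
    then show ?thesis using f.mark_image g.mark_image by auto
  next
    case False
    then obtain i j where "meet \<Gamma> (mark \<Gamma> i) (mark \<Gamma> j) = v" using f.dom.nonterminal_meet assms(3) by blast
    then show ?thesis using f.meet_mark_image g.meet_mark_image by metis
  qed
qed

text \<open>Connectedness of the fibres is the point at issue: a path in a fibre of \<open>g\<close>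
  is lifted edge by edge, and successive lifted edges are joined inside fibres of
  \<open>f\<close>.\<close>

lemma contraction_comp:
  assumes "tree_contraction \<Gamma> \<Gamma>' f" "tree_contraction \<Gamma>' \<Gamma>'' g"
  shows "tree_contraction \<Gamma> \<Gamma>'' (g \<circ> f)"
proof -
  interpret f: tree_contraction \<Gamma> \<Gamma>' f by fact
  interpret g: tree_contraction \<Gamma>' \<Gamma>'' g by fact
  have fib: "(u, v) \<in> (adj \<Gamma> \<inter> F \<times> F)\<^sup>*"
    if F: "F = {w \<in> verts \<Gamma>. g (f w) = x}" and u: "u \<in> F" and v: "v \<in> F" for F x u v
  proof -
    let ?G = "{w \<in> verts \<Gamma>'. g w = g (f v)}"
    have sub: "(y, z) \<in> (adj \<Gamma> \<inter> F \<times> F)\<^sup>*" if "y \<in> F" "z \<in> verts \<Gamma>" "f y = f z" for y z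
    proof -
      let ?H = "{w \<in> verts \<Gamma>. f w = f z}"
      have yz: "(y, z) \<in> (adj \<Gamma> \<inter> ?H \<times> ?H)\<^sup>*"
        by (rule f.fibre_connected) (use that F in simp_all)
      have "adj \<Gamma> \<inter> ?H \<times> ?H \<subseteq> adj \<Gamma> \<inter> F \<times> F"
        by (rule Int_mono[OF subset_refl Sigma_mono]) (use that F in auto)
      then show ?thesis using subsetD[OF rtrancl_mono yz] by simp
    qed
    have "(f u, f v) \<in> (adj \<Gamma>' \<inter> ?G \<times> ?G)\<^sup>*" using g.fibre_connected[of "f u" "f v"] f.vert u v F by simp
    \<comment> \<open>The claim covers all vertices over the current endpoint, since the next lifted
      edge may start at any one of them.\<close>
    then have "\<forall>z\<in>verts \<Gamma>. f z = f v \<longrightarrow> (u, z) \<in> (adj \<Gamma> \<inter> F \<times> F)\<^sup>*"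
    proof (induction rule: rtrancl_induct)
      case base
      then show ?case using sub[OF u] by metis
    next
      case (step y z)
      then have yz: "(y, z) \<in> adj \<Gamma>'" "g y = x" "g z = x" using v F by auto
      obtain y0 z0 where yz0: "(y0, z0) \<in> adj \<Gamma>" "f y0 = y" "f z0 = z" using f.edge_lift[OF yz(1)] by blast
      then have F0: "y0 \<in> F" "z0 \<in> F" using f.dom.adj_verts[OF yz0(1)] yz F by auto
      have "(u, z0) \<in> (adj \<Gamma> \<inter> F \<times> F)\<^sup>*"
        using step(3) yz0 F0 F by (auto intro: rtrancl_into_rtrancl)
      then show ?case using rtrancl_trans[OF _ sub[OF F0(2)]] yz0(3) by simp
    qed
    then show ?thesis using v F by blast
  qed
  have adj: "(g \<circ> f) v = (g \<circ> f) w \<or> ((g \<circ> f) v, (g \<circ> f) w) \<in> adj \<Gamma>''" if "(v, w) \<in> adj \<Gamma>" for v w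
    using f.adj_image[OF that] g.adj_image by auto
  have "contraction \<Gamma> \<Gamma>'' (g \<circ> f)"
    unfolding contraction_def
  proof (intro conjI ballI allI)
    show "(g \<circ> f) ` verts \<Gamma> = verts \<Gamma>''" by (simp only: image_comp[symmetric] f.image g.image)
    show "(g \<circ> f) (mark \<Gamma> i) = mark \<Gamma>'' i" for i by (simp add: f.mark_image g.mark_image)
    show "case p of (v, w) \<Rightarrow> ((g \<circ> f) v, (g \<circ> f) w) \<in> pre \<Gamma>''" if "p \<in> pre \<Gamma>" for p
      using that f.pre_image g.pre_image by auto
    show "case p of (v, w) \<Rightarrow> (g \<circ> f) v = (g \<circ> f) w \<or> ((g \<circ> f) v, (g \<circ> f) w) \<in> adj \<Gamma>''"
      if "p \<in> adj \<Gamma>" for p using that adj by blast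
    show "let F = {v \<in> verts \<Gamma>. (g \<circ> f) v = x} in \<forall>u\<in>F. \<forall>v\<in>F. (u, v) \<in> (adj \<Gamma> \<inter> F \<times> F)\<^sup>*" for x
      unfolding Let_def using fib[OF refl, of _ x] by simp
  qed
  then show ?thesis by (simp add: tree_contraction_def tree_contraction_axioms_def
        f.dom.level_tree_axioms g.cod.level_tree_axioms)
qed

section \<open>Stable lines and their isomorphisms\<close>

lemma dual_tree_simps [simp]:
  "verts (dual_tree L) = verts L" "adj (dual_tree L) = adj L" "vroot (dual_tree L) = vroot L"
  "pre (dual_tree L) = pre L" "mark (dual_tree L) = mark L"
  by (simp_all add: dual_tree_def ltree.truncate_def)

text \<open>Serves both the passage from a line to its dual tree and translation, which leave these
  fields unchanged.\<close>

lemma dual_tree_cong: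
  fixes \<Gamma> :: "('n, 'x) ltree_scheme" and \<Gamma>' :: "('n, 'y) ltree_scheme"
  assumes "verts \<Gamma> = verts \<Gamma>'" "adj \<Gamma> = adj \<Gamma>'" "vroot \<Gamma> = vroot \<Gamma>'" "pre \<Gamma> = pre \<Gamma>'"
  shows "simple_walk \<Gamma> = simple_walk \<Gamma>'" "is_tree \<Gamma> = is_tree \<Gamma>'" "nbrs \<Gamma> = nbrs \<Gamma>'"
    "ancestor \<Gamma> = ancestor \<Gamma>'" "is_terminal \<Gamma> = is_terminal \<Gamma>'" "meet \<Gamma> = meet \<Gamma>'"
    "strictly_below \<Gamma> = strictly_below \<Gamma>'" "same_level \<Gamma> = same_level \<Gamma>'"
    "level \<Gamma> = level \<Gamma>'" "tree_length \<Gamma> = tree_length \<Gamma>'"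
proof -
  show w: "simple_walk \<Gamma> = simple_walk \<Gamma>'" by (intro ext) (simp add: simple_walk_def assms)
  show "is_tree \<Gamma> = is_tree \<Gamma>'" by (simp add: is_tree_def assms w)
  show "nbrs \<Gamma> = nbrs \<Gamma>'" by (intro ext) (simp add: nbrs_def assms)
  show a: "ancestor \<Gamma> = ancestor \<Gamma>'" by (intro ext) (simp add: ancestor_def assms w)
  show "is_terminal \<Gamma> = is_terminal \<Gamma>'" by (intro ext) (simp add: is_terminal_def assms a)
  show "meet \<Gamma> = meet \<Gamma>'" by (intro ext) (simp add: meet_def a)
  show b: "strictly_below \<Gamma> = strictly_below \<Gamma>'" by (intro ext) (simp add: strictly_below_def assms)
  show s: "same_level \<Gamma> = same_level \<Gamma>'" by (simp add: same_level_def assms)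
  show "level \<Gamma> = level \<Gamma>'" by (intro ext) (simp add: level_def assms b s)
  show "tree_length \<Gamma> = tree_length \<Gamma>'" by (simp add: tree_length_def assms s)
qed

lemmas dual_tree_eq [simp] = dual_tree_cong[OF dual_tree_simps(1-4)]

lemma level_tree_cong:
  fixes \<Gamma> :: "('n, 'x) ltree_scheme" and \<Gamma>' :: "('n, 'y) ltree_scheme"
  assumes "verts \<Gamma> = verts \<Gamma>'" "adj \<Gamma> = adj \<Gamma>'" "vroot \<Gamma> = vroot \<Gamma>'" "pre \<Gamma> = pre \<Gamma>'" "mark \<Gamma> = mark \<Gamma>'"
  shows "level_tree \<Gamma> \<longleftrightarrow> level_tree \<Gamma>'"
  unfolding level_tree_def by (simp only: dual_tree_cong[OF assms(1-4)] assms)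

lemma level_tree_stable_line:
  assumes "L \<in> stable_lines" shows "level_tree L"
  using assms
  unfolding stable_lines_def marked_multiscaled_line_def multiscaled_line_def stable_def level_tree_def
  by blast

lemma level_tree_dual_tree: "L \<in> stable_lines \<Longrightarrow> level_tree (dual_tree L)"
  using level_tree_stable_line level_tree_cong[OF dual_tree_simps] by blast

lemma contraction_dual_tree:
  "contraction (dual_tree L) \<Gamma> f \<longleftrightarrow> contraction L \<Gamma> f"
  "contraction \<Gamma> (dual_tree L) f \<longleftrightarrow> contraction \<Gamma> L f"
  by (simp_all add: contraction_def)

definition coord :: "'n mline \<Rightarrow> nat \<Rightarrow> cp1 \<Rightarrow> cp1" where
  "coord L v = (SOME \<phi>. affine_coord (form L v) (desc L v) \<phi>)"

text \<open>For \<open>v = h i \<and> h j\<close> this is the point \<open>n\<^sub>i\<close> in the definition of \<open>I\<^sub>i\<^sub>j\<close>.\<close>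

definition exit_point :: "'n mline \<Rightarrow> nat \<Rightarrow> 'n \<Rightarrow> cp1" where
  "exit_point L v i = (if mark L i = v then pt L i else node L v (next_towards L v (mark L i)))"

section \<open>Integrals on a stable line\<close>

locale stable_line =
  fixes L :: "'n::finite mline"
  assumes stable_line: "L \<in> stable_lines"
begin

sublocale level_tree L by (rule level_tree_stable_line[OF stable_line])

lemma node_inj: "v \<in> verts L \<Longrightarrow> inj_on (node L v) (nbrs L v)"
  and pinf_node: "pinf L \<notin> node L (vroot L) ` nbrs L (vroot L)"
  and double_pole: "v \<in> verts L \<Longrightarrow> only_double_pole (desc L v) (form L v)"
proof -
  have "multiscaled_line L" using stable_line by (simp add: stable_lines_def marked_multiscaled_line_def)
  note * = this[unfolded multiscaled_line_def]
  show "v \<in> verts L \<Longrightarrow> inj_on (node L v) (nbrs L v)" using * by (elim conjE) (rule bspec)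
  show "pinf L \<notin> node L (vroot L) ` nbrs L (vroot L)" using * by (elim conjE)
  show "v \<in> verts L \<Longrightarrow> only_double_pole (desc L v) (form L v)" using * by (elim conjE) (rule bspec)
qed

lemma coord:
  assumes "v \<in> verts L" shows "affine_coord (form L v) (desc L v) (coord L v)"
proof -
  obtain \<phi> where "affine_coord (form L v) (desc L v) \<phi>"
    by (rule only_double_pole_imp_affine_coord[OF double_pole[OF assms]])
  then show ?thesis unfolding coord_def by (rule someI[of "affine_coord (form L v) (desc L v)"])
qed

lemma desc_eq: "desc L v = (if v = vroot L then pinf L else node L v (parent L v))"
  by (simp add: desc_def parent_def)

lemma pt_not_desc: "pt L i \<noteq> desc L (mark L i)"
proof -
  have "pt L i \<notin> node L (mark L i) ` nbrs L (mark L i)" "\<not> (mark L i = vroot L \<and> pt L i = pinf L)"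
    using stable_line by (simp_all add: stable_lines_def marked_multiscaled_line_def)
  then show ?thesis using parent(1)[OF mark_verts, of i] by (auto simp: desc_eq nbrs_def)
qed

lemma nbrs_terminal:
  assumes "is_terminal L v"
  shows "nbrs L v = (if v = vroot L then {} else {parent L v})"
  using assms unfolding nbrs_eq is_terminal_iff by (auto simp: up_def)

text \<open>A terminal component has no node besides its descending one. Avoiding the pole is thus
  all that a translated point has to satisfy.\<close>

lemma pt_not_node:
  assumes "is_terminal L v" "p \<noteq> desc L v"
  shows "p \<notin> node L v ` nbrs L v \<and> \<not> (v = vroot L \<and> p = pinf L)"
  using assms by (auto simp: nbrs_terminal desc_eq)

lemma child_node:
  assumes "(c, w) \<in> up L"
  shows "node L w c \<noteq> desc L w"
proof (cases "w = vroot L")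
  case True
  have "c \<in> nbrs L (vroot L)" using assms True by (simp add: nbrs_eq children_def)
  then show ?thesis using True pinf_node by (metis desc_eq image_eqI)
next
  case False
  have w: "w \<in> verts L" using assms upD(2) by blast
  have "parent L w \<noteq> c"
    using parent(2)[OF w False] upD(5)[OF assms] by (auto simp: strictly_below_def)
  moreover have "c \<in> nbrs L w" "parent L w \<in> nbrs L w"
    using assms upI[OF w False] by (auto simp: nbrs_eq children_def)
  ultimately show ?thesis using node_inj[OF w] False by (auto simp: desc_eq inj_on_def)
qed

lemma exit_point_branch:
  assumes "(mark L i, c) \<in> (up L)\<^sup>*" "(c, w) \<in> up L"
  shows "exit_point L w i = node L w c"
proof -
  have "mark L i \<noteq> w"
  proof
    assume "mark L i = w"
    then have "c = w" using assms up_antisym[of c w] by auto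
    then show False using upD(5)[OF assms(2)] by (simp add: strictly_below_def)
  qed
  then show ?thesis
    using the_next_vertex[OF mark_verts assms] by (simp add: exit_point_def next_towards_def)
qed

lemma exit_point_not_desc:
  assumes "(mark L i, w) \<in> (up L)\<^sup>*"
  shows "exit_point L w i \<noteq> desc L w"
proof (cases "mark L i = w")
  case True
  then show ?thesis using pt_not_desc by (auto simp: exit_point_def)
next
  case False
  then obtain c where "(mark L i, c) \<in> (up L)\<^sup>*" "(c, w) \<in> up L" using branch_below assms by blast
  then show ?thesis using exit_point_branch child_node by simp
qed

text \<open>Marked vertices are terminal, so neither of two distinct ones is their meet. Hence the
  case distinction of \<open>exit_point\<close>, made for a single mark, agrees with that of
  \<open>II\<close>, made for the pair.\<close>

lemma II_exit_points:
  fixes i j defines "v \<equiv> meet L (mark L i) (mark L j)"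
  shows "II L i j = form_integral (form L v) (desc L v) (exit_point L v i) (exit_point L v j)"
proof (cases "mark L i = mark L j")
  case True
  then have "v = mark L i" using meet_same[OF mark_verts] by (simp add: v_def)
  then show ?thesis using True unfolding II_def Let_def v_def[symmetric] by (simp add: exit_point_def)
next
  case False
  have "mark L i \<noteq> v \<and> mark L j \<noteq> v"
    using False mark_terminal mark_eq_iff_meet_terminal unfolding v_def by metis
  then show ?thesis using False unfolding II_def Let_def v_def[symmetric] by (simp add: exit_point_def)
qed

lemma II_coord:
  fixes i j defines "v \<equiv> meet L (mark L i) (mark L j)"
  shows "II L i j = aff (coord L v (exit_point L v j)) - aff (coord L v (exit_point L v i))"
proof -
  note m = meet[OF mark_verts[of i] mark_verts[of j], folded v_def]
  show ?thesis
    unfolding II_exit_points[of i j, folded v_def]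
    by (rule form_integral_affine_coord[OF coord[OF m(4)] exit_point_not_desc[OF m(1)]
          exit_point_not_desc[OF m(2)]])
qed

lemma II_swap: "II L j i = - II L i j"
  unfolding II_coord[of i j] II_coord[of j i] meet_commute[OF mark_verts[of j] mark_verts[of i]] by simp

lemma II_same: "II L i i = 0"
  by (simp add: II_coord)

lemma PPi_eq: "PPi L i j = (if mark L i = mark L j then Aff (II L i j) else Inf1)"
  using meet_same[OF mark_verts]
  by (cases "mark L i = mark L j") (simp_all add: PPi_def exit_point_def II_exit_points)

text \<open>Distinct terminal components are reached from their meet through distinct children,
  hence through distinct nodes, and the coordinate is injective away from the pole.\<close>

lemma II_nonzero:
  assumes "mark L i \<noteq> mark L j"
  shows "II L i j \<noteq> 0"
proof
  define v where "v = meet L (mark L i) (mark L j)"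
  note m = meet[OF mark_verts[of i] mark_verts[of j], folded v_def]
  have ne: "mark L i \<noteq> v" "mark L j \<noteq> v"
    using assms mark_terminal mark_eq_iff_meet_terminal[of i j] unfolding v_def by metis+
  obtain c where c: "(mark L i, c) \<in> (up L)\<^sup>*" "(c, v) \<in> up L" by (rule branch_below[OF m(1) ne(1)])
  obtain c' where c': "(mark L j, c') \<in> (up L)\<^sup>*" "(c', v) \<in> up L" by (rule branch_below[OF m(2) ne(2)])
  have "c \<noteq> c'"
  proof
    assume "c = c'"
    then have "(v, c) \<in> (up L)\<^sup>*" using m(3) c(1) c'(1) by blast
    then show False using up_strict[of v c] upD(5)[OF c(2)] by (auto simp: strictly_below_def)
  qed
  moreover have "c \<in> nbrs L v" "c' \<in> nbrs L v" using c c' by (auto simp: nbrs_eq children_def)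
  ultimately have n: "node L v c \<noteq> node L v c'" using node_inj[OF m(4)] by (auto simp: inj_on_def)
  assume "II L i j = 0"
  then have "aff (coord L v (node L v c')) = aff (coord L v (node L v c))"
    using II_coord[of i j, folded v_def] exit_point_branch[OF c] exit_point_branch[OF c'] by simp
  then show False
    using affine_coord_inj[OF coord[OF m(4)] child_node[OF c'(2)] child_node[OF c(2)]] n by simp
qed

end

section \<open>Lines with translated marked points\<close>

lemma translate_line_simps [simp]:
  "verts (translate_line a L) = verts L" "adj (translate_line a L) = adj L"
  "vroot (translate_line a L) = vroot L" "pre (translate_line a L) = pre L"
  "mark (translate_line a L) = mark L" "node (translate_line a L) = node L"
  "pinf (translate_line a L) = pinf L" "form (translate_line a L) = form L"
  "pt (translate_line a L) i = translate_point (form L (mark L i)) (desc L (mark L i)) (vec_nth a i) (pt L i)"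
  by (simp_all add: translate_line_def)

lemmas translate_line_eq [simp] = dual_tree_cong[OF translate_line_simps(1-4)]

lemma desc_translate_line [simp]: "desc (translate_line a L) = desc L"
  by (intro ext) (simp add: desc_def)

lemma coord_translate_line [simp]: "coord (translate_line a L) = coord L"
  by (intro ext) (simp add: coord_def)

context stable_line begin

lemma coord_translate_point:
  "coord L (mark L i) (pt (translate_line a L) i) = Aff (aff (coord L (mark L i) (pt L i)) + vec_nth a i)"
  "pt (translate_line a L) i \<noteq> desc L (mark L i)"
  using translate_point_affine_coord[OF coord[OF mark_verts] pt_not_desc] by simp_all

lemma translate_line_stable: "translate_line a L \<in> stable_lines"
proof -
  have "pt (translate_line a L) i \<notin> node L (mark L i) ` nbrs L (mark L i) \<and>
      \<not> (mark L i = vroot L \<and> pt (translate_line a L) i = pinf L)" for i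
    by (rule pt_not_node[OF mark_terminal coord_translate_point(2)])
  then show ?thesis
    using stable_line
    by (auto simp: stable_lines_def marked_multiscaled_line_def multiscaled_line_def stable_def
        simp del: translate_line_simps(9))
qed

text \<open>If the marks differ, the integral runs between two nodes, which do not move. Otherwise
  both ends are shifted in the same coordinate.\<close>

lemma II_translate_line:
  "II (translate_line a L) i j = II L i j + (if mark L i = mark L j then vec_nth a j - vec_nth a i else 0)"
proof -
  interpret t: stable_line "translate_line a L" by (unfold_locales) (rule translate_line_stable)
  have nt: "next_towards (translate_line a L) = next_towards L"
    by (intro ext) (simp add: next_towards_def)
  show ?thesis
  proof (cases "mark L i = mark L j")
    case True
    then have "meet L (mark L i) (mark L j) = mark L i" using meet_same[OF mark_verts] by simp
    then show ?thesis
      using True coord_translate_point(1)[of i a] coord_translate_point(1)[of j a]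
      unfolding II_coord t.II_coord by (simp add: exit_point_def del: translate_line_simps(9))
  next
    case False
    have "mark L i \<noteq> meet L (mark L i) (mark L j)" "mark L j \<noteq> meet L (mark L i) (mark L j)"
      using False mark_terminal mark_eq_iff_meet_terminal by metis+
    then show ?thesis using False unfolding II_coord t.II_coord by (simp add: exit_point_def nt)
  qed
qed

end

section \<open>Complex projective isomorphisms\<close>

lemma pullback_id:
  assumes "affine_coord f d \<phi>" shows "pullback_form id f = f"
proof -
  have "is_moebius \<phi>" "f = pullback_form \<phi> (\<lambda>_. 1)" using assms by (simp_all add: affine_coord_def)
  then show ?thesis using pullback_pullback_dz[OF _ is_moebius_id] by simp
qed

text \<open>The assumption is the body of \<open>proj_iso\<close> with its witnesses named, so that
  composites and inverses can be described by theirs.\<close>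

locale line_iso = dom: stable_line L + cod: stable_line L' for L L' :: "'n::finite mline" +
  fixes \<sigma> :: "nat \<Rightarrow> nat" and \<phi> :: "nat \<Rightarrow> cp1 \<Rightarrow> cp1" and c :: "nat \<Rightarrow> complex"
  assumes iso: "bij_betw \<sigma> (verts L) (verts L') \<and>
     (\<forall>v\<in>verts L. is_moebius (\<phi> v)) \<and>
     (\<forall>u\<in>verts L. \<forall>v\<in>verts L. (u, v) \<in> adj L \<longleftrightarrow> (\<sigma> u, \<sigma> v) \<in> adj L') \<and>
     (\<forall>(u, v)\<in>adj L. \<phi> u (node L u v) = node L' (\<sigma> u) (\<sigma> v)) \<and>
     \<sigma> (vroot L) = vroot L' \<and> \<phi> (vroot L) (pinf L) = pinf L' \<and>
     (\<forall>u\<in>verts L. \<forall>v\<in>verts L. (u, v) \<in> pre L \<longleftrightarrow> (\<sigma> u, \<sigma> v) \<in> pre L') \<and>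
     (\<forall>i. \<sigma> (mark L i) = mark L' i \<and> \<phi> (mark L i) (pt L i) = pt L' i) \<and>
     (\<forall>v\<in>verts L. c v \<noteq> 0 \<and> pullback_form (\<phi> v) (form L' (\<sigma> v)) = (\<lambda>z. c v * form L v z)) \<and>
     (\<forall>(u, v)\<in>same_level L. c u = c v) \<and>
     (\<forall>v. is_terminal L v \<longrightarrow> c v = 1)"

lemma iso_rel_iff: "(L, L') \<in> iso_rel \<longleftrightarrow> (\<exists>\<sigma> \<phi> c. line_iso L L' \<sigma> \<phi> c)"
proof
  assume "(L, L') \<in> iso_rel"
  then have st: "stable_line L" "stable_line L'" and "proj_iso L L'"
    by (simp_all add: iso_rel_def stable_line_def)
  from this(3) show "\<exists>\<sigma> \<phi> c. line_iso L L' \<sigma> \<phi> c"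
    unfolding proj_iso_def line_iso_def line_iso_axioms_def
    by (simp only: st simp_thms)
next
  assume "\<exists>\<sigma> \<phi> c. line_iso L L' \<sigma> \<phi> c"
  then obtain \<sigma> \<phi> c where i: "line_iso L L' \<sigma> \<phi> c" by blast
  then interpret line_iso L L' \<sigma> \<phi> c .
  have "proj_iso L L'" unfolding proj_iso_def by (rule exI, rule exI, rule exI, rule iso)
  then show "(L, L') \<in> iso_rel"
    using dom.stable_line cod.stable_line by (simp add: iso_rel_def)
qed

context line_iso begin

lemma bij: "bij_betw \<sigma> (verts L) (verts L')"
  and moebius: "v \<in> verts L \<Longrightarrow> is_moebius (\<phi> v)"
  and adj_iff: "u \<in> verts L \<Longrightarrow> v \<in> verts L \<Longrightarrow> (u, v) \<in> adj L \<longleftrightarrow> (\<sigma> u, \<sigma> v) \<in> adj L'"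
  and node_map: "(u, v) \<in> adj L \<Longrightarrow> \<phi> u (node L u v) = node L' (\<sigma> u) (\<sigma> v)"
  and root_map: "\<sigma> (vroot L) = vroot L'"
  and pinf_map: "\<phi> (vroot L) (pinf L) = pinf L'"
  and pre_iff: "u \<in> verts L \<Longrightarrow> v \<in> verts L \<Longrightarrow> (u, v) \<in> pre L \<longleftrightarrow> (\<sigma> u, \<sigma> v) \<in> pre L'"
  and mark_map: "\<sigma> (mark L i) = mark L' i"
  and pt_map: "\<phi> (mark L i) (pt L i) = pt L' i"
  and scale_nz: "v \<in> verts L \<Longrightarrow> c v \<noteq> 0"
  and form_map: "v \<in> verts L \<Longrightarrow> pullback_form (\<phi> v) (form L' (\<sigma> v)) = (\<lambda>z. c v * form L v z)"
  and scale_level: "(u, v) \<in> same_level L \<Longrightarrow> c u = c v"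
  and scale_terminal: "is_terminal L v \<Longrightarrow> c v = 1"
  using iso by auto

lemma inj: "u \<in> verts L \<Longrightarrow> v \<in> verts L \<Longrightarrow> \<sigma> u = \<sigma> v \<longleftrightarrow> u = v"
  using bij by (auto simp: bij_betw_def inj_on_def)

text \<open>The fibres are single points. Seen as a contraction, an isomorphism inherits the facts
  on meets, levels and paths.\<close>

lemma contraction_iso: "contraction L L' \<sigma>"
proof -
  have "\<forall>x\<in>verts L'. let F = {v \<in> verts L. \<sigma> v = x} in \<forall>u\<in>F. \<forall>v\<in>F. (u, v) \<in> (adj L \<inter> F \<times> F)\<^sup>*"
    unfolding Let_def using inj by auto
  moreover have "(\<sigma> v, \<sigma> w) \<in> pre L'" if "(v, w) \<in> pre L" for v w
    using that pre_iff dom.le_verts by blast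
  moreover have "(\<sigma> v, \<sigma> w) \<in> adj L'" if "(v, w) \<in> adj L" for v w
    using that adj_iff dom.adj_verts by blast
  moreover have "\<sigma> ` verts L = verts L'" using bij by (simp add: bij_betw_def)
  ultimately show ?thesis unfolding contraction_def using mark_map by auto
qed

sublocale tree_contraction L L' \<sigma>
  by unfold_locales (rule contraction_iso)

lemma up_map:
  assumes "(u, v) \<in> up L" shows "(\<sigma> u, \<sigma> v) \<in> up L'"
proof -
  have "u \<noteq> v" using dom.upD(5)[OF assms] by (auto simp: strictly_below_def)
  then have "\<sigma> v \<noteq> \<sigma> u" using inj[OF dom.upD(1,2)[OF assms]] by simp
  then show ?thesis using parent_image[OF assms] by blast
qed

lemma desc_map: "v \<in> verts L \<Longrightarrow> \<phi> v (desc L v) = desc L' (\<sigma> v)"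
proof (cases "v = vroot L")
  case True
  then show ?thesis using pinf_map root_map by (simp add: dom.desc_eq cod.desc_eq)
next
  case False
  assume v: "v \<in> verts L"
  have "\<sigma> v \<noteq> vroot L'" using False inj[OF v dom.root_vert] root_map by simp
  moreover have "\<sigma> (parent L v) = parent L' (\<sigma> v)" using cod.upD(4) up_map dom.upI[OF v False] by blast
  ultimately show ?thesis
    using False node_map[OF dom.parent(1)[OF v False]] by (simp add: dom.desc_eq cod.desc_eq)
qed

lemma exit_point_map:
  assumes "(mark L i, w) \<in> (up L)\<^sup>*"
  shows "\<phi> w (exit_point L w i) = exit_point L' (\<sigma> w) i"
proof (cases "mark L i = w")
  case True
  then show ?thesis using mark_map pt_map by (auto simp: exit_point_def)
next
  case False
  then obtain d where d: "(mark L i, d) \<in> (up L)\<^sup>*" "(d, w) \<in> up L" using dom.branch_below assms by blast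
  have "(mark L' i, \<sigma> d) \<in> (up L')\<^sup>*" using up_image[OF d(1)] mark_map by simp
  then have "exit_point L' (\<sigma> w) i = node L' (\<sigma> w) (\<sigma> d)"
    using cod.exit_point_branch up_map[OF d(2)] by blast
  moreover have "exit_point L w i = node L w d" using dom.exit_point_branch d by blast
  ultimately show ?thesis using node_map dom.adj_sym[OF dom.upD(6)[OF d(2)]] by simp
qed

text \<open>In the chosen coordinates \<open>\<phi> v\<close> is affine with slope
  \<open>c v\<close>, because it pulls the form back to \<open>c v\<close> times the form.\<close>

lemma coord_map:
  assumes v: "v \<in> verts L" and pq: "p \<noteq> desc L v" "q \<noteq> desc L v"
  shows "aff (coord L' (\<sigma> v) (\<phi> v q)) - aff (coord L' (\<sigma> v) (\<phi> v p)) =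
    c v * (aff (coord L v q) - aff (coord L v p))"
proof -
  have "affine_coord (form L' (\<sigma> v)) (\<phi> v (desc L v)) (coord L' (\<sigma> v))"
    using cod.coord[OF vert[OF v]] desc_map[OF v] by simp
  then obtain b where b: "coord L' (\<sigma> v) \<circ> \<phi> v = moebius (c v) b 0 1 \<circ> coord L v"
    by (rule affine_coord_pullback[OF dom.coord[OF v] _ moebius[OF v] form_map[OF v] scale_nz[OF v]])
  have "coord L' (\<sigma> v) (\<phi> v x) = Aff (c v * aff (coord L v x) + b)" if x: "x \<noteq> desc L v" for x
  proof -
    obtain z where "coord L v x = Aff z" using affine_coord_Aff[OF dom.coord[OF v] x] by blast
    then show ?thesis using fun_cong[OF b, of x] by simp
  qed
  then show ?thesis using pq by (simp add: algebra_simps)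
qed

lemma II_map: "II L' i j = c (meet L (mark L i) (mark L j)) * II L i j"
proof -
  define v where "v = meet L (mark L i) (mark L j)"
  note m = dom.meet[OF dom.mark_verts[of i] dom.mark_verts[of j], folded v_def]
  have \<sigma>v: "meet L' (mark L' i) (mark L' j) = \<sigma> v"
    using meet_mark_image[of i j] by (simp add: v_def)
  show ?thesis
    unfolding dom.II_coord[of i j] cod.II_coord[of i j] \<sigma>v v_def[symmetric]
    using coord_map[OF m(4) dom.exit_point_not_desc[OF m(1)] dom.exit_point_not_desc[OF m(2)]]
    by (simp add: exit_point_map m)
qed

lemma mark_eq_iff: "mark L' i = mark L' j \<longleftrightarrow> mark L i = mark L j"
  using inj[OF dom.mark_verts dom.mark_verts] mark_map by metis

lemma PPi_map: "PPi L' i j = PPi L i j"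
  using II_map[of i j] scale_terminal[of "meet L (mark L i) (mark L j)"]
    dom.mark_eq_iff_meet_terminal[of i j]
  by (simp add: dom.PPi_eq cod.PPi_eq mark_eq_iff)

text \<open>On the components that carry marked points the slope is \<open>1\<close>, so
  \<open>\<phi>\<close> commutes with adding the components of \<open>a\<close>.\<close>

lemma translate: "line_iso (translate_line a L) (translate_line a L') \<sigma> \<phi> c"
proof -
  have "\<phi> (mark L i) (pt (translate_line a L) i) = pt (translate_line a L') i" for i
  proof -
    let ?v = "mark L i" and ?p = "pt (translate_line a L) i"
    note v = dom.mark_verts[of i]
    have v': "\<sigma> ?v = mark L' i" by (rule mark_map)
    have "\<phi> ?v ?p \<noteq> desc L' (\<sigma> ?v)"
      using dom.coord_translate_point(2)[of a i] desc_map[OF v]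
        inj_eq[OF bij_is_inj[OF is_moebius_bij[OF moebius[OF v]]], of ?p "desc L ?v"] by simp
    moreover have "aff (coord L' (mark L' i) (\<phi> ?v ?p)) = aff (coord L' (mark L' i) (pt L' i)) + vec_nth a i"
    proof -
      have "aff (coord L' (\<sigma> ?v) (\<phi> ?v ?p)) - aff (coord L' (\<sigma> ?v) (\<phi> ?v (pt L i))) =
          c ?v * (aff (coord L ?v ?p) - aff (coord L ?v (pt L i)))"
        by (rule coord_map[OF v dom.pt_not_desc dom.coord_translate_point(2)])
      also have "\<dots> = vec_nth a i"
        unfolding dom.coord_translate_point(1) using scale_terminal[OF dom.mark_terminal] by simp
      finally show ?thesis unfolding v' pt_map by (simp only: diff_eq_eq add.commute)
    qed
    ultimately show ?thesis
      using translate_point_eqI[OF cod.coord[OF cod.mark_verts] cod.pt_not_desc] v'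
      by (simp del: translate_line_simps(9) add: translate_line_simps(9)[of a L'])
  qed
  then show ?thesis
    using iso unfolding line_iso_def line_iso_axioms_def stable_line_def
    by (simp add: dom.translate_line_stable cod.translate_line_stable del: translate_line_simps(9))
qed

lemma comp:
  assumes "line_iso L' L'' \<sigma>' \<phi>' c'"
  shows "line_iso L L'' (\<sigma>' \<circ> \<sigma>) (\<lambda>v. \<phi>' (\<sigma> v) \<circ> \<phi> v) (\<lambda>v. c v * c' (\<sigma> v))"
proof -
  interpret n: line_iso L' L'' \<sigma>' \<phi>' c' by fact
  have "pullback_form (\<phi>' (\<sigma> v) \<circ> \<phi> v) (form L'' ((\<sigma>' \<circ> \<sigma>) v)) = (\<lambda>z. c v * c' (\<sigma> v) * form L v z)"
    if v: "v \<in> verts L" for v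
    using pullback_comp[OF n.cod.coord[OF n.vert[OF vert[OF v]]] n.moebius[OF vert[OF v]] moebius[OF v]]
      pullback_scale[OF cod.coord[OF vert[OF v]] moebius[OF v] n.scale_nz[OF vert[OF v]]]
    by (simp add: n.form_map[OF vert[OF v]] form_map[OF v] mult.assoc mult.left_commute)
  moreover have "bij_betw (\<sigma>' \<circ> \<sigma>) (verts L) (verts L'')" by (rule bij_betw_trans[OF bij n.bij])
  moreover have "\<phi>' (\<sigma> u) (\<phi> u (node L u v)) = node L'' (\<sigma>' (\<sigma> u)) (\<sigma>' (\<sigma> v))" if "(u, v) \<in> adj L" for u v
    using node_map[OF that] n.node_map[of "\<sigma> u" "\<sigma> v"] adj_iff[of u v] dom.adj_verts[OF that] that by simp
  moreover have "c u * c' (\<sigma> u) = c v * c' (\<sigma> v)" if "(u, v) \<in> same_level L" for u v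
    using scale_level[OF that] n.scale_level[OF same_level_image[OF that]] by simp
  moreover have "\<phi>' (\<sigma> (vroot L)) (\<phi> (vroot L) (pinf L)) = pinf L''"
    using pinf_map n.pinf_map root_map by simp
  moreover have "\<phi>' (\<sigma> (mark L i)) (\<phi> (mark L i) (pt L i)) = pt L'' i" for i
    using pt_map n.pt_map mark_map by simp
  ultimately show ?thesis
    unfolding line_iso_def line_iso_axioms_def
    by (auto simp: dom.stable_line_axioms n.cod.stable_line_axioms is_moebius_comp moebius n.moebius vert
        adj_iff n.adj_iff root_map n.root_map pre_iff n.pre_iff mark_map n.mark_map scale_nz n.scale_nz
        scale_terminal n.scale_terminal terminal_image)
qed

lemma inverse:
  "line_iso L' L (inv_into (verts L) \<sigma>) (\<lambda>v. inv_into UNIV (\<phi> (inv_into (verts L) \<sigma> v)))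
    (\<lambda>v. 1 / c (inv_into (verts L) \<sigma> v))"
proof -
  define \<tau> where "\<tau> = inv_into (verts L) \<sigma>"
  have \<tau>\<sigma>: "\<tau> (\<sigma> v) = v" if "v \<in> verts L" for v
    unfolding \<tau>_def by (rule bij_betw_inv_into_left[OF bij that])
  have \<sigma>\<tau>: "\<sigma> (\<tau> v) = v" if "v \<in> verts L'" for v
    unfolding \<tau>_def by (rule bij_betw_inv_into_right[OF bij that])
  have bij': "bij_betw \<tau> (verts L') (verts L)" unfolding \<tau>_def by (rule bij_betw_inv_into[OF bij])
  then have \<tau>v: "\<tau> v \<in> verts L" if "v \<in> verts L'" for v using that by (auto simp: bij_betw_def)
  have inv\<phi>: "is_moebius (inv_into UNIV (\<phi> v)) \<and> inv_into UNIV (\<phi> v) (\<phi> v p) = p" "\<phi> v \<circ> inv_into UNIV (\<phi> v) = id"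
    if v: "v \<in> verts L" for v p
  proof -
    obtain \<psi> where \<psi>: "is_moebius \<psi>" "\<phi> v \<circ> \<psi> = id" "\<psi> \<circ> \<phi> v = id"
      by (rule is_moebius_inverse[OF moebius[OF v]])
    then have e: "inv_into UNIV (\<phi> v) = \<psi>" by (intro inv_unique_comp)
    then show "is_moebius (inv_into UNIV (\<phi> v)) \<and> inv_into UNIV (\<phi> v) (\<phi> v p) = p" "\<phi> v \<circ> inv_into UNIV (\<phi> v) = id"
      unfolding e using \<psi>(1,2) pointfree_idE[OF \<psi>(3)] by simp_all
  qed
  have "pullback_form (inv_into UNIV (\<phi> (\<tau> v))) (form L (\<tau> v)) = (\<lambda>z. 1 / c (\<tau> v) * form L' v z)"
    if v: "v \<in> verts L'" for v
  proof -
    note t = \<tau>v[OF v]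
    note m = conjunct1[OF inv\<phi>(1)[OF t]]
    have f: "affine_coord (form L' v) (desc L' v) (coord L' v)" by (rule cod.coord[OF v])
    note id = pullback_id[OF f]
    \<comment> \<open>The relation between the two forms is pulled back along the inverse of
      \<open>\<phi> (\<tau> v)\<close>.\<close>
    have "(\<lambda>z. c (\<tau> v) * pullback_form (inv_into UNIV (\<phi> (\<tau> v))) (form L (\<tau> v)) z) =
        pullback_form (inv_into UNIV (\<phi> (\<tau> v))) (pullback_form (\<phi> (\<tau> v)) (form L' v))"
      using form_map[OF t] \<sigma>\<tau>[OF v] pullback_scale[OF dom.coord[OF t] m scale_nz[OF t]] by simp
    also have "\<dots> = form L' v"
      using pullback_comp[OF f moebius[OF t] m] id by (simp add: inv\<phi>(2)[OF t])
    finally have "c (\<tau> v) * pullback_form (inv_into UNIV (\<phi> (\<tau> v))) (form L (\<tau> v)) z = form L' v z" for z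
      by (rule fun_cong)
    then show ?thesis using scale_nz[OF t] by (auto simp: field_simps)
  qed
  moreover have "inv_into UNIV (\<phi> (\<tau> u)) (node L' u v) = node L (\<tau> u) (\<tau> v)" if uv: "(u, v) \<in> adj L'" for u v
  proof -
    have v: "u \<in> verts L'" "v \<in> verts L'" using cod.adj_verts[OF uv] by auto
    then have "(\<tau> u, \<tau> v) \<in> adj L" using uv adj_iff[OF \<tau>v \<tau>v] \<sigma>\<tau> by simp
    then show ?thesis using node_map[of "\<tau> u" "\<tau> v"] inv\<phi>(1)[OF \<tau>v[OF v(1)]] \<sigma>\<tau> v by metis
  qed
  moreover have "inv_into UNIV (\<phi> (\<tau> (vroot L'))) (pinf L') = pinf L"
    using inv\<phi>(1)[OF dom.root_vert] pinf_map root_map \<tau>\<sigma>[OF dom.root_vert] by metis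
  moreover have m: "\<tau> (mark L' i) = mark L i" for i using \<tau>\<sigma>[OF dom.mark_verts] mark_map by metis
  moreover have "inv_into UNIV (\<phi> (mark L i)) (pt L' i) = pt L i" for i
    using inv\<phi>(1)[OF dom.mark_verts] pt_map by metis
  moreover have "c (\<tau> u) = c (\<tau> v)" if "(u, v) \<in> same_level L'" for u v
    using that cod.le_verts[of u v] pre_iff[of "\<tau> u" "\<tau> v"] pre_iff[of "\<tau> v" "\<tau> u"] \<tau>v \<sigma>\<tau>
    by (intro scale_level) (simp add: cod.same_level_iff dom.same_level_iff)
  moreover have "c (\<tau> v) = 1" if "is_terminal L' v" for v
  proof -
    have "v \<in> range (mark L')" using cod.stab that by (fastforce simp: is_terminal_def)
    then show ?thesis using m scale_terminal[OF dom.mark_terminal] by auto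
  qed
  ultimately show ?thesis
    unfolding line_iso_def line_iso_axioms_def \<tau>_def[symmetric]
    using bij' \<tau>\<sigma>[OF dom.root_vert] root_map
    by (auto simp: dom.stable_line_axioms cod.stable_line_axioms inv\<phi>(1) \<tau>v \<sigma>\<tau> adj_iff pre_iff scale_nz)
qed

end

lemma equiv_iso_rel: "equiv stable_lines (iso_rel :: ('n::finite mline \<times> 'n mline) set)"
proof (rule equivI)
  show "iso_rel \<subseteq> stable_lines \<times> (stable_lines :: 'n mline set)" by (auto simp: iso_rel_def)
  show "refl_on stable_lines (iso_rel :: ('n mline \<times> 'n mline) set)"
  proof (rule refl_onI)
    fix L :: "'n mline" assume L: "L \<in> stable_lines"
    then interpret stable_line L by (rule stable_line.intro)
    have "pullback_form id (form L v) = form L v" if "v \<in> verts L" for v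
      by (rule pullback_id[OF coord[OF that]])
    then have "line_iso L L id (\<lambda>_. id) (\<lambda>_. 1)"
      unfolding line_iso_def line_iso_axioms_def using stable_line_axioms is_moebius_id by auto
    then show "(L, L) \<in> iso_rel" using iso_rel_iff by blast
  qed
  show "sym (iso_rel :: ('n mline \<times> 'n mline) set)"
    by (rule symI) (use iso_rel_iff line_iso.inverse in blast)
  show "trans (iso_rel :: ('n mline \<times> 'n mline) set)"
  proof (rule transI)
    fix L L' L'' :: "'n mline"
    assume "(L, L') \<in> iso_rel" "(L', L'') \<in> iso_rel"
    then obtain \<sigma> \<phi> c \<sigma>' \<phi>' c' where "line_iso L L' \<sigma> \<phi> c" "line_iso L' L'' \<sigma>' \<phi>' c'"
      unfolding iso_rel_iff by blast
    then show "(L, L'') \<in> iso_rel" unfolding iso_rel_iff by (intro exI, rule line_iso.comp)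
  qed
qed

section \<open>Translating the marked points\<close>

context stable_line begin

lemma translate_line_0: "translate_line 0 L = L"
proof -
  have "pt (translate_line 0 L) i = pt L i" for i
    unfolding translate_line_simps(9)
    by (rule translate_point_eqI[OF coord[OF mark_verts] pt_not_desc pt_not_desc]) simp
  then have "pt (translate_line 0 L) = pt L" ..
  then show ?thesis by (simp add: translate_line_def)
qed

lemma translate_line_add: "translate_line a (translate_line b L) = translate_line (a + b) L"
proof -
  have "pt (translate_line a (translate_line b L)) i = pt (translate_line (a + b) L) i" for i
  proof -
    interpret t: stable_line "translate_line b L" by unfold_locales (rule translate_line_stable)
    show ?thesis
      unfolding translate_line_simps(9)[of "a + b"]
      using t.coord_translate_point(1)[of i a] t.coord_translate_point(2)[of a i]
        coord_translate_point(1)[of i b]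
      by (intro translate_point_eqI[OF coord[OF mark_verts] pt_not_desc, symmetric])
        (simp_all del: translate_line_simps(9))
  qed
  then have "pt (translate_line a (translate_line b L)) = pt (translate_line (a + b) L)" ..
  then show ?thesis by (simp add: translate_line_def)
qed

text \<open>A simultaneous translation is induced by the translations of the terminal components, which
  fix all nodes and the point at infinity.\<close>

lemma translate_diagonal_iso: "(L, translate_line (\<chi> i. k) L) \<in> iso_rel"
proof -
  let ?T = "moebius 1 k 0 1"
  define \<theta> where "\<theta> v = inv_into UNIV (coord L v) \<circ> (?T \<circ> coord L v)" for v
  define \<phi> where "\<phi> v = (if is_terminal L v then \<theta> v else id)" for v
  have bij: "bij (coord L v)" if "v \<in> verts L" for v
    using coord[OF that] is_moebius_bij by (simp add: affine_coord_def)
  have c\<theta>: "coord L v \<circ> \<theta> v = ?T \<circ> coord L v" if "v \<in> verts L" for v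
    using bij[OF that] by (simp add: \<theta>_def fun_eq_iff bij_is_surj surj_f_inv_f)
  have m\<theta>: "is_moebius (\<theta> v)" if v: "v \<in> verts L" for v
  proof -
    have m: "is_moebius (coord L v)" using coord[OF v] by (simp add: affine_coord_def)
    then obtain \<psi> where "is_moebius \<psi>" "coord L v \<circ> \<psi> = id" "\<psi> \<circ> coord L v = id"
      by (rule is_moebius_inverse)
    then have "is_moebius (inv_into UNIV (coord L v))" by (metis inv_unique_comp)
    then show ?thesis unfolding \<theta>_def using m is_moebius_affine[of 1 k] by (simp add: is_moebius_comp)
  qed
  have form\<theta>: "pullback_form (\<theta> v) (form L v) = form L v" if v: "v \<in> verts L" for v
  proof -
    have m: "is_moebius (coord L v)" "form L v = pullback_form (coord L v) (\<lambda>_. 1)"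
      using coord[OF v] by (simp_all add: affine_coord_def)
    have "pullback_form (\<theta> v) (pullback_form (coord L v) (\<lambda>_. 1)) =
        (\<lambda>z. 1 * pullback_form (coord L v) (\<lambda>_. 1) z)"
      unfolding pullback_pullback_dz[OF m(1) m\<theta>[OF v]] c\<theta>[OF v]
      by (rule pullback_affine_comp_dz[OF m(1)]) simp
    then show ?thesis using m(2) by simp
  qed
  have desc\<theta>: "\<theta> v (desc L v) = desc L v" if v: "v \<in> verts L" for v
    using fun_cong[OF c\<theta>[OF v], of "desc L v"] affine_coord_finite[OF coord[OF v], of "desc L v"]
      affine_coord_finite[OF coord[OF v], of "\<theta> v (desc L v)"] by simp
  have "\<phi> v (node L v w) = node L v w" if vw: "(v, w) \<in> adj L" for v w
  proof (cases "is_terminal L v")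
    case True
    have "w \<in> nbrs L v" using vw by (simp add: nbrs_def)
    then have "node L v w = desc L v" using nbrs_terminal[OF True] by (auto simp: desc_eq split: if_splits)
    then show ?thesis using desc\<theta> adj_verts[OF vw] by (simp add: \<phi>_def)
  qed (simp add: \<phi>_def)
  moreover have "\<phi> (vroot L) (pinf L) = pinf L"
    using desc\<theta>[OF root_vert] by (simp add: \<phi>_def desc_eq)
  moreover have "\<phi> (mark L i) (pt L i) = pt (translate_line (\<chi> i. k) L) i" for i
  proof -
    obtain z where z: "coord L (mark L i) (pt L i) = Aff z"
      using affine_coord_Aff[OF coord[OF mark_verts] pt_not_desc] by blast
    have "coord L (mark L i) (\<theta> (mark L i) (pt L i)) = Aff (z + k)"
      using fun_cong[OF c\<theta>[OF mark_verts[of i]], of "pt L i"] z by simp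
    then have "coord L (mark L i) (\<theta> (mark L i) (pt L i)) =
        coord L (mark L i) (pt (translate_line (\<chi> i. k) L) i)"
      unfolding coord_translate_point(1) using z by simp
    then show ?thesis
      using injD[OF bij_is_inj[OF bij[OF mark_verts]]] mark_terminal by (simp add: \<phi>_def)
  qed
  moreover have "is_moebius (\<phi> v)" if "v \<in> verts L" for v
    using m\<theta>[OF that] is_moebius_id by (simp add: \<phi>_def)
  moreover have "pullback_form (\<phi> v) (form L v) = form L v" if "v \<in> verts L" for v
    using form\<theta>[OF that] pullback_id[OF coord[OF that]] by (simp add: \<phi>_def)
  ultimately have "line_iso L (translate_line (\<chi> i. k) L) id \<phi> (\<lambda>_. 1)"
    unfolding line_iso_def line_iso_axioms_def
    using stable_line_axioms stable_line.intro[OF translate_line_stable]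
    by (simp del: translate_line_simps(9) add: case_prod_beta)
  then show ?thesis unfolding iso_rel_iff by blast
qed

end

section \<open>The action on isomorphism classes\<close>

lemma An_pointsE:
  assumes "x \<in> An_points"
  obtains L where "L \<in> stable_lines" "x = iso_rel `` {L}"
  using assms unfolding An_points_def by (rule quotientE)

lemma An_pointsI: "L \<in> stable_lines \<Longrightarrow> iso_rel `` {L} \<in> An_points"
  unfolding An_points_def by (rule quotientI)

lemma iso_class_eq: "(L, L' :: 'n::finite mline) \<in> iso_rel \<Longrightarrow> iso_rel `` {L} = iso_rel `` {L'}"
  by (rule equiv_class_eq[OF equiv_iso_rel])

lemma iso_class_eq_iff:
  "L \<in> stable_lines \<Longrightarrow> L' \<in> stable_lines \<Longrightarrow> iso_rel `` {L} = iso_rel `` {L' :: 'n::finite mline} \<longleftrightarrow> (L, L') \<in> iso_rel"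
  by (rule eq_equiv_class_iff[OF equiv_iso_rel])

lemma iso_class_self: "L \<in> stable_lines \<Longrightarrow> (L :: 'n::finite mline) \<in> iso_rel `` {L}"
  by (rule equiv_class_self[OF equiv_iso_rel])

text \<open>The union in \<open>act\<close> runs over all representatives. Their translates are
  isomorphic, so it is a single class.\<close>

lemma act_class:
  assumes "L \<in> stable_lines"
  shows "act a (iso_rel `` {L}) = iso_rel `` {translate_line a L}"
proof -
  have "iso_rel `` {translate_line a L'} = iso_rel `` {translate_line a L}" if "L' \<in> iso_rel `` {L}" for L'
  proof -
    obtain \<sigma> \<phi> c where "line_iso L L' \<sigma> \<phi> c" using \<open>L' \<in> iso_rel `` {L}\<close> iso_rel_iff by blast
    then have "(translate_line a L, translate_line a L') \<in> iso_rel"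
      unfolding iso_rel_iff by (intro exI, rule line_iso.translate)
    then show ?thesis by (rule iso_class_eq[symmetric])
  qed
  then show ?thesis unfolding act_def using iso_class_self[OF assms] by blast
qed

lemma act_closed: "x \<in> An_points \<Longrightarrow> act a x \<in> An_points"
  by (elim An_pointsE) (simp add: act_class An_pointsI stable_line.translate_line_stable stable_line.intro)

lemma act_0: "x \<in> An_points \<Longrightarrow> act 0 x = x"
  by (elim An_pointsE) (simp add: act_class stable_line.translate_line_0 stable_line.intro)

lemma act_add: "x \<in> An_points \<Longrightarrow> act a (act b x) = act (a + b) x"
  by (elim An_pointsE)
    (simp add: act_class stable_line.translate_line_add stable_line.translate_line_stable stable_line.intro)

lemma act_diagonal: "x \<in> An_points \<Longrightarrow> act (\<chi> i. k) x = x"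
  by (elim An_pointsE)
    (simp add: act_class iso_class_eq[OF stable_line.translate_diagonal_iso, symmetric] stable_line.intro)

section \<open>Charts\<close>

locale tree_chart = level_tree \<Gamma> for \<Gamma> :: "'n::{finite,linorder} ltree" +
  fixes ij :: "nat \<Rightarrow> 'n \<times> 'n" and vt :: nat
  assumes choice: "chart_choice \<Gamma> ij vt"
begin

text \<open>The vertex \<open>v\<^sub>m\<close> of the chart; \<open>scale\<close> is
  \<open>s\<^sub>m\<close>, and \<open>mlev i j\<close> is the index of the scale that divides the
  integral of the pair. At the top level the values are \<open>vt\<close> and
  \<open>1\<close>.\<close>

definition vtx :: "nat \<Rightarrow> nat" where
  "vtx m = (if m = tree_length \<Gamma> then vt else meet \<Gamma> (mark \<Gamma> (fst (ij m))) (mark \<Gamma> (snd (ij m))))"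

definition scale :: "'n mline \<Rightarrow> nat \<Rightarrow> complex" where
  "scale L m = (if m = tree_length \<Gamma> then 1 else II L (fst (ij m)) (snd (ij m)))"

definition mlev :: "'n \<Rightarrow> 'n \<Rightarrow> nat" where
  "mlev i j = level \<Gamma> (meet \<Gamma> (mark \<Gamma> i) (mark \<Gamma> j))"

lemma vtx: "m \<le> tree_length \<Gamma> \<Longrightarrow> vtx m \<in> verts \<Gamma> \<and> level \<Gamma> (vtx m) = m"
proof (cases "m = tree_length \<Gamma>")
  case True
  have "is_terminal \<Gamma> vt" using choice by (simp add: chart_choice_def)
  then show ?thesis using True level_terminal by (simp add: vtx_def is_terminal_def)
next
  case False
  assume "m \<le> tree_length \<Gamma>"
  then have "level \<Gamma> (meet \<Gamma> (mark \<Gamma> (fst (ij m))) (mark \<Gamma> (snd (ij m)))) = m"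
    using choice False by (simp add: chart_choice_def)
  then show ?thesis using False meet(4)[OF mark_verts mark_verts] by (simp add: vtx_def)
qed

lemma mlev_le: "mlev i j \<le> tree_length \<Gamma>"
  unfolding mlev_def by (rule level_le_length[OF meet(4)[OF mark_verts mark_verts]])

lemma mlev_pair: "m < tree_length \<Gamma> \<Longrightarrow> mlev (fst (ij m)) (snd (ij m)) = m"
  using vtx[of m] by (simp add: vtx_def mlev_def)

lemma mlev_eq_length_iff: "mlev i j = tree_length \<Gamma> \<longleftrightarrow> mark \<Gamma> i = mark \<Gamma> j"
  unfolding mlev_def is_terminal_iff_level[OF meet(4)[OF mark_verts mark_verts], symmetric]
  by (rule mark_eq_iff_meet_terminal)

lemma mlev_commute: "mlev i j = mlev j i"
  unfolding mlev_def by (simp only: meet_commute[OF mark_verts[of i] mark_verts[of j]])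

end

text \<open>The antisymmetric extension of the coordinates, matching \<open>II_swap\<close>: the
  pairs chosen for the scales may come in either order.\<close>

definition z_coord :: "('n::linorder \<times> 'n \<Rightarrow> complex) \<times> (nat \<Rightarrow> complex) \<Rightarrow> 'n \<Rightarrow> 'n \<Rightarrow> complex" where
  "z_coord y i j = (if i < j then fst y (i, j) else if j < i then - fst y (j, i) else 0)"

text \<open>The polynomial \<open>w\<^sub>i\<^sub>j\<close>, with \<open>d i j\<close> in place of \<open>a\<^sub>j - a\<^sub>i\<close>.\<close>

definition z_translate :: "'n::{finite,linorder} ltree \<Rightarrow> ('n \<Rightarrow> 'n \<Rightarrow> complex) \<Rightarrow>
    ('n \<times> 'n \<Rightarrow> complex) \<times> (nat \<Rightarrow> complex) \<Rightarrow> 'n \<Rightarrow> 'n \<Rightarrow> complex" where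
  "z_translate \<Gamma> d y i j = z_coord y i j +
     d i j * (\<Prod>k\<in>{level \<Gamma> (meet \<Gamma> (mark \<Gamma> i) (mark \<Gamma> j))<..tree_length \<Gamma>}. snd y k)"

section \<open>Coordinates of a line in a chart\<close>

locale chart_point = tree_chart \<Gamma> ij vt + pt: stable_line L
  for \<Gamma> :: "'n::{finite,linorder} ltree" and ij vt and L :: "'n mline" +
  fixes f :: "nat \<Rightarrow> nat"
  assumes contr: "contraction \<Gamma> L f"
    and PPi_nz: "mark \<Gamma> i \<noteq> mark \<Gamma> j \<Longrightarrow> PPi L i j \<noteq> Aff 0"
begin

sublocale tree_contraction \<Gamma> L f
  by unfold_locales (rule contr)

text \<open>If the contraction merges the two marks, this is the condition on \<open>PPi\<close>; if
  not, the integral runs between distinct nodes.\<close>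

lemma II_nz: "mark \<Gamma> i \<noteq> mark \<Gamma> j \<Longrightarrow> II L i j \<noteq> 0"
  using PPi_nz[of i j] pt.II_nonzero[of i j] by (auto simp: pt.PPi_eq split: if_splits)

lemma scale_nz: "m \<le> tree_length \<Gamma> \<Longrightarrow> scale L m \<noteq> 0"
  using mlev_pair[of m] mlev_eq_length_iff[of "fst (ij m)" "snd (ij m)"]
    II_nz[of "fst (ij m)" "snd (ij m)"]
  by (auto simp: scale_def)

text \<open>The level of \<open>L\<close> to which level \<open>m\<close> of \<open>\<Gamma>\<close>
  is contracted; by \<open>llev_vertex\<close> the choice of a vertex on level \<open>m\<close> is
  immaterial. Levels \<open>m - 1\<close> and \<open>m\<close> are merged iff the values
  agree.\<close>

definition llev :: "nat \<Rightarrow> nat" where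
  "llev m = level L (f (vtx m))"

lemma llev_mono: "m \<le> m' \<Longrightarrow> m' \<le> tree_length \<Gamma> \<Longrightarrow> llev m \<le> llev m'"
  unfolding llev_def
  using vtx[of m] vtx[of m'] pre_image[of "vtx m" "vtx m'"] level_le_iff[of "vtx m" "vtx m'"]
    pt.level_le_iff[of "f (vtx m)" "f (vtx m')"] vert by simp

lemma same_level_vtx:
  "m \<le> tree_length \<Gamma> \<Longrightarrow> m' \<le> tree_length \<Gamma> \<Longrightarrow> (f (vtx m), f (vtx m')) \<in> same_level L \<longleftrightarrow> llev m = llev m'"
  unfolding llev_def
  using vtx[of m] vtx[of m'] vert pt.level_eq_iff[of "f (vtx m)" "f (vtx m')"] by simp

lemma llev_vertex: "v \<in> verts \<Gamma> \<Longrightarrow> level L (f v) = llev (level \<Gamma> v)"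
  unfolding llev_def
  using vtx[OF level_le_length[of v]] same_level_image[of v "vtx (level \<Gamma> v)"]
    level_eq_iff[of v "vtx (level \<Gamma> v)"] vert
    pt.level_eq_iff[of "f v" "f (vtx (level \<Gamma> v))"] by simp

text \<open>Two points share a component iff their meet in \<open>L\<close> is terminal. It is the
  image of their meet in \<open>\<Gamma>\<close>, whose level must thus be merged with the top
  level.\<close>

lemma mark_eq_iff_llev: "mark L i = mark L j \<longleftrightarrow> llev (mlev i j) = llev (tree_length \<Gamma>)"
proof -
  have "llev (tree_length \<Gamma>) = tree_length L"
    using pt.level_terminal[OF terminal_image] choice by (simp add: llev_def vtx_def chart_choice_def)
  moreover have "mark L i = mark L j \<longleftrightarrow> level L (f (meet \<Gamma> (mark \<Gamma> i) (mark \<Gamma> j))) = tree_length L"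
    unfolding meet_mark_image pt.mark_eq_iff_meet_terminal[symmetric]
    by (rule pt.is_terminal_iff_level[OF pt.meet(4)[OF pt.mark_verts pt.mark_verts]])
  moreover have "level L (f (meet \<Gamma> (mark \<Gamma> i) (mark \<Gamma> j))) = llev (mlev i j)"
    using llev_vertex[OF meet(4)[OF mark_verts mark_verts]] by (simp add: mlev_def)
  ultimately show ?thesis by simp
qed

text \<open>The contraction selected in \<open>line_chart\<close> agrees with \<open>f\<close> on
  vertices by uniqueness.\<close>

lemma line_chart_eq:
  "line_chart \<Gamma> ij vt L =
    (restrict (\<lambda>(i, j). II L i j / scale L (mlev i j)) {(i, j). i < j},
     restrict (\<lambda>m. if llev m = llev (m - 1) then scale L m / scale L (m - 1) else 0) {1..tree_length \<Gamma>})"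
proof -
  define f' where "f' = (SOME f. contraction \<Gamma> (dual_tree L) f)"
  have "contraction \<Gamma> (dual_tree L) f'"
    unfolding f'_def by (rule someI[of _ f]) (simp add: contr contraction_dual_tree)
  then have "contraction \<Gamma> L f'" by (simp add: contraction_dual_tree)
  then have "tree_contraction \<Gamma> L f'"
    by (intro tree_contraction.intro tree_contraction_axioms.intro) unfold_locales
  then have f': "f' v = f v" if "v \<in> verts \<Gamma>" for v
    using contraction_unique tree_contraction_axioms that by blast
  have "(f' (vtx m), f' (vtx (m - 1))) \<in> same_level L \<longleftrightarrow> llev m = llev (m - 1)"
    if "m \<in> {1..tree_length \<Gamma>}" for m
  proof -
    have le: "m \<le> tree_length \<Gamma>" "m - 1 \<le> tree_length \<Gamma>" using that by auto
    show ?thesis using same_level_vtx[OF le] vtx[OF le(1)] vtx[OF le(2)] f' by simp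
  qed
  then show ?thesis
    unfolding line_chart_def Let_def f'_def[symmetric] vtx_def[abs_def] scale_def[abs_def] mlev_def
    by (auto intro!: restrict_ext)
qed

abbreviation "y \<equiv> line_chart \<Gamma> ij vt L"

lemma t_eq: "m \<in> {1..tree_length \<Gamma>} \<Longrightarrow>
    snd y m = (if llev m = llev (m - 1) then scale L m / scale L (m - 1) else 0)"
  by (simp add: line_chart_eq)

lemma z_coord_eq: "z_coord y i j = II L i j / scale L (mlev i j)"
proof -
  have "i < j \<or> i = j \<or> j < i" by (rule less_linear)
  then show ?thesis
    using pt.II_swap[of i j] mlev_commute[of i j] pt.II_same[of i]
    by (auto simp: z_coord_def line_chart_eq)
qed

text \<open>Downward induction from the empty product at the top, where the scale is
  \<open>1\<close>. As \<open>llev\<close> is monotone, equality of \<open>llev\<close> at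
  \<open>m\<close> and at the top forces all levels in between to be merged, so the quotients
  telescope; otherwise a factor is \<open>0\<close>.\<close>

lemma t_prod_eq:
  "m \<le> tree_length \<Gamma> \<Longrightarrow> (\<Prod>k\<in>{m<..tree_length \<Gamma>}. snd y k) =
    (if llev m = llev (tree_length \<Gamma>) then 1 / scale L m else 0)"
proof (induction rule: inc_induct)
  case base
  then show ?case by (simp add: scale_def)
next
  case (step n)
  have "{n<..tree_length \<Gamma>} = insert (Suc n) {Suc n<..tree_length \<Gamma>}" using step by auto
  then have "(\<Prod>k\<in>{n<..tree_length \<Gamma>}. snd y k) =
      snd y (Suc n) * (\<Prod>k\<in>{Suc n<..tree_length \<Gamma>}. snd y k)" by simp
  moreover have "llev n \<le> llev (Suc n)" "llev (Suc n) \<le> llev (tree_length \<Gamma>)"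
    using llev_mono step by simp_all
  moreover have "scale L (Suc n) \<noteq> 0" using scale_nz step by simp
  ultimately show ?case using step t_eq[of "Suc n"] by auto
qed

text \<open>The shift in \<open>II_translate_line\<close> is present exactly when the product of the
  \<open>t\<close>s is nonzero, and then this product cancels the scale in front.\<close>

lemma II_translate:
  "II (translate_line a L) i j = scale L (mlev i j) * z_translate \<Gamma> (\<lambda>i j. vec_nth a j - vec_nth a i) y i j"
  unfolding z_translate_def mlev_def[symmetric] t_prod_eq[OF mlev_le] z_coord_eq
    pt.II_translate_line mark_eq_iff_llev
  using scale_nz[OF mlev_le, of i j] by (simp add: field_simps)

end

lemma (in tree_chart) chart_pointI:
  assumes "L \<in> stable_lines" "contraction \<Gamma> L f" "\<And>i j. mark \<Gamma> i \<noteq> mark \<Gamma> j \<Longrightarrow> PPi L i j \<noteq> Aff 0"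
  shows "chart_point \<Gamma> ij vt L f"
  using assms tree_chart_axioms by (simp add: chart_point_def chart_point_axioms_def stable_line_def)

text \<open>Each integral is multiplied by the constant of its meet, which depends only on the
  level. The constant cancels in \<open>z\<close>, and also in \<open>t\<close>, since a quotient is
  formed only where the two levels are merged and share their constant.\<close>

lemma (in chart_point) iso:
  assumes "line_iso L L' \<sigma> \<phi> c"
  shows "chart_point \<Gamma> ij vt L' (\<sigma> \<circ> f)" "line_chart \<Gamma> ij vt L' = line_chart \<Gamma> ij vt L"
proof -
  interpret i: line_iso L L' \<sigma> \<phi> c by fact
  have "contraction \<Gamma> L' (\<sigma> \<circ> f)"
    using contraction_comp[OF tree_contraction_axioms i.tree_contraction_axioms]
    by (simp add: tree_contraction_def tree_contraction_axioms_def)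
  then show cp: "chart_point \<Gamma> ij vt L' (\<sigma> \<circ> f)"
    using PPi_nz i.PPi_map by (intro chart_pointI) (auto simp: i.cod.stable_line)
  interpret p: chart_point \<Gamma> ij vt L' "\<sigma> \<circ> f" by fact
  have s: "scale L' m = c (f (vtx m)) * scale L m" if "m \<le> tree_length \<Gamma>" for m
  proof (cases "m = tree_length \<Gamma>")
    case True
    have "is_terminal L (f vt)" using terminal_image choice by (simp add: chart_choice_def)
    then show ?thesis using True i.scale_terminal by (simp add: scale_def vtx_def)
  next
    case False
    then show ?thesis using i.II_map meet_mark_image by (simp add: scale_def vtx_def)
  qed
  have cv: "c (f v) = c (f (vtx (level \<Gamma> v)))" if "v \<in> verts \<Gamma>" for v
    using vtx[OF level_le_length[OF that]] level_eq_iff[OF that, of "vtx (level \<Gamma> v)"]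
    by (intro i.scale_level same_level_image) simp
  have cnz: "c (f (vtx m)) \<noteq> 0" if "m \<le> tree_length \<Gamma>" for m
    using i.scale_nz vert vtx[OF that] by blast
  have z: "II L' i j / scale L' (mlev i j) = II L i j / scale L (mlev i j)" for i j
    using s[OF mlev_le] cnz[OF mlev_le[of i j]] i.II_map[of i j] meet_mark_image[of i j]
      cv[OF meet(4)[OF mark_verts[of i] mark_verts[of j]]] by (simp add: mlev_def)
  have l: "p.llev m = p.llev m' \<longleftrightarrow> llev m = llev m'" if "m \<le> tree_length \<Gamma>" "m' \<le> tree_length \<Gamma>" for m m'
  proof -
    have v: "f (vtx m) \<in> verts L" "f (vtx m') \<in> verts L" using vtx that vert by auto
    then have "(\<sigma> (f (vtx m)), \<sigma> (f (vtx m'))) \<in> same_level L' \<longleftrightarrow> (f (vtx m), f (vtx m')) \<in> same_level L"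
      using i.pre_iff by (simp add: pt.same_level_iff i.cod.same_level_iff)
    then show ?thesis using same_level_vtx[OF that] p.same_level_vtx[OF that] by simp
  qed
  have t: "scale L' m / scale L' (m - 1) = scale L m / scale L (m - 1)"
    if "m \<in> {1..tree_length \<Gamma>}" "llev m = llev (m - 1)" for m
  proof -
    have le: "m \<le> tree_length \<Gamma>" "m - 1 \<le> tree_length \<Gamma>" using that by auto
    have "c (f (vtx m)) = c (f (vtx (m - 1)))"
      using that same_level_vtx[OF le] by (intro i.scale_level) simp
    then show ?thesis using s[OF le(1)] s[OF le(2)] cnz[OF le(1)] by simp
  qed
  show "line_chart \<Gamma> ij vt L' = line_chart \<Gamma> ij vt L"
    unfolding line_chart_eq p.line_chart_eq
    using z l t by (auto intro!: restrict_ext)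
qed

section \<open>Change of charts under a translation\<close>

locale chart_transition = chart_point \<Gamma> ij vt L f + new: tree_chart \<Gamma>' ij' vt'
  for \<Gamma> :: "'n::{finite,linorder} ltree" and ij vt and L :: "'n mline" and f
    and \<Gamma>' :: "'n ltree" and ij' vt' +
  fixes g :: "nat \<Rightarrow> nat" and a :: "complex ^ 'n::{finite,linorder}"
  assumes g: "contraction \<Gamma>' \<Gamma> g"
    and z_nz: "mark \<Gamma>' i \<noteq> mark \<Gamma>' j \<Longrightarrow> z_translate \<Gamma> (\<lambda>i j. vec_nth a j - vec_nth a i) y i j \<noteq> 0"
begin

abbreviation "w \<equiv> z_translate \<Gamma> (\<lambda>i j. vec_nth a j - vec_nth a i) y"

text \<open>The ratio of scale \<open>m\<close> of the translate in the new chart to scale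
  \<open>\<kappa> m\<close> of \<open>L\<close> in the old one, by \<open>scale_translate\<close>.
  It is expressed in the old coordinates and \<open>a\<close>.\<close>

definition W :: "nat \<Rightarrow> complex" where
  "W m = (if m = tree_length \<Gamma>' then 1 else w (fst (ij' m)) (snd (ij' m)))"

text \<open>The level of \<open>\<Gamma>\<close> to which level \<open>m\<close> of
  \<open>\<Gamma>'\<close> is contracted. It depends on \<open>g\<close> but not on
  \<open>L\<close>.\<close>

definition \<kappa> :: "nat \<Rightarrow> nat" where
  "\<kappa> m = level \<Gamma> (g (new.vtx m))"

sublocale g: tree_contraction \<Gamma>' \<Gamma> g
  by unfold_locales (rule g)

text \<open>Translation keeps the tree, so \<open>f \<circ> g\<close> is a contraction onto that of
  the translate. By \<open>II_translate\<close> the domain condition follows from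
  \<open>z_nz\<close>.\<close>

lemma chart_point_translate: "chart_point \<Gamma>' ij' vt' (translate_line a L) (f \<circ> g)"
proof (rule new.chart_pointI)
  show "translate_line a L \<in> stable_lines" by (rule pt.translate_line_stable)
  have "contraction \<Gamma>' L (f \<circ> g)"
    using contraction_comp[OF g.tree_contraction_axioms tree_contraction_axioms]
    by (simp add: tree_contraction_def tree_contraction_axioms_def)
  then show "contraction \<Gamma>' (translate_line a L) (f \<circ> g)" by (simp add: contraction_def)
next
  fix i j assume "mark \<Gamma>' i \<noteq> mark \<Gamma>' j"
  then have "II (translate_line a L) i j \<noteq> 0" using z_nz scale_nz[OF mlev_le] by (simp add: II_translate)
  then show "PPi (translate_line a L) i j \<noteq> Aff 0"
    by (simp add: stable_line.PPi_eq[OF stable_line.intro[OF pt.translate_line_stable]])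
qed

sublocale t: chart_point \<Gamma>' ij' vt' "translate_line a L" "f \<circ> g"
  by (rule chart_point_translate)

lemma \<kappa>_le: "m \<le> tree_length \<Gamma>' \<Longrightarrow> \<kappa> m \<le> tree_length \<Gamma>"
  unfolding \<kappa>_def using new.vtx g.vert level_le_length by blast

lemma \<kappa>_length: "\<kappa> (tree_length \<Gamma>') = tree_length \<Gamma>"
  using level_terminal[OF g.terminal_image] new.choice by (simp add: \<kappa>_def new.vtx_def chart_choice_def)

text \<open>The contraction \<open>g\<close> preserves meets and sends vertices on one level to
  vertices on one level.\<close>

lemma \<kappa>_mlev: "\<kappa> (new.mlev i j) = mlev i j"
proof -
  let ?v = "meet \<Gamma>' (mark \<Gamma>' i) (mark \<Gamma>' j)"
  have v: "?v \<in> verts \<Gamma>'" by (rule new.meet(4)[OF new.mark_verts new.mark_verts])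
  have "(new.vtx (new.mlev i j), ?v) \<in> same_level \<Gamma>'"
    using new.vtx[OF new.mlev_le, of i j]
    by (intro iffD1[OF new.level_eq_iff[OF _ v]]) (simp_all add: new.mlev_def)
  then have "\<kappa> (new.mlev i j) = level \<Gamma> (g ?v)"
    unfolding \<kappa>_def using new.vtx[OF new.mlev_le, of i j]
    by (intro iffD2[OF level_eq_iff[OF g.vert g.vert[OF v]]] g.same_level_image) simp_all
  then show ?thesis using g.meet_mark_image by (simp add: mlev_def)
qed

lemma \<kappa>_step:
  assumes "m \<in> {1..tree_length \<Gamma>'}"
  shows "\<kappa> m = \<kappa> (m - 1) \<or> \<kappa> m = Suc (\<kappa> (m - 1))"
  unfolding \<kappa>_def using new.vtx[of m] new.vtx[of "m - 1"] assms by (intro g.level_step) auto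

lemma scale_translate:
  assumes "m \<le> tree_length \<Gamma>'"
  shows "new.scale (translate_line a L) m = scale L (\<kappa> m) * W m"
proof (cases "m = tree_length \<Gamma>'")
  case True
  then show ?thesis by (simp add: W_def new.scale_def \<kappa>_length scale_def)
next
  case False
  then have "mlev (fst (ij' m)) (snd (ij' m)) = \<kappa> m"
    using \<kappa>_mlev[symmetric] new.mlev_pair[of m] assms by simp
  then show ?thesis using False by (simp add: W_def new.scale_def II_translate)
qed

lemma W_nz: "m \<le> tree_length \<Gamma>' \<Longrightarrow> W m \<noteq> 0"
  using t.scale_nz scale_translate by auto

lemma llev_translate: "m \<le> tree_length \<Gamma>' \<Longrightarrow> t.llev m = llev (\<kappa> m)"
  unfolding t.llev_def \<kappa>_def using llev_vertex g.vert new.vtx by simp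

lemma z_transition:
  assumes "i < j"
  shows "fst t.y (i, j) = w i j / W (new.mlev i j)"
proof -
  have "fst t.y (i, j) = II (translate_line a L) i j / new.scale (translate_line a L) (new.mlev i j)"
    using assms by (simp add: t.line_chart_eq)
  then show ?thesis
    unfolding II_translate scale_translate[OF new.mlev_le] \<kappa>_mlev using scale_nz[OF mlev_le] by simp
qed

text \<open>If \<open>g\<close> merges levels \<open>m - 1\<close> and \<open>m\<close>, the old
  scales cancel. Otherwise \<open>\<kappa> (m - 1)\<close> is the predecessor of
  \<open>\<kappa> m\<close>, and the old coordinate \<open>t\<close> of index
  \<open>\<kappa> m\<close> is the quotient of the old scales, or \<open>0\<close> if
  \<open>f\<close> separates the levels.\<close>

lemma t_transition:
  assumes m: "m \<in> {1..tree_length \<Gamma>'}"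
  shows "snd t.y m = (if \<kappa> m = \<kappa> (m - 1) then 1 else snd y (\<kappa> m)) * W m / W (m - 1)"
proof -
  have le: "m \<le> tree_length \<Gamma>'" "m - 1 \<le> tree_length \<Gamma>'" using m by auto
  have "snd t.y m = (if llev (\<kappa> m) = llev (\<kappa> (m - 1))
      then (scale L (\<kappa> m) * W m) / (scale L (\<kappa> (m - 1)) * W (m - 1)) else 0)"
    using t.t_eq[OF m] llev_translate le scale_translate by simp
  moreover have "snd y (\<kappa> m) = (if llev (\<kappa> m) = llev (\<kappa> (m - 1))
      then scale L (\<kappa> m) / scale L (\<kappa> (m - 1)) else 0)" if "\<kappa> m \<noteq> \<kappa> (m - 1)"
    using t_eq[of "\<kappa> m"] \<kappa>_step[OF m] that \<kappa>_le[OF le(1)] by auto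
  moreover have "scale L (\<kappa> (m - 1)) \<noteq> 0" using scale_nz \<kappa>_le le by blast
  ultimately show ?thesis by auto
qed

end

section \<open>Charts on isomorphism classes\<close>

lemma class_in_chart_dom_iff:
  fixes L :: "'n::finite mline"
  assumes \<Gamma>: "level_tree \<Gamma>" and L: "L \<in> stable_lines"
  shows "iso_rel `` {L} \<in> chart_dom \<Gamma> \<longleftrightarrow>
    (\<exists>f. contraction \<Gamma> L f) \<and> (\<forall>i j. mark \<Gamma> i \<noteq> mark \<Gamma> j \<longrightarrow> PPi L i j \<noteq> Aff 0)"
proof
  assume "iso_rel `` {L} \<in> chart_dom \<Gamma>"
  then obtain L' f where L': "L' \<in> stable_lines" "iso_rel `` {L} = iso_rel `` {L'}" "contraction \<Gamma> L' f"
    "\<forall>i j. mark \<Gamma> i \<noteq> mark \<Gamma> j \<longrightarrow> PPi L' i j \<noteq> Aff 0"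
    by (auto simp: chart_dom_def contraction_dual_tree)
  then have "(L', L) \<in> iso_rel" using iso_class_eq_iff[OF L'(1) L] by simp
  then obtain \<sigma> \<phi> c where "line_iso L' L \<sigma> \<phi> c" unfolding iso_rel_iff by blast
  then interpret i: line_iso L' L \<sigma> \<phi> c .
  have "tree_contraction \<Gamma> L' f"
    using \<Gamma> L'(3) i.dom.level_tree_axioms by (simp add: tree_contraction_def tree_contraction_axioms_def)
  then have "tree_contraction \<Gamma> L (\<sigma> \<circ> f)" by (rule contraction_comp[OF _ i.tree_contraction_axioms])
  then show "(\<exists>f. contraction \<Gamma> L f) \<and> (\<forall>i j. mark \<Gamma> i \<noteq> mark \<Gamma> j \<longrightarrow> PPi L i j \<noteq> Aff 0)"
    using L'(4) i.PPi_map by (auto simp: tree_contraction_def tree_contraction_axioms_def)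
next
  assume "(\<exists>f. contraction \<Gamma> L f) \<and> (\<forall>i j. mark \<Gamma> i \<noteq> mark \<Gamma> j \<longrightarrow> PPi L i j \<noteq> Aff 0)"
  then show "iso_rel `` {L} \<in> chart_dom \<Gamma>"
    using L unfolding chart_dom_def contraction_dual_tree by blast
qed

lemma chart_dom_subset: "chart_dom \<Gamma> \<subseteq> An_points"
  unfolding chart_dom_def using An_pointsI by blast

lemma chart_class:
  assumes "chart_point \<Gamma> ij vt L f"
  shows "iso_rel `` {L} \<in> chart_dom \<Gamma>" "chart \<Gamma> ij vt (iso_rel `` {L}) = line_chart \<Gamma> ij vt L"
proof -
  interpret chart_point \<Gamma> ij vt L f by fact
  show "iso_rel `` {L} \<in> chart_dom \<Gamma>"
    using contr PPi_nz class_in_chart_dom_iff[OF level_tree_axioms pt.stable_line] by blast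
  have "(SOME L'. L' \<in> iso_rel `` {L}) \<in> iso_rel `` {L}"
    using iso_class_self[OF pt.stable_line] by (rule someI[of "\<lambda>L'. L' \<in> iso_rel `` {L}"])
  then have "(L, SOME L'. L' \<in> iso_rel `` {L}) \<in> iso_rel" by blast
  then show "chart \<Gamma> ij vt (iso_rel `` {L}) = line_chart \<Gamma> ij vt L"
    unfolding chart_def iso_rel_iff using iso(2) by blast
qed

section \<open>The action as a morphism\<close>

lemma polys_z_coord:
  assumes "\<And>i j. i < j \<Longrightarrow> (\<lambda>x. fst (y x) (i, j)) \<in> polys C"
  shows "(\<lambda>x. z_coord (y x) i j) \<in> polys C"
proof (cases i j rule: linorder_cases)
  case less
  then show ?thesis using assms by (simp add: z_coord_def)
next
  case equal
  then show ?thesis using polys.const[of 0] by (simp add: z_coord_def)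
next
  case greater
  then show ?thesis using polys_uminus[OF assms[OF greater]] by (simp add: z_coord_def less_not_sym)
qed

text \<open>Both \<open>d\<close> and \<open>y\<close> depend on a parameter \<open>x\<close>, so
  that the lemma applies on a product, where they come from different factors.\<close>

lemma polys_z_translate:
  assumes "\<And>i j. i < j \<Longrightarrow> (\<lambda>x. fst (y x) (i, j)) \<in> polys C"
    and "\<And>m. m \<in> {1..tree_length \<Gamma>} \<Longrightarrow> (\<lambda>x. snd (y x) m) \<in> polys C"
    and "\<And>i j. (\<lambda>x. d x i j) \<in> polys C"
  shows "(\<lambda>x. z_translate \<Gamma> (d x) (y x) i j) \<in> polys C"
  unfolding z_translate_def
  by (intro polys.add polys.mult polys_prod polys_z_coord assms) auto

text \<open>The identity is a contraction onto the line's own dual tree. The domain condition holds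
  because \<open>PPi\<close> is infinite for points on distinct components.\<close>

lemma chart_at:
  fixes L :: "'n::{finite,linorder} mline"
  assumes L: "L \<in> stable_lines"
  obtains ij vt where "dual_level_tree (dual_tree L)" "chart_point (dual_tree L) ij vt L id"
proof -
  interpret stable_line L by (rule stable_line.intro[OF L])
  interpret \<Gamma>: level_tree "dual_tree L" by (rule level_tree_dual_tree[OF L])
  obtain ij where "\<forall>m < tree_length L. level L (meet L (mark L (fst (ij m))) (mark L (snd (ij m)))) = m"
    using level_pairs by blast
  then have "chart_choice (dual_tree L) ij (mark L undefined)"
    using mark_terminal by (simp add: chart_choice_def)
  then interpret tree_chart "dual_tree L" ij "mark L undefined" by unfold_locales
  have "contraction (dual_tree L) L id" unfolding contraction_def by auto
  then have "chart_point (dual_tree L) ij (mark L undefined) L id"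
    by (rule chart_pointI[OF L]) (simp add: PPi_eq)
  moreover have "dual_level_tree (dual_tree L)" using L by (auto simp: dual_level_tree_def)
  ultimately show ?thesis using that by blast
qed

lemma dual_level_tree_level_tree: "dual_level_tree \<Gamma> \<Longrightarrow> level_tree \<Gamma>"
  using level_tree_dual_tree by (auto simp: dual_level_tree_def)

lemma chart_point_choice: "chart_point \<Gamma> ij vt L f \<Longrightarrow> chart_choice \<Gamma> ij vt"
  by (simp add: chart_point_def tree_chart_def tree_chart_axioms_def)

lemma topspace_An: "topspace (ztop (An :: 'n::{finite,linorder} mline set fspace)) = An_points"
proof -
  have "\<exists>\<Gamma> ij vt. dual_level_tree \<Gamma> \<and> chart_choice \<Gamma> ij vt \<and> x \<in> chart_dom \<Gamma>"
    if x: "x \<in> An_points" for x :: "'n mline set"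
  proof -
    obtain L where L: "L \<in> stable_lines" "x = iso_rel `` {L}" using x by (rule An_pointsE)
    obtain ij vt where c: "dual_level_tree (dual_tree L)" "chart_point (dual_tree L) ij vt L id"
      by (rule chart_at[OF L(1)])
    then show ?thesis using chart_class(1)[OF c(2)] chart_point_choice[OF c(2)] L(2) by blast
  qed
  then show ?thesis unfolding An_def topspace_glue using chart_dom_subset by fastforce
qed

text \<open>With \<open>\<alpha>\<close> the identity this concerns the full group. With
  \<open>\<alpha>\<close> an arbitrary choice of coset representatives it concerns the quotient,
  where only differences of components are known to be regular.\<close>

lemma is_morphism_act:
  fixes X :: "'g fspace" and \<alpha> :: "'g \<Rightarrow> complex ^ 'n::{finite,linorder}"
  assumes diff: "\<And>i j. (\<lambda>g. vec_nth (\<alpha> g) j - vec_nth (\<alpha> g) i) \<in> regfun X (topspace (ztop X))"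
  shows "is_morphism (prod_fspace X An) An (\<lambda>(g, x). act (\<alpha> g) x)"
proof -
  define Ch where "Ch = {(U \<times> V, {f \<circ> fst | f. f \<in> regfun X U} \<union> {g \<circ> snd | g. g \<in> regfun An V}) | U V.
    openin (ztop X) U \<and> openin (ztop An) (V :: 'n mline set set)}"
  define ChA where "ChA = {(chart_dom \<Gamma>, (\<lambda>c. c \<circ> chart \<Gamma> ij vt) ` target_coords \<Gamma>) | (\<Gamma> :: 'n ltree) ij vt.
     dual_level_tree \<Gamma> \<and> chart_choice \<Gamma> ij vt}"
  let ?F = "\<lambda>(g, x). act (\<alpha> g) x"
  have prod: "prod_fspace X An = glue Ch" by (simp add: prod_fspace_def Ch_def)
  have An: "An = glue ChA" by (simp add: An_def ChA_def)
  have top: "topspace (ztop (glue Ch)) = topspace (ztop X) \<times> An_points"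
    unfolding prod[symmetric] topspace_prod_fspace topspace_An ..
  have "is_morphism (glue Ch) (glue ChA) ?F"
  proof (rule is_morphism_glueI)
    fix p assume "p \<in> topspace (ztop (glue Ch))"
    then show "?F p \<in> topspace (ztop (glue ChA))"
      unfolding top An[symmetric] topspace_An using act_closed by auto
  next
    fix p0 U' C' assume p0: "p0 \<in> topspace (ztop (glue Ch))" and U'C': "(U', C') \<in> ChA" "?F p0 \<in> U'"
    obtain \<Gamma>' :: "'n ltree" and ij' vt' where U': "U' = chart_dom \<Gamma>'"
      and C': "C' = (\<lambda>c. c \<circ> chart \<Gamma>' ij' vt') ` target_coords \<Gamma>'"
      and \<Gamma>': "dual_level_tree \<Gamma>'" "chart_choice \<Gamma>' ij' vt'"
      using U'C'(1) unfolding ChA_def by blast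
    interpret new: tree_chart \<Gamma>' ij' vt'
      using dual_level_tree_level_tree[OF \<Gamma>'(1)] \<Gamma>'(2) by (simp add: tree_chart_def tree_chart_axioms_def)
    obtain g0 x0 where gx: "p0 = (g0, x0)" "g0 \<in> topspace (ztop X)" "x0 \<in> An_points"
      using p0 unfolding top by blast
    obtain L0 where L0: "L0 \<in> stable_lines" "x0 = iso_rel `` {L0}" using gx(3) by (rule An_pointsE)
    define \<Gamma> where "\<Gamma> = dual_tree L0"
    obtain ij vt where \<Gamma>: "dual_level_tree \<Gamma>" "chart_point \<Gamma> ij vt L0 id"
      unfolding \<Gamma>_def by (rule chart_at[OF L0(1)])
    interpret base: chart_point \<Gamma> ij vt L0 id by (rule \<Gamma>(2))
    have "iso_rel `` {translate_line (\<alpha> g0) L0} \<in> chart_dom \<Gamma>'"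
      using U'C'(2) by (simp add: gx L0(2) act_class[OF L0(1)] U')
    then obtain g where g: "contraction \<Gamma>' (translate_line (\<alpha> g0) L0) g"
      and PPi: "\<And>i j. mark \<Gamma>' i \<noteq> mark \<Gamma>' j \<Longrightarrow> PPi (translate_line (\<alpha> g0) L0) i j \<noteq> Aff 0"
      using class_in_chart_dom_iff[OF new.level_tree_axioms base.pt.translate_line_stable] by blast
    interpret t0: chart_point \<Gamma>' ij' vt' "translate_line (\<alpha> g0) L0" g
      by (rule new.chart_pointI[OF base.pt.translate_line_stable g PPi])
    \<comment> \<open>The translate of \<open>L0\<close> has the dual tree of \<open>L0\<close>,
      which is \<open>\<Gamma>\<close>, so \<open>g\<close> can be followed by the contraction from
      \<open>\<Gamma>\<close> to any nearby line.\<close>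
    have g': "contraction \<Gamma>' \<Gamma> g" using g by (simp add: contraction_def \<Gamma>_def)

    define D where "D a i j = vec_nth a j - vec_nth a i" for a :: "(complex, 'n) vec" and i j
    define y where "y p = chart \<Gamma> ij vt (snd p)" for p :: "'g \<times> 'n mline set"
    define w where "w p i j = z_translate \<Gamma> (D (\<alpha> (fst p))) (y p) i j" for p i j
    define W where "W p m = (if m = tree_length \<Gamma>' then 1 else w p (fst (ij' m)) (snd (ij' m)))" for p m
    define \<kappa> where "\<kappa> m = level \<Gamma> (g (new.vtx m))" for m
    \<comment> \<open>A single polynomial gathering all nonvanishing conditions of the new
      chart.\<close>
    define R where "R p = (\<Prod>(i, j)\<in>{(i, j). mark \<Gamma>' i \<noteq> mark \<Gamma>' j}. w p i j)" for p
    define U where "U = topspace (ztop X) \<times> chart_dom \<Gamma>"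
    define C where "C = {f \<circ> fst | f. f \<in> regfun X (topspace (ztop X))} \<union>
      {g \<circ> snd | g. g \<in> regfun An (chart_dom \<Gamma>)}"
    define N where "N = {p \<in> U. R p \<noteq> 0}"

    have ch: "(chart_dom \<Gamma>, (\<lambda>c. c \<circ> chart \<Gamma> ij vt) ` target_coords \<Gamma>) \<in> ChA"
      unfolding ChA_def using \<Gamma>(1) chart_point_choice[OF \<Gamma>(2)] by blast
    then have "openin (ztop An) (chart_dom \<Gamma>)" unfolding An by (rule openin_glue_chart)
    then have UC: "(U, C) \<in> Ch" unfolding Ch_def U_def C_def by blast
    have coordC: "(\<lambda>p. c (y p)) \<in> polys C" if "c \<in> target_coords \<Gamma>" for c
    proof -
      have "c \<circ> chart \<Gamma> ij vt \<in> regfun An (chart_dom \<Gamma>)"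
        unfolding An using that by (intro regfun_glue_coordinate[OF ch]) blast
      then have "(c \<circ> chart \<Gamma> ij vt) \<circ> snd \<in> polys C" unfolding C_def by (intro polys.gen) blast
      then show ?thesis by (simp add: y_def o_def)
    qed
    have zC: "(\<lambda>p. fst (y p) (i, j)) \<in> polys C" if "i < j" for i j
      using coordC[of "\<lambda>y. fst y (i, j)"] that by (simp add: target_coords_def) blast
    have tC: "(\<lambda>p. snd (y p) m) \<in> polys C" if "m \<in> {1..tree_length \<Gamma>}" for m
      using coordC[of "\<lambda>y. snd y m"] that by (simp add: target_coords_def) blast
    have dC: "(\<lambda>p. D (\<alpha> (fst p)) i j) \<in> polys C" for i j
    proof -
      have "(\<lambda>g. D (\<alpha> g) i j) \<circ> fst \<in> polys C"
        unfolding C_def using diff by (intro polys.gen) (auto simp: D_def)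
      then show ?thesis by (simp add: o_def)
    qed
    have wC: "(\<lambda>p. w p i j) \<in> polys C" for i j
      unfolding w_def by (intro polys_z_translate zC tC dC)
    have WC: "(\<lambda>p. W p m) \<in> polys C" for m
      using wC polys.const[of 1] by (cases "m = tree_length \<Gamma>'") (simp_all add: W_def)
    have RC: "R \<in> polys C"
      unfolding R_def[abs_def] case_prod_beta by (intro polys_prod wC)
    have openN: "openin (ztop (glue Ch)) N"
      unfolding N_def by (rule openin_glue_basic[OF UC RC])
    have fin: "finite {(i, j). mark \<Gamma>' i \<noteq> mark \<Gamma>' j}" by simp
    have R_nz: "R p \<noteq> 0 \<longleftrightarrow> (\<forall>i j. mark \<Gamma>' i \<noteq> mark \<Gamma>' j \<longrightarrow> w p i j \<noteq> 0)" for p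
      unfolding R_def by (auto simp: prod_zero_iff[OF fin])

    \<comment> \<open>The same \<open>g\<close> serves at every point, so the new coordinates are
      given by the same polynomials throughout \<open>N\<close>.\<close>
    have transition: "chart_transition \<Gamma> ij vt L f \<Gamma>' ij' vt' g (\<alpha> (fst p))"
      if "chart_point \<Gamma> ij vt L f" "snd p = iso_rel `` {L}" "R p \<noteq> 0" for p L f
      using that g' new.tree_chart_axioms chart_class(2)[OF that(1)]
      unfolding chart_transition_def chart_transition_axioms_def R_nz w_def y_def D_def by auto
    \<comment> \<open>The translate of \<open>L0\<close> lies in the new chart, so its integral for
      this pair is nonzero, and \<open>w\<close> is a factor of that integral.\<close>
    have "w p0 i j \<noteq> 0" if "mark \<Gamma>' i \<noteq> mark \<Gamma>' j" for i j
    proof -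
      have "y p0 = line_chart \<Gamma> ij vt L0" using chart_class(2)[OF \<Gamma>(2)] by (simp add: y_def gx L0(2))
      then show ?thesis
        using t0.II_nz[OF that] unfolding base.II_translate by (simp add: w_def D_def[abs_def] gx)
    qed
    then have R0: "R p0 \<noteq> 0" unfolding R_nz by blast
    have "p0 \<in> U" using gx chart_class(1)[OF \<Gamma>(2)] L0(2) by (simp add: U_def)
    then have p0N: "p0 \<in> N" using R0 by (simp add: N_def)
    interpret base: chart_transition \<Gamma> ij vt L0 id \<Gamma>' ij' vt' g "\<alpha> (fst p0)"
      by (rule transition[OF \<Gamma>(2) _ R0]) (simp add: gx L0(2))
    \<comment> \<open>A step of \<open>\<kappa>\<close> between \<open>m - 1\<close> and
      \<open>m\<close> makes \<open>\<kappa> m\<close> positive, so it is the index of a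
      coordinate.\<close>
    have \<kappa>C: "(\<lambda>p. if \<kappa> m = \<kappa> (m - 1) then 1 else snd (y p) (\<kappa> m)) \<in> polys C"
      if "m \<in> {1..tree_length \<Gamma>'}" for m
    proof (cases "\<kappa> m = \<kappa> (m - 1)")
      case False
      have "\<kappa> = base.\<kappa>" by (intro ext) (simp add: \<kappa>_def base.\<kappa>_def)
      then have "\<kappa> m \<in> {1..tree_length \<Gamma>}"
        using base.\<kappa>_step[OF that] base.\<kappa>_le[of m] that False by auto
      then show ?thesis using tC False by simp
    qed (simp add: polys.const)

    have key: "?F p \<in> U' \<and>
        (\<forall>i j. i < j \<longrightarrow> fst (chart \<Gamma>' ij' vt' (?F p)) (i, j) = w p i j / W p (new.mlev i j)) \<and>
        (\<forall>m\<in>{1..tree_length \<Gamma>'}. snd (chart \<Gamma>' ij' vt' (?F p)) m =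
          (if \<kappa> m = \<kappa> (m - 1) then 1 else snd (y p) (\<kappa> m)) * W p m / W p (m - 1)) \<and>
        (\<forall>m\<le>tree_length \<Gamma>'. W p m \<noteq> 0)"
      if p: "p \<in> N" for p
    proof -
      obtain h x where hx: "p = (h, x)" "x \<in> chart_dom \<Gamma>" using p by (auto simp: N_def U_def)
      obtain L where L: "L \<in> stable_lines" "x = iso_rel `` {L}"
        using hx(2) chart_dom_subset by (blast elim: An_pointsE)
      then obtain f where f: "contraction \<Gamma> L f" "\<And>i j. mark \<Gamma> i \<noteq> mark \<Gamma> j \<Longrightarrow> PPi L i j \<noteq> Aff 0"
        using hx(2) class_in_chart_dom_iff[OF base.level_tree_axioms L(1)] by blast
      have cp: "chart_point \<Gamma> ij vt L f" by (rule base.chart_pointI[OF L(1) f])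
      interpret tr: chart_transition \<Gamma> ij vt L f \<Gamma>' ij' vt' g "\<alpha> (fst p)"
        by (rule transition[OF cp]) (use p hx L(2) in \<open>simp_all add: N_def\<close>)
      have y: "y p = line_chart \<Gamma> ij vt L" using chart_class(2)[OF cp] by (simp add: y_def hx(1) L(2))
      have F: "?F p = iso_rel `` {translate_line (\<alpha> (fst p)) L}"
        by (simp add: hx(1) L(2) act_class[OF L(1)])
      note cls = chart_class[OF tr.chart_point_translate, folded F]
      have w: "w p = tr.w" by (intro ext) (simp add: w_def y D_def[abs_def])
      have W: "W p = tr.W" by (intro ext) (simp add: W_def tr.W_def w)
      have \<kappa>: "\<kappa> = tr.\<kappa>" by (intro ext) (simp add: \<kappa>_def tr.\<kappa>_def)
      show ?thesis
        unfolding cls(2) U' w W \<kappa> y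
        using cls(1) tr.z_transition tr.t_transition tr.W_nz by blast
    qed
    have "\<exists>P\<in>polys C. \<exists>Q\<in>polys C. \<forall>p\<in>N. Q p \<noteq> 0 \<and> c (?F p) = P p / Q p" if c: "c \<in> C'" for c
    proof -
      consider (z) i j where "i < j" "c = (\<lambda>y. fst y (i, j)) \<circ> chart \<Gamma>' ij' vt'"
        | (t) m where "m \<in> {1..tree_length \<Gamma>'}" "c = (\<lambda>y. snd y m) \<circ> chart \<Gamma>' ij' vt'"
        using c unfolding C' target_coords_def by blast
      then show ?thesis
      proof cases
        case z
        show ?thesis
          by (rule bexI[OF bexI[OF _ WC[of "new.mlev i j"]] wC[of i j]])
            (use key z new.mlev_le in simp)
      next
        case t
        have "m - 1 \<le> tree_length \<Gamma>'" using t(1) by auto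
        then show ?thesis
          by (intro bexI[OF bexI[OF _ WC[of "m - 1"]] polys.mult[OF \<kappa>C[OF t(1)] WC[of m]]])
            (use key t in simp)
      qed
    qed
    moreover have "?F ` N \<subseteq> U'" using key by blast
    moreover have "N \<subseteq> U" by (auto simp: N_def)
    ultimately show "\<exists>U C N. (U, C) \<in> Ch \<and> openin (ztop (glue Ch)) N \<and> p0 \<in> N \<and> N \<subseteq> U \<and> ?F ` N \<subseteq> U' \<and>
        (\<forall>c\<in>C'. \<exists>P\<in>polys C. \<exists>Q\<in>polys C. \<forall>y\<in>N. Q y \<noteq> 0 \<and> c (?F y) = P y / Q y)"
      using UC openN p0N by blast
  qed
  then show ?thesis unfolding prod unfolding An .
qed

section \<open>The group and its quotient\<close>

text \<open>A \<open>group_action\<close> is a homomorphism into the extensional bijections of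
  \<open>E\<close>. Each map is bijective because the inverse element acts as its inverse.\<close>

lemma group_actionI:
  assumes G: "group G"
    and closed: "\<And>g x. g \<in> carrier G \<Longrightarrow> x \<in> E \<Longrightarrow> \<phi> g x \<in> E"
    and one: "\<And>x. x \<in> E \<Longrightarrow> \<phi> \<one>\<^bsub>G\<^esub> x = x"
    and mult: "\<And>g h x. g \<in> carrier G \<Longrightarrow> h \<in> carrier G \<Longrightarrow> x \<in> E \<Longrightarrow> \<phi> (g \<otimes>\<^bsub>G\<^esub> h) x = \<phi> g (\<phi> h x)"
  shows "group_action G E (\<lambda>g. \<lambda>x\<in>E. \<phi> g x)"
proof -
  interpret group G by (rule G)
  have bij: "(\<lambda>x\<in>E. \<phi> g x) \<in> Bij E" if g: "g \<in> carrier G" for g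
  proof -
    have "\<phi> g (\<phi> (inv\<^bsub>G\<^esub> g) x) = x" "\<phi> (inv\<^bsub>G\<^esub> g) (\<phi> g x) = x" if "x \<in> E" for x
      using that g one by (simp_all flip: mult)
    then have "bij_betw (\<phi> g) E E"
      using g closed by (intro bij_betwI[where g = "\<phi> (inv\<^bsub>G\<^esub> g)"]) auto
    then show ?thesis by (simp add: Bij_def cong: bij_betw_cong)
  qed
  have "(\<lambda>x\<in>E. \<phi> (g \<otimes>\<^bsub>G\<^esub> h) x) = (\<lambda>x\<in>E. \<phi> g x) \<otimes>\<^bsub>BijGroup E\<^esub> (\<lambda>x\<in>E. \<phi> h x)"
    if "g \<in> carrier G" "h \<in> carrier G" for g h
    using that mult closed bij by (auto simp: BijGroup_def compose_def intro!: restrict_ext)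
  then have "(\<lambda>g. \<lambda>x\<in>E. \<phi> g x) \<in> hom G (BijGroup E)"
    using bij by (intro homI) (simp_all add: BijGroup_def)
  then show ?thesis
    unfolding group_action_def group_hom_def group_hom_axioms_def using G group_BijGroup by blast
qed

lemma group_Ga_pow: "group (Ga_pow :: (complex ^ 'n::finite) monoid)"
proof (rule groupI)
  show "\<exists>y\<in>carrier Ga_pow. y \<otimes>\<^bsub>Ga_pow\<^esub> x = \<one>\<^bsub>Ga_pow\<^esub>" for x :: "complex ^ 'n"
    by (rule bexI[of _ "- x"]) (simp_all add: Ga_pow_def)
qed (simp_all add: Ga_pow_def add.assoc)

lemma normal_Diag: "Diag \<lhd> (Ga_pow :: (complex ^ 'n::finite) monoid)"
proof -
  interpret comm_group "Ga_pow :: (complex ^ 'n::finite) monoid"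
    by (intro group.group_comm_groupI group_Ga_pow) (simp add: Ga_pow_def add.commute)
  have inv: "inv\<^bsub>Ga_pow\<^esub> a = - a" for a :: "complex ^ 'n::finite"
    by (rule inv_equality) (simp_all add: Ga_pow_def)
  have "subgroup Diag (Ga_pow :: (complex ^ 'n::finite) monoid)"
  proof (rule subgroupI)
    show "inv\<^bsub>Ga_pow\<^esub> a \<in> Diag" if a: "a \<in> Diag" for a :: "complex ^ 'n::finite"
    proof -
      obtain c where "a = (\<chi> i. c)" using a by (auto simp: Diag_def)
      then have "- a = (\<chi> i. - c)" by (simp add: vec_eq_iff)
      then show ?thesis by (auto simp: inv Diag_def)
    qed
    show "a \<otimes>\<^bsub>Ga_pow\<^esub> b \<in> Diag" if ab: "a \<in> Diag" "b \<in> Diag" for a b :: "complex ^ 'n::finite"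
    proof -
      obtain c c' where "a = (\<chi> i. c)" "b = (\<chi> i. c')" using ab by (auto simp: Diag_def)
      then have "a + b = (\<chi> i. c + c')" by (simp add: vec_eq_iff)
      then show ?thesis by (auto simp: Ga_pow_def Diag_def)
    qed
  qed (auto simp: Ga_pow_def Diag_def)
  then show ?thesis by (rule subgroup_imp_normal)
qed

lemma Diag_coset: "Diag #>\<^bsub>Ga_pow\<^esub> a = range (\<lambda>c. a + (\<chi> i. c))"
  by (auto simp: r_coset_def Ga_pow_def Diag_def add.commute)

lemma coset_eqD:
  assumes "Diag #>\<^bsub>Ga_pow\<^esub> a = Diag #>\<^bsub>Ga_pow\<^esub> b"
  obtains c where "b = a + (\<chi> i. c)"
proof -
  have "b = b + (\<chi> i. 0)" by (simp add: vec_eq_iff)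
  then have "b \<in> Diag #>\<^bsub>Ga_pow\<^esub> b" unfolding Diag_coset by blast
  then show ?thesis using that assms unfolding Diag_coset by blast
qed

text \<open>Any two representatives differ by a diagonal element, which acts trivially and cancels
  in differences of components.\<close>

definition coset_rep :: "(complex ^ 'n::finite) set \<Rightarrow> complex ^ 'n" where
  "coset_rep g = (SOME a. g = Diag #>\<^bsub>Ga_pow\<^esub> a)"

lemma coset_rep:
  obtains c where "coset_rep (Diag #>\<^bsub>Ga_pow\<^esub> a) = a + (\<chi> i. c)"
proof (rule coset_eqD)
  show "Diag #>\<^bsub>Ga_pow\<^esub> a = Diag #>\<^bsub>Ga_pow\<^esub> coset_rep (Diag #>\<^bsub>Ga_pow\<^esub> a)"
    unfolding coset_rep_def
    by (rule someI[of "\<lambda>b. Diag #>\<^bsub>Ga_pow\<^esub> a = Diag #>\<^bsub>Ga_pow\<^esub> b"]) (rule refl)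
qed

lemma act_coset_rep:
  assumes "x \<in> An_points"
  shows "act (coset_rep (Diag #>\<^bsub>Ga_pow\<^esub> a)) x = act a x"
proof -
  obtain c where "coset_rep (Diag #>\<^bsub>Ga_pow\<^esub> a) = a + (\<chi> i. c)" by (rule coset_rep)
  then show ?thesis using act_add[OF assms, of a "\<chi> i. c"] act_diagonal[OF assms] by simp
qed

lemma topspace_affine_space [simp]: "topspace (ztop affine_space) = UNIV"
  by (simp add: affine_space_def topspace_glue)

lemma regfun_affine_diff: "(\<lambda>a. vec_nth a j - vec_nth a i) \<in> regfun affine_space UNIV"
proof -
  let ?Ch = "{(UNIV, range (\<lambda>i a. vec_nth a i))}"
  have "openin (ztop (glue ?Ch)) UNIV" by (rule openin_glue_chart) blast
  moreover have "(\<lambda>a. vec_nth a j - vec_nth a i) \<in> polys (range (\<lambda>i a. vec_nth a i))"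
    by (intro polys_diff polys.gen) auto
  ultimately show ?thesis
    unfolding affine_space_def regfun_glue using polys.const[of 1]
    by (intro ballI bexI[of _ "(UNIV, range (\<lambda>i a. vec_nth a i))"] case_prodI
        bexI[of _ "\<lambda>a. vec_nth a j - vec_nth a i"] bexI[of _ "\<lambda>_. 1"] exI[of _ UNIV]) auto
qed

lemma topspace_quot_fspace: "topspace (ztop (quot_fspace X q)) = q ` topspace (ztop X)"
proof -
  have "{x \<in> topspace (ztop X). q x \<in> q ` topspace (ztop X)} = topspace (ztop X)" by blast
  then have "q ` topspace (ztop X) \<in> {W. W \<subseteq> q ` topspace (ztop X) \<and>
      openin (ztop X) {x \<in> topspace (ztop X). q x \<in> W}}" by simp
  then show ?thesis unfolding quot_fspace_def by (auto simp: topology_generated_by_topspace)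
qed

text \<open>Regularity on the quotient is tested after composing with the projection, where the
  diagonal ambiguity of the representative cancels in the difference.\<close>

lemma regfun_quot_diff:
  defines "X \<equiv> quot_fspace affine_space (\<lambda>a. Diag #>\<^bsub>Ga_pow\<^esub> a)"
  shows "(\<lambda>g. vec_nth (coset_rep g) j - vec_nth (coset_rep g) i) \<in> regfun X (topspace (ztop X))"
proof -
  have "vec_nth (coset_rep (Diag #>\<^bsub>Ga_pow\<^esub> a)) j - vec_nth (coset_rep (Diag #>\<^bsub>Ga_pow\<^esub> a)) i =
      vec_nth a j - vec_nth a i" for a
  proof -
    obtain c where "coset_rep (Diag #>\<^bsub>Ga_pow\<^esub> a) = a + (\<chi> i. c)" by (rule coset_rep)
    then show ?thesis by simp
  qed
  then have "(\<lambda>g. vec_nth (coset_rep g) j - vec_nth (coset_rep g) i) \<circ> (\<lambda>a. Diag #>\<^bsub>Ga_pow\<^esub> a) =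
      (\<lambda>a. vec_nth a j - vec_nth a i)" by (simp add: fun_eq_iff)
  then show ?thesis
    unfolding X_def topspace_quot_fspace using regfun_affine_diff by (simp add: quot_fspace_def)
qed

section \<open>Irreducible lines\<close>

lemma irreducible_line_simps [simp]:
  "verts (irreducible_line z) = {0}" "adj (irreducible_line z) = {}" "vroot (irreducible_line z) = 0"
  "pre (irreducible_line z) = {(0, 0)}" "mark (irreducible_line z) i = 0"
  "pinf (irreducible_line z) = Inf1" "form (irreducible_line z) v = (\<lambda>_. 1)"
  "pt (irreducible_line z) i = Aff (vec_nth z i)"
  by (simp_all add: irreducible_line_def)

lemma desc_irreducible_line [simp]: "desc (irreducible_line z) 0 = Inf1"
  by (simp add: desc_def)

text \<open>The only vertex is both root and terminal. Stability asks for a mark on it, which exists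
  because the index type is nonempty.\<close>

lemma irreducible_line_stable: "irreducible_line z \<in> stable_lines"
proof -
  let ?L = "irreducible_line z"
  have walk: "simple_walk ?L 0 xs 0 \<longleftrightarrow> xs = [0]" for xs
  proof
    assume w: "simple_walk ?L 0 xs 0"
    then obtain ys where "xs = 0 # ys" by (cases xs) (auto simp: simple_walk_def)
    then show "xs = [0]" using w by (cases ys) (auto simp: simple_walk_def)
  qed (simp add: simple_walk_def)
  have n: "nbrs ?L v = {}" for v by (simp add: nbrs_def)
  have t: "is_terminal ?L v \<longleftrightarrow> v = 0" for v by (auto simp: is_terminal_def)
  have "multiscaled_line ?L"
    unfolding multiscaled_line_def
    by (auto simp: is_tree_def walk n t same_level_def only_double_pole_dz preorder_on_def refl_on_def
        trans_def total_on_def sym_def irrefl_def)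
  then show ?thesis
    by (auto simp: stable_lines_def marked_multiscaled_line_def stable_def t n)
qed

text \<open>The identity is an affine coordinate of \<open>dz\<close>.\<close>

lemma translate_irreducible_line:
  "translate_line a (irreducible_line z) = irreducible_line (z + a)"
proof -
  have "affine_coord (\<lambda>_. 1) Inf1 (moebius 1 0 0 1)"
    using pullback_moebius_dz[of 1 1 0 0] is_moebius_affine[of 1 0]
    by (simp add: affine_coord_def moebius_form_1)
  then have "translate_point (\<lambda>_. 1) Inf1 b (Aff w) = Aff (w + b)" for b w
    by (rule translate_point_eqI) simp_all
  then show ?thesis by (simp add: translate_line_def) (simp add: irreducible_line_def)
qed

text \<open>Simultaneous translation gives an isomorphic line, so the union over the orbit is a
  single class.\<close>

lemma incl_transl_orbit: "incl (transl_orbit z) = iso_rel `` {irreducible_line z}"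
proof -
  have "iso_rel `` {irreducible_line (z + (\<chi> i. c))} = iso_rel `` {irreducible_line z}" for c
    unfolding translate_irreducible_line[symmetric]
    by (rule iso_class_eq[OF stable_line.translate_diagonal_iso, symmetric])
      (rule stable_line.intro[OF irreducible_line_stable])
  then show ?thesis by (auto simp: incl_def transl_orbit_def)
qed

theorem proposition3p27:
  shows
    "(\<forall>a :: complex ^ 'n::{finite,linorder}. \<forall>L \<in> stable_lines.
        translate_line a L \<in> stable_lines \<and>
        act a (iso_rel `` {L}) = iso_rel `` {translate_line a L}) \<and>
     group_action (Ga_pow :: (complex ^ 'n::{finite,linorder}) monoid) An_points (\<lambda>a. \<lambda>x\<in>An_points. act a x) \<and>
     is_morphism (prod_fspace affine_space An) An (\<lambda>(a :: complex ^ 'n::{finite,linorder}, x). act a x) \<and>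
     (\<exists>\<beta> :: (complex ^ 'n::{finite,linorder}) set \<Rightarrow> ('n::{finite,linorder}) mline set \<Rightarrow> ('n::{finite,linorder}) mline set.
        (\<forall>a. \<forall>x\<in>An_points. \<beta> (Diag #>\<^bsub>Ga_pow\<^esub> a) x = act a x) \<and>
        group_action (Ga_pow Mod Diag) An_points (\<lambda>g. \<lambda>x\<in>An_points. \<beta> g x) \<and>
        is_morphism (prod_fspace (quot_fspace affine_space (\<lambda>a. Diag #>\<^bsub>Ga_pow\<^esub> a)) An) An
          (\<lambda>(g, x). \<beta> g x) \<and>
        (\<forall>a z. incl (transl_orbit (a + z)) = \<beta> (Diag #>\<^bsub>Ga_pow\<^esub> a) (incl (transl_orbit z))))"
proof (intro conjI allI ballI exI[of _ "\<lambda>g. act (coset_rep g)"])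
  fix a :: "complex ^ 'n::{finite,linorder}" and L :: "'n mline" assume L: "L \<in> stable_lines"
  show "translate_line a L \<in> stable_lines"
    by (rule stable_line.translate_line_stable[OF stable_line.intro[OF L]])
  show "act a (iso_rel `` {L}) = iso_rel `` {translate_line a L}" by (rule act_class[OF L])
next
  show "group_action (Ga_pow :: (complex ^ 'n::{finite,linorder}) monoid) An_points
      (\<lambda>a. \<lambda>x\<in>An_points. act a x)"
    by (intro group_actionI group_Ga_pow) (simp_all add: Ga_pow_def act_closed act_0 act_add)
next
  show "is_morphism (prod_fspace affine_space An) An (\<lambda>(a :: complex ^ 'n::{finite,linorder}, x). act a x)"
    by (rule is_morphism_act) (simp add: regfun_affine_diff)
next
  show "act (coset_rep (Diag #>\<^bsub>Ga_pow\<^esub> a)) x = act a x" if "x \<in> An_points"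
    for a :: "complex ^ 'n::{finite,linorder}" and x by (rule act_coset_rep[OF that])
next
  interpret normal Diag "Ga_pow :: (complex ^ 'n::{finite,linorder}) monoid" by (rule normal_Diag)
  have carrier: "g \<in> carrier (Ga_pow Mod Diag) \<Longrightarrow> \<exists>a. g = Diag #>\<^bsub>Ga_pow\<^esub> a"
    for g :: "(complex ^ 'n::{finite,linorder}) set" by (auto simp: FactGroup_def RCOSETS_def)
  show "group_action (Ga_pow Mod (Diag :: (complex ^ 'n::{finite,linorder}) set)) An_points
      (\<lambda>g. \<lambda>x\<in>An_points. act (coset_rep g) x)"
  proof (rule group_actionI)
    show "group (Ga_pow Mod (Diag :: (complex ^ 'n::{finite,linorder}) set))" by (rule factorgroup_is_group)
  next
    fix g :: "(complex ^ 'n::{finite,linorder}) set" and x :: "'n mline set" assume "x \<in> An_points"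
    then show "act (coset_rep g) x \<in> An_points" by (rule act_closed)
  next
    fix x :: "'n mline set" assume x: "x \<in> An_points"
    have "\<one>\<^bsub>Ga_pow Mod Diag\<^esub> = Diag #>\<^bsub>Ga_pow\<^esub> (0 :: complex ^ 'n::{finite,linorder})"
      by (auto simp: FactGroup_def Diag_coset) (auto simp: Diag_def)
    then show "act (coset_rep \<one>\<^bsub>Ga_pow Mod Diag\<^esub>) x = x"
      by (simp only: act_coset_rep[OF x] act_0[OF x])
  next
    fix g h :: "(complex ^ 'n::{finite,linorder}) set" and x :: "'n mline set"
    assume gh: "g \<in> carrier (Ga_pow Mod Diag)" "h \<in> carrier (Ga_pow Mod Diag)" and x: "x \<in> An_points"
    obtain a b where ab: "g = Diag #>\<^bsub>Ga_pow\<^esub> a" "h = Diag #>\<^bsub>Ga_pow\<^esub> b" using carrier gh by blast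
    have gh: "g \<otimes>\<^bsub>Ga_pow Mod Diag\<^esub> h = Diag #>\<^bsub>Ga_pow\<^esub> (a + b)"
      using rcos_sum[of a b] by (simp add: ab FactGroup_def Ga_pow_def)
    show "act (coset_rep (g \<otimes>\<^bsub>Ga_pow Mod Diag\<^esub> h)) x = act (coset_rep g) (act (coset_rep h) x)"
      unfolding gh
      by (simp only: ab act_coset_rep[OF x] act_coset_rep[OF act_closed[OF x]]) (rule act_add[OF x, symmetric])
  qed
next
  show "is_morphism (prod_fspace (quot_fspace affine_space (\<lambda>a. Diag #>\<^bsub>Ga_pow\<^esub> a)) An) An
      (\<lambda>(g, x :: 'n::{finite,linorder} mline set). act (coset_rep g) x)"
    by (rule is_morphism_act) (rule regfun_quot_diff)
next
  fix a z :: "complex ^ 'n::{finite,linorder}"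
  have "act a (iso_rel `` {irreducible_line z}) = iso_rel `` {irreducible_line (a + z)}"
    by (simp add: act_class[OF irreducible_line_stable] translate_irreducible_line add.commute)
  then show "incl (transl_orbit (a + z)) =
      act (coset_rep (Diag #>\<^bsub>Ga_pow\<^esub> a)) (incl (transl_orbit z))"
    by (simp add: incl_transl_orbit act_coset_rep An_pointsI irreducible_line_stable)
qed

end
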